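(* Let $m\ge 2$ and let $K \subset \mathbb{R}^m$ be a convex body with $C^2$-class boundary that contains all its centres of curvature. Consider the deformation $C : \mathbb{S}^{m-1} \times [0,T) \to \mathbb{R}^m$ of the embedding $C(\mathbb{S}^{m-1},0) = \mathrm{bd}\,K$ satisfying $$\frac{\partial C}{\partial t} = N,$$ where $N$ is the outer unit normal of $C$. For any $t \in [0,T)$, let $K(t)$ denote the convex body bounded by $C(\mathbb{S}^{m-1},t)$. If $K$ is not a Euclidean ball, then $n(K(t))$ is a strictly decreasing function of $t$. If $K$ is a Euclidean ball, then $n(K(t)) = 2$ for every value of $t$.
   Context: A convex body in $\mathbb{R}^m$ is a compact convex set with nonempty interior; $\mathrm{bd}\,K$ denotes its boundary, $\mathrm{vol}$ denotes $m$-dimensional Lebesgue measure and $\mathbb{S}^{m-1}$ is the unit sphere of $\mathbb{R}^m$. For a convex body $K$ and $q \in \mathrm{bd}\,K$, a line starting at $q$ and perpendicular to a supporting hyperplane of $K$ at $q$ is called a normal of $K$ at $q$. For $p \in K$, $n(K,p)$ denotes the number of normals of $K$ passing through $p$; normals are counted according to their starting points, so a line that is a normal at both of its boundary points is counted twice. Set $$I(K) = \int_{K} n(K,p)\, dp, \qquad n(K) = \frac{I(K)}{\mathrm{vol}(K)}.$$ If $\mathrm{bd}\,K$ is of class $C^2$, the centres of curvature of $K$ at $q\in \mathrm{bd}\,K$ are the points $q + \rho \nu(q)$, where $\nu(q)$ is the inner unit normal at $q$ and $\rho = 1/\kappa$ runs over the principal radii of curvature at $q$ ($\kappa$ a nonzero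 principal curvature of $\mathrm{bd}\,K$ at $q$). In the flow equation, $N$ at $(u,t)$ is the outer unit normal of the hypersurface $C(\mathbb{S}^{m-1},t)$ at $C(u,t)$. *)

theory Defs
  imports "HOL-Analysis.Analysis"
begin

definition convex_body :: "'a::euclidean_space set \<Rightarrow> bool" where
  "convex_body K \<longleftrightarrow> compact K \<and> convex K \<and> interior K \<noteq> {}"

definition supporting_at :: "'a::euclidean_space set \<Rightarrow> 'a \<Rightarrow> 'a \<Rightarrow> bool" where
  "supporting_at K q v \<longleftrightarrow> q \<in> frontier K \<and> v \<noteq> 0 \<and> (\<forall>x\<in>K. v \<bullet> x \<le> v \<bullet> q)"

definition normal_line :: "'a::euclidean_space set \<Rightarrow> 'a \<Rightarrow> 'a set \<Rightarrow> bool" where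
  "normal_line K q L \<longleftrightarrow> (\<exists>v. supporting_at K q v \<and> L = range (\<lambda>s. q + s *\<^sub>R v))"

text \<open>Normals are counted with their starting points, hence the pairs \<open>(q, L)\<close>. The number may be
  infinite (as for the centre of a ball), so it is taken in \<^typ>\<open>ennreal\<close>.\<close>

definition num_normals :: "'a::euclidean_space set \<Rightarrow> 'a \<Rightarrow> ennreal" where
  "num_normals K p = emeasure (count_space UNIV) {(q, L). normal_line K q L \<and> p \<in> L}"

definition normal_integral :: "'a::euclidean_space set \<Rightarrow> ennreal" where
  "normal_integral K = (\<integral>\<^sup>+p\<in>K. num_normals K p \<partial>lebesgue)"

definition mean_normals :: "'a::euclidean_space set \<Rightarrow> ennreal" where
  "mean_normals K = normal_integral K / emeasure lebesgue K"

text \<open>Near \<open>x\<close>, the set \<open>S\<close> is the zero set of the \<open>C\<^sup>1\<close> function \<open>f\<close>, whose gradient \<open>g\<close> does not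
  vanish on \<open>U\<close>.\<close>

definition local_equation ::
    "'a::euclidean_space set \<Rightarrow> 'a \<Rightarrow> 'a set \<Rightarrow> ('a \<Rightarrow> real) \<Rightarrow> ('a \<Rightarrow> 'a) \<Rightarrow> bool" where
  "local_equation S x U f g \<longleftrightarrow>
     open U \<and> x \<in> U \<and> S \<inter> U = {y \<in> U. f y = 0} \<and>
     (\<forall>y\<in>U. GDERIV f y :> g y \<and> g y \<noteq> 0) \<and> continuous_on U g"

definition C2_hypersurface :: "'a::euclidean_space set \<Rightarrow> bool" where
  "C2_hypersurface S \<longleftrightarrow>
     (\<forall>x\<in>S. \<exists>U f g. \<exists>H :: 'a \<Rightarrow> 'a \<Rightarrow>\<^sub>L 'a.
        local_equation S x U f g \<and>
        (\<forall>y\<in>U. (g has_derivative blinfun_apply (H y)) (at y)) \<and> continuous_on U H)"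

text \<open>A unit vector orthogonal to the tangent space of \<open>S\<close> at \<open>x\<close>, i.e. parallel to the gradient of a
  local equation, that points into the unbounded side of \<open>S\<close>. In particular it presupposes that
  \<open>S\<close> is a \<open>C\<^sup>1\<close> hypersurface near \<open>x\<close>.\<close>

definition outer_unit_normal :: "'a::euclidean_space set \<Rightarrow> 'a \<Rightarrow> 'a \<Rightarrow> bool" where
  "outer_unit_normal S x v \<longleftrightarrow>
     x \<in> S \<and> norm v = 1 \<and>
     (\<exists>U f g. local_equation S x U f g \<and> v \<in> span {g x}) \<and>
     (\<exists>e>0. \<forall>s\<in>{0<..<e}. x + s *\<^sub>R v \<in> outside S)"

definition enclosed_body :: "'a::euclidean_space set \<Rightarrow> 'a set" where
  "enclosed_body S = S \<union> inside S"

definition inner_normal :: "'a::euclidean_space set \<Rightarrow> 'a \<Rightarrow> 'a" where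
  "inner_normal K q = (THE v. norm v = 1 \<and> (\<forall>x\<in>K. v \<bullet> q \<le> v \<bullet> x))"

text \<open>The principal curvatures are the eigenvalues of the Weingarten map: minus the differential of
  the inner unit normal, on the tangent space at \<open>q\<close>. With the inner normal the sign makes them
  nonnegative for a convex body (a sphere of radius \<open>r\<close> has curvatures \<open>1 / r\<close>). A derivative
  within \<^term>\<open>frontier K\<close> is determined only on the tangent space, which is all that is used.\<close>

definition principal_curvature :: "'a::euclidean_space set \<Rightarrow> 'a \<Rightarrow> real \<Rightarrow> bool" where
  "principal_curvature K q k \<longleftrightarrow>
     (\<exists>D w. (inner_normal K has_derivative D) (at q within frontier K) \<and>
            w \<noteq> 0 \<and> w \<bullet> inner_normal K q = 0 \<and> D w = - k *\<^sub>R w)"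

definition centres_of_curvature :: "'a::euclidean_space set \<Rightarrow> 'a set" where
  "centres_of_curvature K =
     {q + (1 / k) *\<^sub>R inner_normal K q | q k. q \<in> frontier K \<and> principal_curvature K q k \<and> k \<noteq> 0}"

text \<open>Only the initial map is required to be an embedding; that \<open>C u t\<close> lies on a \<open>C\<^sup>1\<close> hypersurface
  at later times is part of \<open>N u t\<close> being an outer unit normal.\<close>

definition outer_normal_flow ::
    "real \<Rightarrow> 'a::euclidean_space set \<Rightarrow> ('a \<Rightarrow> real \<Rightarrow> 'a) \<Rightarrow> ('a \<Rightarrow> real \<Rightarrow> 'a) \<Rightarrow> bool" where
  "outer_normal_flow T S0 C N \<longleftrightarrow>
     continuous_on (sphere 0 1 \<times> {0..<T}) (\<lambda>(u, t). C u t) \<and>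
     embedding_map (top_of_set (sphere 0 1)) euclidean (\<lambda>u. C u 0) \<and>
     (\<lambda>u. C u 0) ` sphere 0 1 = S0 \<and>
     (\<forall>u\<in>sphere 0 1. \<forall>t\<in>{0..<T}.
        outer_unit_normal ((\<lambda>u. C u t) ` sphere 0 1) (C u t) (N u t) \<and>
        (C u has_vector_derivative N u t) (at t within {0..<T}))"

end

theory Submission
  imports Defs
begin

text \<open>The flow moves the boundary of \<open>K\<close> along its outer normals at unit speed, so \<open>K(t)\<close> is the parallel body
  \<open>K + t B\<close>.  Parallel bodies have the same normal lines; hence \<open>n(K(t), p) = n(K, p)\<close> for every point
  \<open>p\<close>, and only the domain of integration changes.  Outside \<open>K\<close> every point lies on exactly two normals,
  since the focal set is contained in \<open>K\<close>.  Therefore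
  \<open>n(K(t)) = 2 + (I(K) - 2 vol K) / vol K(t)\<close>, and the theorem amounts to \<open>2 vol K < I(K) < \<infinity>\<close> when \<open>K\<close>
  is not a ball.  For a ball, every point except the centre lies on exactly two normals.

  The flow (\<open>flow_parallel_body\<close>).  The moving surface is compared with balls: at the point of
  the surface nearest to an interior point \<open>y\<close> of \<open>K\<close>, the surface
  is tangent to a ball around \<open>y\<close> and its outer normal points away from \<open>y\<close>.  So the distance
  from \<open>y\<close> grows at unit rate, and \<open>y\<close> stays inside by a homotopy argument.  These balls exhaust the
  interior of the parallel body.

  Two normals outside \<open>K\<close> (\<open>unique_reflection\<close>).  A centre of curvature in \<open>K\<close> bounds its
  curvature away from zero.  As the least curvature is continuous on the connected boundary and positive
  somewhere, all curvatures are positive (\<open>shape_injective\<close>), and the Gauss map is injective and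
  locally expanding.  The map \<open>q - s \<nu>(q) \<mapsto> q + s \<nu>(q)\<close>, with \<open>s > 0\<close> and \<open>\<nu>\<close> the inner unit normal,
  is a local homeomorphism over the complement of \<open>K\<close>, because it degenerates only at centres of
  curvature.  The points outside \<open>K\<close> with several preimages form an open and closed set.  It is not the whole
  complement, as distant points have only one; so it is empty.

  Finiteness (\<open>Lipschitz_fibre_count\<close>).  The same map is Lipschitz, and the fibre count of a Lipschitz
  map on a bounded set is measurable with finite integral.

  The strict inequality (\<open>ex_open_three_normals\<close>).  Every interior point has a nearest and
  a farthest boundary point.  On the normal at some boundary point \<open>q\<close>, the positions that have \<open>q\<close> as a nearest
  point and those that have it as a farthest point are closed and, unless \<open>K\<close> is a ball, disjoint;
  they cannot cover the connected segment inside \<open>K\<close>.  Near a nonfocal position between them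
  there are at least three normals, on an open set.\<close>

section \<open>Convex bodies and their parallel bodies\<close>

definition parallel_body :: "'a::euclidean_space set \<Rightarrow> real \<Rightarrow> 'a set" where
  "parallel_body K t = {x. infdist x K \<le> t}"

locale body =
  fixes K :: "'a::euclidean_space set"
  assumes convex_body: "convex_body K"
begin

lemma compact_K: "compact K" and convex_K: "convex K" and interior_K: "interior K \<noteq> {}"
  using convex_body unfolding convex_body_def by auto

lemma closed_K: "closed K" and bounded_K: "bounded K"
  using compact_K by (auto intro: compact_imp_closed compact_imp_bounded)

lemma nonempty_K: "K \<noteq> {}"
  using interior_K interior_subset by blast

lemma closure_interior_K: "closure (interior K) = K"
  using convex_closure_interior [OF convex_K interior_K] closed_K by simp

lemma closest_in: "closest_point K x \<in> K"
  using closest_point_in_set [OF closed_K nonempty_K] .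

lemma infdist_eq: "infdist x K = dist x (closest_point K x)"
  using setdist_closest_point [OF closed_K nonempty_K] by (simp add: infdist_eq_setdist)

lemma infdist_eq_0: "infdist x K = 0 \<longleftrightarrow> x \<in> K"
  using in_closed_iff_infdist_zero [OF closed_K nonempty_K] by simp

text \<open>As a Minkowski sum with a ball, the parallel body inherits compactness and convexity.\<close>

lemma parallel_body_eq_sums: "parallel_body K t = (\<Union>x\<in>K. \<Union>y\<in>cball 0 t. {x + y})" (is "?l = ?r")
proof (intro set_eqI iffI)
  fix x assume "x \<in> ?l"
  then have "x - closest_point K x \<in> cball 0 t"
    unfolding parallel_body_def infdist_eq by (simp add: dist_norm norm_minus_commute)
  moreover have "x = closest_point K x + (x - closest_point K x)" by simp
  ultimately show "x \<in> ?r" using closest_in by blast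
next
  fix x assume "x \<in> ?r"
  then obtain q w where "q \<in> K" "norm w \<le> t" "x = q + w" by auto
  then show "x \<in> ?l"
    unfolding parallel_body_def by (auto intro!: infdist_le2 simp: dist_norm)
qed

lemma compact_parallel_body: "compact (parallel_body K t)"
  unfolding parallel_body_eq_sums by (intro compact_sums' compact_K compact_cball)

lemma convex_parallel_body: "convex (parallel_body K t)"
  unfolding parallel_body_eq_sums by (intro convex_sums convex_K convex_cball)

lemma subset_parallel_body: "t \<ge> 0 \<Longrightarrow> K \<subseteq> parallel_body K t"
  unfolding parallel_body_def by auto

lemma parallel_body_0: "parallel_body K 0 = K"
  unfolding parallel_body_def using infdist_eq_0 infdist_nonneg [of _ K] by (auto intro: antisym)

lemma convex_body_parallel_body: "t \<ge> 0 \<Longrightarrow> convex_body (parallel_body K t)"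
  using compact_parallel_body convex_parallel_body interior_K interior_mono [OF subset_parallel_body]
  unfolding convex_body_def by blast

text \<open>All points of the ray from the closest point through \<^term>\<open>x\<close> have the same closest point, so the
  distance to \<open>K\<close> grows at unit rate along it.\<close>

lemma closest_point_beyond:
  assumes "s \<ge> 0"
  shows "closest_point K (closest_point K x + s *\<^sub>R (x - closest_point K x)) = closest_point K x"
proof (rule closest_point_unique [OF convex_K closed_K closest_in, symmetric], rule ballI)
  fix z assume z: "z \<in> K"
  let ?p = "closest_point K x"
  have "(x - ?p) \<bullet> (z - ?p) \<le> 0" by (rule closest_point_dot [OF convex_K closed_K z])
  then have le: "s * ((x - ?p) \<bullet> (z - ?p)) \<le> 0" using assms by (simp add: mult_nonneg_nonpos)
  have "(norm (s *\<^sub>R (x - ?p)))\<^sup>2 \<le> (norm (s *\<^sub>R (x - ?p)))\<^sup>2 - 2 * (s * ((x - ?p) \<bullet> (z - ?p))) + (norm (z - ?p))\<^sup>2"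
    using le by (smt (verit) zero_le_power2)
  also have "\<dots> = (norm (s *\<^sub>R (x - ?p) - (z - ?p)))\<^sup>2"
    by (simp only: power2_norm_eq_inner inner_diff_left inner_diff_right inner_scaleR_left inner_scaleR_right)
       (simp add: inner_commute algebra_simps)
  finally have "norm (s *\<^sub>R (x - ?p)) \<le> norm (s *\<^sub>R (x - ?p) - (z - ?p))"
    by (simp add: power2_le_iff_abs_le)
  then show "dist (?p + s *\<^sub>R (x - ?p)) ?p \<le> dist (?p + s *\<^sub>R (x - ?p)) z"
    by (simp add: dist_norm algebra_simps)
qed

lemma interior_parallel_body:
  assumes "t > 0"
  shows "interior (parallel_body K t) = {x. infdist x K < t}"
proof
  have "open {x. infdist x K < t}"
    by (intro open_Collect_less continuous_intros)
  then show "{x. infdist x K < t} \<subseteq> interior (parallel_body K t)"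
    by (intro interior_maximal) (auto simp: parallel_body_def)
next
  show "interior (parallel_body K t) \<subseteq> {x. infdist x K < t}"
  proof (rule ccontr)
    assume "\<not> ?thesis"
    then obtain x where x: "x \<in> interior (parallel_body K t)" and ge: "infdist x K \<ge> t" by force
    let ?p = "closest_point K x"
    obtain e where e: "e > 0" "ball x e \<subseteq> parallel_body K t"
      using x by (meson mem_interior)
    have d: "dist x ?p \<ge> t" using ge by (simp add: infdist_eq)
    define s where "s = e / (2 * dist x ?p)"
    have "dist x ?p > 0" using d assms by linarith
    then have s: "s > 0" using e by (simp add: s_def)
    let ?y = "?p + (1 + s) *\<^sub>R (x - ?p)"
    have "dist x ?y = s * dist x ?p" using s by (simp add: dist_norm algebra_simps flip: scaleR_diff_right)
    also have "\<dots> < e" using e d assms by (simp add: s_def)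
    finally have "infdist ?y K \<le> t" using e by (auto simp: parallel_body_def)
    moreover have "infdist ?y K = (1 + s) * dist x ?p"
      using s by (simp add: infdist_eq closest_point_beyond) (simp add: dist_norm)
    moreover have "(1 + s) * dist x ?p > t"
      using s d assms by (smt (verit) mult_less_cancel_right1 mult_less_cancel_right2)
    ultimately show False by simp
  qed
qed

end

section \<open>The outer normal flow produces the parallel bodies\<close>

text \<open>A hypersurface avoiding an open ball, but meeting its boundary sphere at \<open>x\<close>, is tangent to
  that sphere: its local equation keeps one sign on the ball near \<open>x\<close>, so the gradient is
  nonnegative on the open half-space of directions entering the ball.\<close>

lemma gradient_at_touching_ball:
  fixes S :: "'a::euclidean_space set"
  assumes le: "local_equation S x U f g" and x: "x \<in> S"
    and disj: "S \<inter> ball y r = {}" and d: "dist y x = r" and r: "r > 0"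
  shows "\<exists>c. g x = c *\<^sub>R (x - y)"
proof -
  from le have U: "open U" "x \<in> U" "S \<inter> U = {y\<in>U. f y = 0}" "continuous_on U f"
      and gr: "GDERIV f x :> g x" "g x \<noteq> 0"
    unfolding local_equation_def gderiv_def
    by (auto intro!: has_derivative_continuous_on intro: has_derivative_at_withinI)
  have fx: "f x = 0" using x U by auto
  obtain e where e: "e > 0" "ball x e \<subseteq> U" using U by (meson openE)
  let ?B = "ball x e \<inter> ball y r"
  have conn: "connected (f ` ?B)"
    using U(4) e by (intro connected_continuous_image convex_connected convex_Int convex_ball)
      (auto intro: continuous_on_subset)
  have nz: "0 \<notin> f ` ?B" using U e disj by auto
  have "(\<forall>z\<in>?B. f z \<ge> 0) \<or> (\<forall>z\<in>?B. f z \<le> 0)"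
  proof (rule ccontr)
    assume "\<not> ?thesis"
    then obtain a b where "a \<in> ?B" "b \<in> ?B" "f a \<le> 0" "0 \<le> f b" by force
    then have "0 \<in> f ` ?B"
      using connectedD_interval [OF conn] by blast
    then show False using nz by simp
  qed
  then obtain \<sigma> :: real where \<sigma>: "\<sigma> \<noteq> 0" "\<forall>z\<in>?B. \<sigma> * f z \<ge> 0"
    by (metis mult_1 mult_minus_left neg_0_le_iff_le one_neq_neg_one zero_neq_one neg_equal_0_iff_equal)
  have half: "\<sigma> * (w \<bullet> g x) \<ge> 0" if w: "w \<bullet> (y - x) > 0" for w
  proof -
    have "((\<lambda>s. \<sigma> * f (x + s *\<^sub>R w)) has_derivative (\<lambda>s. \<sigma> * ((s *\<^sub>R w) \<bullet> g x))) (at 0)"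
    proof -
      have "((\<lambda>s. x + s *\<^sub>R w) has_derivative (\<lambda>s. s *\<^sub>R w)) (at 0)"
        by (auto intro!: derivative_eq_intros)
      moreover have "(f has_derivative (\<lambda>h. h \<bullet> g x)) (at (x + 0 *\<^sub>R w))"
        using gr unfolding gderiv_def by simp
      ultimately show ?thesis
        by (intro has_derivative_mult_right) (rule has_derivative_compose [where g=f])
    qed
    then have der: "((\<lambda>s. \<sigma> * f (x + s *\<^sub>R w)) has_real_derivative \<sigma> * (w \<bullet> g x)) (at 0)"
      
      by (rule has_derivative_imp_has_field_derivative) (simp add: mult_ac)
    have neg: "\<exists>d>0. \<forall>h>0. h < d \<longrightarrow> \<sigma> * f (x + h *\<^sub>R w) < 0" if "\<sigma> * (w \<bullet> g x) < 0"
      using DERIV_neg_dec_right [OF der that] fx by simp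
    have "\<exists>d>0. \<forall>h>0. h < d \<longrightarrow> x + h *\<^sub>R w \<in> ?B"
    proof -
      have w0: "w \<noteq> 0" using w by auto
      define d where "d = min (e / norm w) (2 * (w \<bullet> (y - x)) / (norm w)\<^sup>2)"
      have "d > 0" using w0 w e by (simp add: d_def)
      moreover have "x + h *\<^sub>R w \<in> ?B" if h: "h > 0" "h < d" for h
      proof -
        have "h * norm w < e" using h w0 by (simp add: d_def pos_less_divide_eq)
        moreover have "h * (norm w)\<^sup>2 < 2 * (w \<bullet> (y - x))" using h w0 by (simp add: d_def pos_less_divide_eq)
        then have "h * (h * (norm w)\<^sup>2) < h * (2 * (w \<bullet> (y - x)))" using h by simp
        then have "(norm ((y - x) - h *\<^sub>R w))\<^sup>2 < (norm (y - x))\<^sup>2"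
          unfolding power2_norm_eq_inner inner_diff_left inner_diff_right
          by (simp add: inner_commute algebra_simps)
        then have "norm ((y - x) - h *\<^sub>R w) < norm (y - x)"
          by (rule power_less_imp_less_base) simp
        then have "dist y (x + h *\<^sub>R w) < r" using d by (simp add: dist_norm algebra_simps)
        ultimately show ?thesis using h by (simp add: dist_norm)
      qed
      ultimately show ?thesis by blast
    qed
    then obtain d where d: "d > 0" "\<forall>h>0. h < d \<longrightarrow> x + h *\<^sub>R w \<in> ?B" by blast
    show ?thesis
    proof (rule ccontr)
      assume "\<not> ?thesis"
      with neg obtain d' where d': "d' > 0" "\<forall>h>0. h < d' \<longrightarrow> \<sigma> * f (x + h *\<^sub>R w) < 0" by force
      define h where "h = min d d' / 2"
      have "h > 0" "h < d" "h < d'" using d(1) d'(1) by (auto simp: h_def)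
      then show False using d d' \<sigma>(2) by (meson less_le_not_le)
    qed
  qed
  \<comment> \<open>otherwise tilting the direction \<open>y - x\<close> by a large multiple of the tangential part of the
    gradient leaves the half-space where the gradient is nonnegative\<close>
  define a where "a = y - x"
  define k where "k = (g x \<bullet> a) / (a \<bullet> a)"
  have aa: "a \<bullet> a > 0" using d r by (auto simp: a_def dist_norm)
  define b where "b = g x - k *\<^sub>R a"
  have ab: "a \<bullet> b = 0" using aa by (simp add: b_def k_def inner_diff_right inner_commute)
  have gb: "g x \<bullet> b = b \<bullet> b"
    using ab by (simp add: b_def inner_diff_left)
  have "b = 0"
  proof (rule ccontr)
    assume "b \<noteq> 0"
    then have bb: "b \<bullet> b > 0" by simp
    define M where "M = (\<bar>a \<bullet> g x\<bar> + 1) / (b \<bullet> b)"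
    let ?w = "a - (\<sigma> * M / \<bar>\<sigma>\<bar>) *\<^sub>R b"
    have "?w \<bullet> a = a \<bullet> a" using ab by (simp add: inner_diff_left inner_commute [of b])
    then have "?w \<bullet> (y - x) > 0" using aa by (simp add: a_def)
    then have "\<sigma> * (?w \<bullet> g x) \<ge> 0" by (rule half)
    moreover have "\<sigma> * (?w \<bullet> g x) = \<sigma> * (a \<bullet> g x) - \<bar>\<sigma>\<bar> * (\<bar>a \<bullet> g x\<bar> + 1)"
    proof -
      have "\<sigma> * (\<sigma> * M / \<bar>\<sigma>\<bar>) = \<bar>\<sigma>\<bar> * M" using \<sigma>(1) by (cases "\<sigma> > 0") auto
      moreover have "M * (b \<bullet> b) = \<bar>a \<bullet> g x\<bar> + 1" using bb by (simp add: M_def)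
      moreover have "b \<bullet> g x = b \<bullet> b" using gb by (simp add: inner_commute)
      moreover have "\<sigma> * (?w \<bullet> g x) = \<sigma> * (a \<bullet> g x) - (\<sigma> * (\<sigma> * M / \<bar>\<sigma>\<bar>)) * (b \<bullet> g x)"
        unfolding inner_diff_left inner_scaleR_left right_diff_distrib mult.assoc ..
      ultimately show ?thesis by (simp only: mult.assoc)
    qed
    moreover have "\<sigma> * (a \<bullet> g x) \<le> \<bar>\<sigma>\<bar> * \<bar>a \<bullet> g x\<bar>" by (metis abs_ge_self abs_mult)
    moreover have "\<bar>\<sigma>\<bar> > 0" using \<sigma> by simp
    ultimately show False by (simp add: distrib_left)
  qed
  then have "g x = (- k) *\<^sub>R (x - y)" by (simp add: b_def a_def algebra_simps)
  then show ?thesis by blast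
qed

text \<open>Tangency leaves two unit vectors; the one pointing into the ball enters the inside, so it is not
  an outer normal.\<close>

lemma outer_normal_at_touching_ball:
  fixes S :: "'a::euclidean_space set"
  assumes n: "outer_unit_normal S x v" and sub: "ball y r \<subseteq> inside S"
    and d: "dist y x = r" and r: "r > 0"
  shows "v = (1 / r) *\<^sub>R (x - y)"
proof -
  from n obtain U f g e where le: "local_equation S x U f g" and v: "v \<in> span {g x}" "norm v = 1" and x: "x \<in> S"
    and e: "e > 0" "\<forall>s\<in>{0<..<e}. x + s *\<^sub>R v \<in> outside S"
    unfolding outer_unit_normal_def by blast
  have "S \<inter> ball y r = {}" using sub inside_no_overlap by blast
  from gradient_at_touching_ball [OF le x this d r] v obtain c k where "g x = c *\<^sub>R (x - y)" "v = k *\<^sub>R g x"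
    unfolding span_singleton by blast
  then have "v = (k * c) *\<^sub>R (x - y)" by simp
  then obtain k where k: "v = k *\<^sub>R (x - y)" by blast
  have nr: "norm (x - y) = r" using d by (simp add: dist_norm norm_minus_commute)
  have kr: "\<bar>k\<bar> * r = 1" using v k nr by simp
  have "k > 0"
  proof (rule ccontr)
    assume "\<not> k > 0"
    then have k': "- k * r = 1" using kr by auto
    define s where "s = min e r / 2"
    have s: "0 < s" "s < e" "s < r" using e r by (auto simp: s_def)
    have "x + s *\<^sub>R v - y = (1 + s * k) *\<^sub>R (x - y)" by (simp add: k algebra_simps)
    then have nrm: "norm (x + s *\<^sub>R v - y) = \<bar>1 + s * k\<bar> * r" using nr by simp
    have "k \<noteq> 0" using k' by auto
    then have "- k > 0" using \<open>\<not> k > 0\<close> by simp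
    then have sk: "s * (- k) < r * (- k)" "0 < s * (- k)"
      using mult_strict_right_mono [OF s(3), of "- k"] mult_pos_pos [OF s(1), of "- k"] by auto
    then have "\<bar>1 + s * k\<bar> < 1" using k' by (simp add: mult.commute)
    then have "norm (x + s *\<^sub>R v - y) < r" using nrm r by simp
    then have "x + s *\<^sub>R v \<in> inside S" using sub by (auto simp: dist_norm norm_minus_commute)
    moreover have "x + s *\<^sub>R v \<in> outside S" using e s by simp
    ultimately show False using inside_Int_outside by blast
  qed
  then have "k = 1 / r" using kr r by (simp add: field_simps)
  then show ?thesis using k by simp
qed

text \<open>Growth bound from backward difference quotients: only they are available for a minimum
  \<open>m t = Min\<^sub>u \<phi> u t\<close>, since a minimiser at time \<open>t\<close> is merely a competitor at earlier times.\<close>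

lemma backward_growth_bound:
  fixes m :: "real \<Rightarrow> real"
  assumes cont: "continuous_on {0..b} m" and b: "b \<ge> 0"
    and bwd: "\<And>t e. t \<in> {0<..b} \<Longrightarrow> e > 0 \<Longrightarrow> \<exists>d>0. \<forall>h\<in>{0<..<d}. m (t - h) \<le> m t - (1 - e) * h"
  shows "m b \<ge> m 0 + b"
proof -
  have main: "m b \<ge> m 0 + (1 - e) * b" if e: "e > 0" for e
  proof (rule ccontr)
    assume neg: "\<not> ?thesis"
    define \<phi> where "\<phi> t = m t - (1 - e) * t" for t
    define Z where "Z = {t \<in> {0..b}. \<phi> t \<in> {..\<phi> b}}"
    have cphi: "continuous_on {0..b} \<phi>" unfolding \<phi>_def by (intro continuous_intros cont)
    have "closed Z" unfolding Z_def 
      using continuous_closed_preimage [OF cphi, of "{..\<phi> b}"] by (simp add: vimage_def Int_def)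
    moreover have "Z \<noteq> {}" "bdd_below Z" using b by (auto simp: Z_def intro!: bdd_belowI [of _ 0])
    ultimately have inf: "Inf Z \<in> Z" by (metis closed_contains_Inf)
    let ?t = "Inf Z"
    have "?t \<noteq> 0" using inf neg by (auto simp: Z_def \<phi>_def)
    then have t: "?t \<in> {0<..b}" using inf by (auto simp: Z_def)
    from bwd [OF t e] obtain d where d: "d > 0" "\<forall>h\<in>{0<..<d}. m (?t - h) \<le> m ?t - (1 - e) * h" by blast
    define h where "h = min d ?t / 2"
    have h: "0 < h" "h < d" "h < ?t" using d t by (auto simp: h_def)
    then have "\<phi> (?t - h) \<le> \<phi> ?t" using d by (auto simp: \<phi>_def algebra_simps)
    then have "?t - h \<in> Z" using inf h t by (auto simp: Z_def)
    then have "?t \<le> ?t - h" using \<open>bdd_below Z\<close> by (rule cInf_lower)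
    then show False using h by simp
  qed
  show ?thesis
  proof (rule ccontr)
    assume "\<not> ?thesis"
    then have lt: "m b < m 0 + b" by simp
    then have "b > 0" using b by (cases "b = 0") auto
    with lt have "(m 0 + b - m b) / (2 * b) > 0" by simp
    from main [OF this] have "m 0 + b - (m 0 + b - m b) / (2 * b) * b \<le> m b"
      by (simp add: left_diff_distrib)
    moreover have "(m 0 + b - m b) / (2 * b) * b = (m 0 + b - m b) / 2" using \<open>b > 0\<close> by simp
    ultimately have "m 0 + b - (m 0 + b - m b) / 2 \<le> m b" by (simp only:)
    then show False using lt by argo
  qed
qed


text \<open>While \<^term>\<open>y\<close> is not swept over by the moving hypersurface, it stays inside: the direction map
  from \<^term>\<open>y\<close> is deformed through maps to the sphere, and it is null-homotopic as soon as \<^term>\<open>y\<close> is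
  outside.\<close>

lemma stays_inside:
  fixes C :: "'a::euclidean_space \<Rightarrow> real \<Rightarrow> 'a"
  assumes cont: "continuous_on (sphere 0 1 \<times> {0..t}) (\<lambda>(u, t). C u t)"
    and emb: "embedding_map (top_of_set (sphere 0 1)) euclidean (\<lambda>u. C u 0)"
    and t: "t \<ge> 0"
    and y0: "y \<in> inside ((\<lambda>u. C u 0) ` sphere 0 1)"
    and avoid: "\<And>\<tau>. \<tau> \<in> {0..t} \<Longrightarrow> y \<notin> (\<lambda>u. C u \<tau>) ` sphere 0 1"
  shows "y \<in> inside ((\<lambda>u. C u t) ` sphere 0 1)"
proof (rule ccontr)
  assume neg: "\<not> ?thesis"
  let ?S = "sphere (0::'a) 1"
  let ?B = "\<lambda>x. inverse (norm (x - y)) *\<^sub>R (x - y)"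
  have cslice: "continuous_on ?S (\<lambda>u. C u \<tau>)" if "\<tau> \<in> {0..t}" for \<tau>
  proof -
    have "continuous_on ?S ((\<lambda>(u, t). C u t) \<circ> (\<lambda>u. (u, \<tau>)))"
      using that by (intro continuous_on_compose continuous_intros continuous_on_subset [OF cont]) auto
    then show ?thesis by (simp add: o_def)
  qed
  have comp: "compact ((\<lambda>u. C u \<tau>) ` ?S)" if "\<tau> \<in> {0..t}" for \<tau>
    using cslice [OF that] by (intro compact_continuous_image) auto
  have yt: "y \<notin> (\<lambda>u. C u t) ` ?S" using avoid t by simp
  then have "\<not> bounded (connected_component_set (- (\<lambda>u. C u t) ` ?S) y)"
    using neg by (simp add: inside_def)
  then obtain c where c: "homotopic_with_canon (\<lambda>x. True) ((\<lambda>u. C u t) ` ?S) ?S ?B (\<lambda>x. c)"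
    using Borsuk_map_essential_bounded_component [OF comp yt] t by auto
  have ht: "homotopic_with_canon (\<lambda>x. True) ?S ?S (?B \<circ> (\<lambda>u. C u t)) ((\<lambda>x. c) \<circ> (\<lambda>u. C u t))"
    by (rule homotopic_with_compose_continuous_right [OF c]) (use cslice t in auto)
  have h0t: "homotopic_with_canon (\<lambda>x. True) ?S ?S (?B \<circ> (\<lambda>u. C u 0)) (?B \<circ> (\<lambda>u. C u t))"
  proof -
    let ?h = "\<lambda>z::real \<times> 'a. ?B (C (snd z) (t * fst z))"
    have mem: "C u (t * s) \<noteq> y" if "s \<in> {0..1}" "u \<in> ?S" for s u
    proof -
      have "t * s \<in> {0..t}" using that t by (auto simp: mult_left_le)
      then show ?thesis using avoid that by blast
    qed
    have ch: "continuous_on ({0..1} \<times> ?S) (\<lambda>z. C (snd z) (t * fst z))"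
    proof -
      have "continuous_on ({0..1} \<times> ?S) ((\<lambda>(u, t). C u t) \<circ> (\<lambda>z. (snd z, t * fst z)))"
        using t by (intro continuous_on_compose continuous_intros continuous_on_subset [OF cont])
          (auto simp: mult_left_le)
      then show ?thesis by (simp add: o_def)
    qed
    have "continuous_on ({0..1} \<times> ?S) ?h"
      using mem by (intro continuous_intros ch) force
    moreover have "?h ` ({0..1} \<times> ?S) \<subseteq> ?S"
      using mem by auto
    ultimately show ?thesis
      unfolding homotopic_with_def
      by (intro exI [of _ ?h]) (auto simp: image_subset_iff_funcset)
  qed
  from emb obtain k where k: "homeomorphic_maps (top_of_set ?S) (top_of_set ((\<lambda>u. C u 0) ` ?S)) (\<lambda>u. C u 0) k"
    unfolding embedding_map_def homeomorphic_map_maps by auto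
  then have "continuous_map (top_of_set ((\<lambda>u. C u 0) ` ?S)) (top_of_set ?S) k"
     and kk: "\<And>x. x \<in> (\<lambda>u. C u 0) ` ?S \<Longrightarrow> C (k x) 0 = x"
    unfolding homeomorphic_maps_def by auto
  then have ck: "continuous_on ((\<lambda>u. C u 0) ` ?S) k" "k \<in> (\<lambda>u. C u 0) ` ?S \<rightarrow> ?S"
    unfolding continuous_map_in_subtopology by (auto simp del: image_ident)
  have "homotopic_with_canon (\<lambda>x. True) ?S ?S (?B \<circ> (\<lambda>u. C u 0)) (\<lambda>x. c)"
    using homotopic_with_trans [OF h0t ht] by (simp add: o_def)
  then have "homotopic_with_canon (\<lambda>x. True) ((\<lambda>u. C u 0) ` ?S) ?S ((?B \<circ> (\<lambda>u. C u 0)) \<circ> k) ((\<lambda>x. c) \<circ> k)"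
    by (rule homotopic_with_compose_continuous_right) (use ck in auto)
  then have "homotopic_with_canon (\<lambda>x. True) ((\<lambda>u. C u 0) ` ?S) ?S ?B (\<lambda>x. c)"
    by (rule homotopic_with_eq) (use kk in auto)
  moreover have "y \<notin> (\<lambda>u. C u 0) ` ?S" using avoid t by simp
  ultimately have "\<not> bounded (connected_component_set (- (\<lambda>u. C u 0) ` ?S) y)"
    using Borsuk_map_essential_bounded_component [OF comp] t by force
  then show False using y0 by (simp add: inside_def)
qed

text \<open>The minimal distance \<open>m t\<close> from \<^term>\<open>y\<close> to the hypersurface grows with unit speed: at a nearest
  point the hypersurface is tangent to a ball around \<^term>\<open>y\<close>, so there the velocity \<open>N\<close> points
  straight away from \<^term>\<open>y\<close>.\<close>

lemma flow_encloses_growing_ball: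
  fixes C N :: "'a::euclidean_space \<Rightarrow> real \<Rightarrow> 'a"
  assumes flow: "outer_normal_flow T S0 C N"
    and y0: "y \<in> inside S0" and ball0: "ball y r \<inter> S0 = {}" and r: "r > 0" and t: "t \<in> {0..<T}"
  shows "ball y (r + t) \<subseteq> inside ((\<lambda>u. C u t) ` sphere 0 1)"
proof -
  let ?S = "\<lambda>t. (\<lambda>u. C u t) ` sphere 0 1"
  from flow have cont: "continuous_on (sphere 0 1 \<times> {0..<T}) (\<lambda>(u, t). C u t)"
    and emb: "embedding_map (top_of_set (sphere 0 1)) euclidean (\<lambda>u. C u 0)"
    and S0: "?S 0 = S0"
    and nor: "\<And>u t. u \<in> sphere 0 1 \<Longrightarrow> t \<in> {0..<T} \<Longrightarrow> outer_unit_normal (?S t) (C u t) (N u t)"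
    and der: "\<And>u t. u \<in> sphere 0 1 \<Longrightarrow> t \<in> {0..<T} \<Longrightarrow> (C u has_vector_derivative N u t) (at t within {0..<T})"
    unfolding outer_normal_flow_def by auto
  have norN: "norm (N u t) = 1" if "u \<in> sphere 0 1" "t \<in> {0..<T}" for u t
    using nor [OF that] by (simp add: outer_unit_normal_def)
  have lip: "norm (C u s - C u t) \<le> \<bar>s - t\<bar>" if "u \<in> sphere 0 1" "t \<in> {0..<T}" "s \<in> {0..<T}" for u s t
  proof -
    have "norm (C u s - C u t) \<le> 1 * norm (s - t)"
    proof (rule differentiable_bound [where S="{0..<T}" and f'="\<lambda>t h. h *\<^sub>R N u t"])
      fix x assume x: "x \<in> {0..<T}"
      show "(C u has_derivative (\<lambda>h. h *\<^sub>R N u x)) (at x within {0..<T})"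
        using der [OF that(1) x] by (simp add: has_vector_derivative_def)
      show "onorm (\<lambda>h. h *\<^sub>R N u x) \<le> 1"
        using norN [OF that(1) x] by (intro onorm_le) simp
    qed (use that in auto)
    then show ?thesis by simp
  qed
  have cslice: "continuous_on (sphere 0 1) (\<lambda>u. C u \<tau>)" if "\<tau> \<in> {0..<T}" for \<tau>
  proof -
    have "continuous_on (sphere 0 1) ((\<lambda>(u, t). C u t) \<circ> (\<lambda>u. (u, \<tau>)))"
      using that by (intro continuous_on_compose continuous_intros continuous_on_subset [OF cont]) auto
    then show ?thesis by (simp add: o_def)
  qed
  have comp: "compact (?S \<tau>)" if "\<tau> \<in> {0..<T}" for \<tau>
    using cslice [OF that] by (intro compact_continuous_image) auto
  obtain u0 :: 'a where "norm u0 = 1" using vector_choose_size zero_le_one by blast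
  then have u0: "u0 \<in> sphere 0 1" by simp
  then have ne: "?S \<tau> \<noteq> {}" for \<tau> by blast
  define m where "m \<tau> = infdist y (?S \<tau>)" for \<tau>
  have mle: "m \<tau> \<le> dist y (C u \<tau>)" if "u \<in> sphere 0 1" for u \<tau>
    unfolding m_def using that by (intro infdist_le) auto
  have matt: "\<exists>u\<in>sphere 0 1. m \<tau> = dist y (C u \<tau>)" if \<tau>: "\<tau> \<in> {0..<T}" for \<tau>
  proof -
    obtain x where "x \<in> ?S \<tau>" "infdist y (?S \<tau>) = dist y x"
      using infdist_attains_inf [OF compact_imp_closed [OF comp [OF \<tau>]] ne] by blast
    then show ?thesis by (auto simp: m_def)
  qed
  have mlip1: "m s \<le> m \<tau> + \<bar>s - \<tau>\<bar>" if st: "s \<in> {0..<T}" "\<tau> \<in> {0..<T}" for s \<tau>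
  proof -
    obtain u where u: "u \<in> sphere 0 1" "m \<tau> = dist y (C u \<tau>)" using matt [OF st(2)] by blast
    have "m s \<le> dist y (C u s)" by (rule mle [OF u(1)])
    also have "\<dots> \<le> dist y (C u \<tau>) + dist (C u \<tau>) (C u s)" by (rule dist_triangle)
    also have "dist (C u \<tau>) (C u s) \<le> \<bar>s - \<tau>\<bar>"
      using lip [OF u(1) st(2) st(1)] by (simp add: dist_norm norm_minus_commute)
    finally show ?thesis using u by simp
  qed
  have mcont: "continuous_on {0..<T} m"
  proof (rule lipschitz_on_continuous_on [where L = 1], rule lipschitz_onI)
    fix s \<tau> assume "s \<in> {0..<T}" "\<tau> \<in> {0..<T}"
    then show "dist (m s) (m \<tau>) \<le> 1 * dist s \<tau>"
      using mlip1 [of s \<tau>] mlip1 [of \<tau> s] by (auto simp: dist_real_def abs_minus_commute)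
  qed simp
  have m0: "m 0 \<ge> r"
  proof -
    obtain u where u: "u \<in> sphere 0 1" "m 0 = dist y (C u 0)" using matt [of 0] t by auto
    then have "C u 0 \<in> S0" using S0 by blast
    then have "C u 0 \<notin> ball y r" using ball0 by blast
    then show ?thesis using u by simp
  qed
  have ball_sub: "ball y (m \<tau>) \<subseteq> inside (?S \<tau>)" if yin: "y \<in> inside (?S \<tau>)" for \<tau>
  proof (cases "m \<tau> > 0")
    case True
    have disj: "ball y (m \<tau>) \<subseteq> - ?S \<tau>"
    proof (intro subsetI ComplI)
      fix z assume z: "z \<in> ball y (m \<tau>)" "z \<in> ?S \<tau>"
      then obtain u where "u \<in> sphere 0 1" "z = C u \<tau>" by blast
      then show False using mle [of u \<tau>] z by simp
    qed
    have "ball y (m \<tau>) \<subseteq> connected_component_set (- ?S \<tau>) y"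
      using True disj by (intro connected_component_maximal) auto
    also have "\<dots> \<subseteq> inside (?S \<tau>)"
    proof
      fix z assume z: "z \<in> connected_component_set (- ?S \<tau>) y"
      then have "z \<in> - ?S \<tau>" using connected_component_subset by blast
      moreover have "connected_component_set (- ?S \<tau>) z = connected_component_set (- ?S \<tau>) y"
        using connected_component_eq [OF z] by simp
      ultimately show "z \<in> inside (?S \<tau>)" using yin unfolding inside_def by simp
    qed
    finally show ?thesis .
  next
    case False
    then have "ball y (m \<tau>) = {}" by simp
    then show ?thesis by (simp only: empty_subsetI)
  qed
  have grow: "m b \<ge> m 0 + b" if b: "b \<in> {0..<T}" and av: "\<And>\<tau>. \<tau> \<in> {0..<b} \<Longrightarrow> y \<notin> ?S \<tau>" for b
  proof -
    have inn: "y \<in> inside (?S \<tau>)" if "\<tau> \<in> {0..<b}" for \<tau>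
    proof (rule stays_inside [where C=C and t=\<tau>, OF _ emb])
      show "continuous_on (sphere 0 1 \<times> {0..\<tau>}) (\<lambda>(u, t). C u t)"
        by (rule continuous_on_subset [OF cont]) (use that b in auto)
      show "y \<in> inside (?S 0)" using y0 S0 by simp
    qed (use that av in auto)
    have key: "m s \<ge> m 0 + s" if s: "s \<in> {0..<b}" for s
    proof (rule backward_growth_bound)
      show "continuous_on {0..s} m" by (rule continuous_on_subset [OF mcont]) (use s b in auto)
      show "s \<ge> 0" using s by simp
      fix \<tau> e :: real assume \<tau>: "\<tau> \<in> {0<..s}" and e: "e > 0"
      have \<tau>T: "\<tau> \<in> {0..<T}" and \<tau>b: "\<tau> \<in> {0..<b}" using \<tau> s b by auto
      obtain u where u: "u \<in> sphere 0 1" "m \<tau> = dist y (C u \<tau>)" using matt [OF \<tau>T] by blast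
      have mpos: "m \<tau> > 0"
        using av [OF \<tau>b] u by auto
      have Nu: "N u \<tau> = (1 / m \<tau>) *\<^sub>R (C u \<tau> - y)"
        by (rule outer_normal_at_touching_ball [OF nor [OF u(1) \<tau>T] ball_sub [OF inn [OF \<tau>b]]]) (use u mpos in auto)
      have "C u \<tau> - y \<noteq> 0" using u mpos by auto
      have "((\<lambda>s. norm (C u s - y)) has_derivative (\<lambda>h. (h *\<^sub>R N u \<tau>) \<bullet> sgn (C u \<tau> - y))) (at \<tau> within {0..<T})"
      proof (rule has_derivative_compose [where g=norm and f="\<lambda>s. C u s - y"])
        show "((\<lambda>s. C u s - y) has_derivative (\<lambda>h. h *\<^sub>R N u \<tau>)) (at \<tau> within {0..<T})"
          using der [OF u(1) \<tau>T] unfolding has_vector_derivative_def by (auto intro!: derivative_eq_intros)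
        show "(norm has_derivative (\<lambda>h. h \<bullet> sgn (C u \<tau> - y))) (at (C u \<tau> - y))"
          by (rule has_derivative_norm) fact
      qed
      moreover have "N u \<tau> \<bullet> sgn (C u \<tau> - y) = 1"
        using u(2) mpos unfolding Nu sgn_div_norm
        by (simp add: dist_norm norm_minus_commute power2_norm_eq_inner [symmetric] power2_eq_square)
      ultimately have "((\<lambda>s. norm (C u s - y)) has_real_derivative 1) (at \<tau> within {0..<T})"
        by (intro has_derivative_imp_has_field_derivative) auto
      then obtain d where d: "d > 0"
        "\<And>s. s \<in> {0..<T} \<Longrightarrow> \<bar>s - \<tau>\<bar> < d \<Longrightarrow>
           \<bar>norm (C u s - y) - norm (C u \<tau> - y) - (s - \<tau>)\<bar> \<le> e * \<bar>s - \<tau>\<bar>"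
        unfolding has_field_derivative_def has_derivative_within_alt using e
        by (auto simp: real_norm_def)
      show "\<exists>d>0. \<forall>h\<in>{0<..<d}. m (\<tau> - h) \<le> m \<tau> - (1 - e) * h"
      proof (intro exI [of _ "min d \<tau>"] conjI ballI)
        show "min d \<tau> > 0" using d \<tau> by auto
        fix h assume h: "h \<in> {0<..<min d \<tau>}"
        have "m (\<tau> - h) \<le> dist y (C u (\<tau> - h))" by (rule mle [OF u(1)])
        also have "\<dots> = norm (C u (\<tau> - h) - y)" by (simp add: dist_norm norm_minus_commute)
        also have "\<dots> \<le> norm (C u \<tau> - y) - h + e * h"
          using d(2) [of "\<tau> - h"] h \<tau>T by (auto simp: abs_if split: if_splits)
        also have "norm (C u \<tau> - y) = m \<tau>" using u by (simp add: dist_norm norm_minus_commute)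
        finally show "m (\<tau> - h) \<le> m \<tau> - (1 - e) * h" by (simp add: algebra_simps)
      qed
    qed
    \<comment> \<open>at time \<open>b\<close> itself the point may be hit, so the bound is extended by continuity\<close>
    show ?thesis
    proof (cases "b = 0")
      case False
      then have b0: "b > 0" using b by simp
      show ?thesis
      proof (rule ccontr)
        assume "\<not> ?thesis"
        then have \<delta>: "m 0 + b - m b > 0" by simp
        define s where "s = b - min b ((m 0 + b - m b) / 4)"
        have s: "s \<in> {0..<b}" using b0 \<delta> by (auto simp: s_def)
        have s2: "b - s \<le> (m 0 + b - m b) / 4" using min.cobounded2 [of b "(m 0 + b - m b) / 4"] unfolding s_def by argo
        have "s \<in> {0..<T}" using s b by auto
        then have "m s \<le> m b + (b - s)" using mlip1 [of s b] b s by auto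
        then show False using key [OF s] s2 \<delta> by argo
      qed
    qed simp
  qed
  \<comment> \<open>up to the first time of hitting \<open>y\<close> the growth bound holds, which rules that time out\<close>
  have av: "y \<notin> ?S \<tau>" if "\<tau> \<in> {0..<T}" for \<tau>
  proof
    assume "y \<in> ?S \<tau>"
    define Z where "Z = {s \<in> {0..\<tau>}. m s \<in> {0}}"
    have "closed Z"
    proof -
      have "continuous_on {0..\<tau>} m" by (rule continuous_on_subset [OF mcont]) (use that in auto)
      then have "closed ({0..\<tau>} \<inter> m -` {0})" by (intro continuous_closed_preimage) auto
      also have "{0..\<tau>} \<inter> m -` {0} = Z" by (auto simp: Z_def)
      finally show ?thesis .
    qed
    moreover have "Z \<noteq> {}"
    proof -
      have "m \<tau> = 0" using \<open>y \<in> ?S \<tau>\<close> by (simp add: m_def)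
      then show ?thesis using that by (auto simp: Z_def)
    qed
    moreover have "bdd_below Z" by (auto simp: Z_def intro!: bdd_belowI [of _ 0])
    ultimately have b: "Inf Z \<in> Z" by (metis closed_contains_Inf)
    have "y \<notin> ?S s" if s: "s \<in> {0..<Inf Z}" for s
    proof
      assume "y \<in> ?S s"
      then have "m s = 0" by (simp add: m_def)
      then have "s \<in> Z" using s b by (auto simp: Z_def)
      then have "Inf Z \<le> s" using \<open>bdd_below Z\<close> by (rule cInf_lower)
      then show False using s by simp
    qed
    then have "m (Inf Z) \<ge> m 0 + Inf Z" by (intro grow) (use b that in \<open>auto simp: Z_def\<close>)
    then show False using b m0 r by (auto simp: Z_def)
  qed
  have "y \<in> inside (?S t)"
  proof (rule stays_inside [where C=C and t=t, OF _ emb])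
    show "continuous_on (sphere 0 1 \<times> {0..t}) (\<lambda>(u, t). C u t)"
      by (rule continuous_on_subset [OF cont]) (use t in auto)
    show "y \<in> inside (?S 0)" using y0 S0 by simp
  qed (use t av in auto)
  moreover have "r + t \<le> m t" using grow [OF t] av m0 t by force
  ultimately show ?thesis using ball_sub subset_ball by blast
qed


text \<open>Unit speed keeps the hypersurface within the parallel body.  The growing balls around interior
  points of \<open>K\<close> fill the interior of the parallel body and are enclosed by the hypersurface, which
  therefore lies on the frontier; a gap in it would connect inside and outside.\<close>

theorem (in body) flow_parallel_body:
  assumes flow: "outer_normal_flow T (frontier K) C N" and t: "t \<in> {0..<T}"
  shows "(\<lambda>u. C u t) ` sphere 0 1 = frontier (parallel_body K t)"
    and "enclosed_body ((\<lambda>u. C u t) ` sphere 0 1) = parallel_body K t"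
proof -
  let ?S = "(\<lambda>u. C u t) ` sphere 0 1"
  let ?P = "parallel_body K t"
  from flow have S0: "(\<lambda>u. C u 0) ` sphere 0 1 = frontier K"
    and nor: "\<And>u t. u \<in> sphere 0 1 \<Longrightarrow> t \<in> {0..<T} \<Longrightarrow> norm (N u t) = 1"
    and der: "\<And>u t. u \<in> sphere 0 1 \<Longrightarrow> t \<in> {0..<T} \<Longrightarrow> (C u has_vector_derivative N u t) (at t within {0..<T})"
    unfolding outer_normal_flow_def outer_unit_normal_def by auto
  have inK: "interior K = inside (frontier K)"
    using inside_frontier_eq_interior [OF bounded_K convex_K] by simp
  have sub: "?S \<subseteq> ?P"
  proof
    fix x assume "x \<in> ?S"
    then obtain u where u: "u \<in> sphere 0 1" "x = C u t" by blast
    have "norm (C u t - C u 0) \<le> 1 * norm (t - 0)"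
    proof (rule differentiable_bound [where S="{0..<T}" and f'="\<lambda>t h. h *\<^sub>R N u t"])
      fix x assume x: "x \<in> {0..<T}"
      show "(C u has_derivative (\<lambda>h. h *\<^sub>R N u x)) (at x within {0..<T})"
        using der [OF u(1) x] by (simp add: has_vector_derivative_def)
      show "onorm (\<lambda>h. h *\<^sub>R N u x) \<le> 1"
        using nor [OF u(1) x] by (intro onorm_le) simp
    qed (use t in auto)
    moreover have "C u 0 \<in> K" using S0 u frontier_subset_closed [OF closed_K] by blast
    ultimately show "x \<in> ?P" unfolding parallel_body_def u using t by (auto intro!: infdist_le2 simp: dist_norm)
  qed
  have inner: "interior ?P \<subseteq> inside ?S"
  proof (cases "t = 0")
    case True
    then show ?thesis using S0 inK parallel_body_0 by simp
  next
    case False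
    then have t0: "t > 0" using t by simp
    show ?thesis
    proof
      fix x assume "x \<in> interior ?P"
      then have x: "dist x (closest_point K x) < t" using interior_parallel_body [OF t0] by (simp add: infdist_eq)
      have "closest_point K x \<in> closure (interior K)" using closure_interior_K closest_in by simp
      then obtain y where y: "y \<in> interior K" "dist y (closest_point K x) < t - dist x (closest_point K x)"
        using x closure_approachable by (metis diff_gt_0_iff_gt)
      obtain r where r: "r > 0" "ball y r \<subseteq> interior K" using y open_interior by (meson openE)
      have yin: "y \<in> inside (frontier K)" using y inK by simp
      have "ball y r \<inter> frontier K = {}" using r(2) by (auto simp: frontier_def)
      from flow_encloses_growing_ball [OF flow yin this r(1) t]
      have "ball y (r + t) \<subseteq> inside ?S" .
      moreover have "dist y x < t"
        using y(2) dist_triangle2 [of y x "closest_point K x"] by linarith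
      ultimately show "x \<in> inside ?S" using r by auto
    qed
  qed
  have "outside ?P \<subseteq> outside ?S" by (rule outside_mono [OF sub])
  then have outer: "- ?P \<subseteq> outside ?S" using outside_convex [OF convex_parallel_body] by simp
  have fr: "frontier ?P \<subseteq> ?S"
  proof
    fix x assume x: "x \<in> frontier ?P"
    show "x \<in> ?S"
    proof (rule ccontr)
      assume nx: "x \<notin> ?S"
      have "closed ?S"
      proof (intro compact_imp_closed compact_continuous_image)
        have "continuous_on (sphere 0 1 \<times> {0..<T}) (\<lambda>(u, t). C u t)"
          using flow unfolding outer_normal_flow_def by simp
        then have "continuous_on ((\<lambda>u. (u, t)) ` sphere 0 1) (\<lambda>(u, t). C u t)"
          by (rule continuous_on_subset) (use t in auto)
        then have "continuous_on (sphere 0 1) ((\<lambda>(u, t). C u t) \<circ> (\<lambda>u. (u, t)))"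
          by (intro continuous_on_compose continuous_intros)
        then show "continuous_on (sphere 0 1) (\<lambda>u. C u t)" by (simp add: o_def)
      qed auto
      then obtain e where e: "e > 0" "ball x e \<subseteq> - ?S"
        using nx by (meson ComplI open_Compl openE)
      have conv: "closure (interior ?P) = ?P"
        using body.closure_interior_K [of ?P] convex_body_parallel_body t by (simp add: body_def)
      have "x \<in> closure (interior ?P)" using x conv compact_imp_closed [OF compact_parallel_body]
        frontier_subset_closed by blast
      then obtain a where a: "a \<in> interior ?P" "dist a x < e" using e closure_approachable by blast
      have "x \<in> closure (- ?P)" using x by (simp add: frontier_closures)
      then obtain b where b: "b \<in> - ?P" "dist b x < e" using e closure_approachable by blast
      have ain: "a \<in> inside ?S" and bout: "b \<in> outside ?S" using a b inner outer by auto
      have "a \<in> ball x e" "b \<in> ball x e" using a b by (auto simp: dist_commute)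
      then have "connected_component (- ?S) a b"
        unfolding connected_component_def using e(2) convex_connected [OF convex_ball] by blast
      then have "connected_component_set (- ?S) a = connected_component_set (- ?S) b"
        by (simp add: connected_component_eq)
      then show False using ain bout by (simp add: inside_def outside_def)
    qed
  qed
  have "?S \<inter> interior ?P = {}" using inner inside_no_overlap by blast
  then have "?S \<subseteq> frontier ?P" unfolding frontier_def using sub closure_subset [of ?P] by blast
  with fr show eq: "?S = frontier ?P" by blast
  have "inside ?S \<subseteq> ?P" using outer inside_Int_outside by blast
  moreover have "?P = interior ?P \<union> frontier ?P"
    using compact_imp_closed [OF compact_parallel_body] interior_subset [of ?P] by (auto simp: frontier_def)
  ultimately show "enclosed_body ?S = ?P" using inner sub eq unfolding enclosed_body_def by blast
qed

section \<open>Two facts on functions of several variables\<close>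

text \<open>Schwarz's theorem: the mixed second difference of \<open>f\<close> is computed by the mean value theorem
  in either order.\<close>

lemma gradient_derivative_symmetric:
  fixes f :: "'a::real_inner \<Rightarrow> real"
  assumes U: "open U" "x \<in> U" and f: "\<And>y. y \<in> U \<Longrightarrow> GDERIV f y :> g y"
    and g: "(g has_derivative H) (at x)"
  shows "H u \<bullet> w = H w \<bullet> u"
proof -
  have lin: "linear H" using g has_derivative_linear by blast
  have main: "\<bar>H w \<bullet> u - H u \<bullet> w\<bar> \<le> e * (2 * (norm u + norm w) * (norm u + norm w))" if e: "e > 0" for e
  proof -
    obtain d0 where d0: "d0 > 0" "ball x d0 \<subseteq> U" using U openE by blast
    obtain d1 where d1: "d1 > 0" "\<And>y. norm (y - x) < d1 \<Longrightarrow> norm (g y - g x - H (y - x)) \<le> e * norm (y - x)"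
      using g e unfolding has_derivative_at_alt by blast
    define t where "t = min d0 d1 / (2 * (norm u + norm w + 1))"
    have pos: "norm u + norm w + 1 > 0" by (smt (verit) norm_ge_zero)
    have t: "t > 0" using d0 d1 pos by (simp add: t_def)
    have "t * (norm u + norm w) < t * (2 * (norm u + norm w + 1))"
      using t by (intro mult_strict_left_mono) (smt (verit) norm_ge_zero)+
    also have "\<dots> = min d0 d1" using pos by (simp add: t_def)
    finally have tl: "t * (norm u + norm w) < min d0 d1" .
    have half: "\<bar>f (x + t *\<^sub>R u + t *\<^sub>R w) - f (x + t *\<^sub>R u) - f (x + t *\<^sub>R w) + f x - t\<^sup>2 * (H w \<bullet> u)\<bar>
        \<le> t\<^sup>2 * (e * (2 * (norm u + norm w) * norm u))"
      if tl: "t * (norm u + norm w) < min d0 d1" for u w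
    proof -
      have small: "norm (a *\<^sub>R u + b *\<^sub>R w) \<le> t * (norm u + norm w)" if "0 \<le> a" "a \<le> t" "0 \<le> b" "b \<le> t" for a b
      proof -
        have "norm (a *\<^sub>R u + b *\<^sub>R w) \<le> a * norm u + b * norm w"
          using norm_triangle_ineq [of "a *\<^sub>R u" "b *\<^sub>R w"] that by simp
        also have "\<dots> \<le> t * norm u + t * norm w" using that by (intro add_mono mult_right_mono) auto
        finally show ?thesis by (simp add: distrib_left)
      qed
      have inU: "x + a *\<^sub>R u + b *\<^sub>R w \<in> U" if "0 \<le> a" "a \<le> t" "0 \<le> b" "b \<le> t" for a b
      proof -
        have "dist x (x + a *\<^sub>R u + b *\<^sub>R w) = norm (a *\<^sub>R u + b *\<^sub>R w)" 
          by (metis add.assoc add_diff_cancel_left' dist_commute dist_norm)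
        then show ?thesis using small [OF that] tl d0 by auto
      qed
      define \<phi> where "\<phi> a = f (x + a *\<^sub>R u + t *\<^sub>R w) - f (x + a *\<^sub>R u)" for a
      have der: "(\<phi> has_real_derivative (g (x + a *\<^sub>R u + t *\<^sub>R w) - g (x + a *\<^sub>R u)) \<bullet> u) (at a)" if a: "0 \<le> a" "a \<le> t" for a
      proof -
        have f1: "(f has_derivative (\<lambda>h. h \<bullet> g (x + a *\<^sub>R u + t *\<^sub>R w))) (at (x + a *\<^sub>R u + t *\<^sub>R w))"
          using f [OF inU [OF a, of t]] t by (simp add: gderiv_def)
        have f2: "(f has_derivative (\<lambda>h. h \<bullet> g (x + a *\<^sub>R u))) (at (x + a *\<^sub>R u))"
          using f [OF inU [OF a, of 0]] t by (simp add: gderiv_def)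
        have "((\<lambda>a. f (x + a *\<^sub>R u + t *\<^sub>R w)) has_derivative (\<lambda>h. (h *\<^sub>R u) \<bullet> g (x + a *\<^sub>R u + t *\<^sub>R w))) (at a)"
          by (rule has_derivative_compose [where f="\<lambda>a. x + a *\<^sub>R u + t *\<^sub>R w" and g=f, OF _ f1]) (auto intro!: derivative_eq_intros)
        moreover have "((\<lambda>a. f (x + a *\<^sub>R u)) has_derivative (\<lambda>h. (h *\<^sub>R u) \<bullet> g (x + a *\<^sub>R u))) (at a)"
          by (rule has_derivative_compose [where f="\<lambda>a. x + a *\<^sub>R u" and g=f, OF _ f2]) (auto intro!: derivative_eq_intros)
        ultimately have "(\<phi> has_derivative (\<lambda>h. (h *\<^sub>R u) \<bullet> g (x + a *\<^sub>R u + t *\<^sub>R w) - (h *\<^sub>R u) \<bullet> g (x + a *\<^sub>R u))) (at a)"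
          unfolding \<phi>_def by (rule has_derivative_diff)
        then show ?thesis
          by (rule has_derivative_imp_has_field_derivative) (simp add: algebra_simps inner_commute)
      qed
      obtain a where a: "0 < a" "a < t" and "\<phi> t - \<phi> 0 = (t - 0) * ((g (x + a *\<^sub>R u + t *\<^sub>R w) - g (x + a *\<^sub>R u)) \<bullet> u)"
        using MVT2 [OF t der] by auto
      then have \<phi>: "\<phi> t - \<phi> 0 = t * ((g (x + a *\<^sub>R u + t *\<^sub>R w) - g (x + a *\<^sub>R u)) \<bullet> u)" by simp
      let ?y = "x + a *\<^sub>R u + t *\<^sub>R w" and ?z = "x + a *\<^sub>R u"
      have ny: "norm (?y - x) \<le> t * (norm u + norm w)" using small [of a t] a by (simp add: add.assoc)
      have nz: "norm (?z - x) \<le> t * (norm u + norm w)" using small [of a 0] a by simp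
      have ey: "norm (g ?y - g x - H (?y - x)) \<le> e * (t * (norm u + norm w))"
        by (rule order_trans [OF d1(2)]) (use ny tl e in \<open>auto intro: mult_left_mono\<close>)
      have ez: "norm (g ?z - g x - H (?z - x)) \<le> e * (t * (norm u + norm w))"
        by (rule order_trans [OF d1(2)]) (use nz tl e in \<open>auto intro: mult_left_mono\<close>)
      have "H (?y - x) - H (?z - x) = t *\<^sub>R H w"
        by (simp add: linear_diff [OF lin, symmetric] linear_scale [OF lin, symmetric])
      then have eq: "g ?y - g ?z - t *\<^sub>R H w = (g ?y - g x - H (?y - x)) - (g ?z - g x - H (?z - x))"
        by (simp add: algebra_simps)
      have "norm (g ?y - g ?z - t *\<^sub>R H w) \<le> e * (t * (norm u + norm w)) + e * (t * (norm u + norm w))"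
        unfolding eq by (rule order_trans [OF norm_triangle_ineq4 add_mono [OF ey ez]])
      then have "\<bar>(g ?y - g ?z - t *\<^sub>R H w) \<bullet> u\<bar> \<le> (2 * (e * (t * (norm u + norm w)))) * norm u"
        by (intro order_trans [OF Cauchy_Schwarz_ineq2] mult_right_mono) auto
      then have "t * \<bar>(g ?y - g ?z - t *\<^sub>R H w) \<bullet> u\<bar> \<le> t * ((2 * (e * (t * (norm u + norm w)))) * norm u)"
        using t by (intro mult_left_mono) auto
      also have "t * \<bar>(g ?y - g ?z - t *\<^sub>R H w) \<bullet> u\<bar> = \<bar>(\<phi> t - \<phi> 0) - t\<^sup>2 * (H w \<bullet> u)\<bar>"
      proof -
        have "(\<phi> t - \<phi> 0) - t\<^sup>2 * (H w \<bullet> u) = t * ((g ?y - g ?z - t *\<^sub>R H w) \<bullet> u)"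
          unfolding \<phi> inner_diff_left inner_scaleR_left power2_eq_square by algebra
        then show ?thesis using t by (simp add: abs_mult)
      qed
      finally show ?thesis unfolding \<phi>_def by (simp add: power2_eq_square algebra_simps)
    qed
    let ?D = "f (x + t *\<^sub>R u + t *\<^sub>R w) - f (x + t *\<^sub>R u) - f (x + t *\<^sub>R w) + f x"
    have 1: "\<bar>?D - t\<^sup>2 * (H w \<bullet> u)\<bar> \<le> t\<^sup>2 * (e * (2 * (norm u + norm w) * norm u))" by (rule half [OF tl])
    have "\<bar>f (x + t *\<^sub>R w + t *\<^sub>R u) - f (x + t *\<^sub>R w) - f (x + t *\<^sub>R u) + f x - t\<^sup>2 * (H u \<bullet> w)\<bar>
        \<le> t\<^sup>2 * (e * (2 * (norm w + norm u) * norm w))" by (rule half) (use tl in \<open>simp add: add.commute\<close>)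
    then have 2: "\<bar>?D - t\<^sup>2 * (H u \<bullet> w)\<bar> \<le> t\<^sup>2 * (e * (2 * (norm u + norm w) * norm w))"
      by (simp add: algebra_simps)
    have "t\<^sup>2 * \<bar>H w \<bullet> u - H u \<bullet> w\<bar> = \<bar>t\<^sup>2 * (H w \<bullet> u) - t\<^sup>2 * (H u \<bullet> w)\<bar>"
      using t by (simp add: right_diff_distrib [symmetric] abs_mult)
    also have "\<dots> \<le> t\<^sup>2 * (e * (2 * (norm u + norm w) * norm u)) + t\<^sup>2 * (e * (2 * (norm u + norm w) * norm w))"
      using 1 2 by linarith
    also have "\<dots> = t\<^sup>2 * (e * (2 * (norm u + norm w) * (norm u + norm w)))" by (simp add: algebra_simps)
    finally show ?thesis using t by simp
  qed
  define c where "c = 2 * (norm u + norm w) * (norm u + norm w)"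
  have "\<bar>H w \<bullet> u - H u \<bullet> w\<bar> \<le> 0"
  proof (rule field_le_epsilon)
    fix e :: real assume e: "e > 0"
    have c: "c \<ge> 0" by (simp add: c_def)
    have "\<bar>H w \<bullet> u - H u \<bullet> w\<bar> \<le> e / (c + 1) * c" unfolding c_def
      by (rule main) (use e c in \<open>simp add: c_def add_nonneg_pos\<close>)
    also have "\<dots> \<le> e" using e c by (simp add: field_simps)
    finally show "\<bar>H w \<bullet> u - H u \<bullet> w\<bar> \<le> 0 + e" by simp
  qed
  then show ?thesis by simp
qed

text \<open>A continuously differentiable map is strictly differentiable: its derivative at a point also
  controls difference quotients between two nearby points.\<close>

lemma strictly_differentiable:
  fixes G :: "'a::euclidean_space \<Rightarrow> 'b::euclidean_space"
  assumes U: "open U" "q \<in> U" and D: "\<And>y. y \<in> U \<Longrightarrow> (G has_derivative D y) (at y)"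
    and cont: "\<And>i. i \<in> Basis \<Longrightarrow> continuous_on U (\<lambda>y. D y i)" and e: "e > 0"
  shows "\<exists>d>0. \<forall>x\<in>ball q d. \<forall>y\<in>ball q d. norm (G x - G y - D q (x - y)) \<le> e * norm (x - y)"
proof -
  define B where "B y = Blinfun (D y)" for y
  have B: "blinfun_apply (B y) = D y" if "y \<in> U" for y
    unfolding B_def by (rule bounded_linear_Blinfun_apply) (rule has_derivative_bounded_linear [OF D [OF that]])
  have "continuous_on U B"
  proof (rule continuous_on_blinfun_componentwise)
    fix i :: 'a assume "i \<in> Basis"
    then show "continuous_on U (\<lambda>y. blinfun_apply (B y) i)"
      using continuous_on_cong [OF refl, of U "\<lambda>y. D y i" "\<lambda>y. blinfun_apply (B y) i"] cont B by auto
  qed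
  then obtain d1 where d1: "d1 > 0" "\<And>y. y \<in> U \<Longrightarrow> dist y q < d1 \<Longrightarrow> dist (B y) (B q) < e"
    using U e unfolding continuous_on_iff by metis
  obtain d2 where d2: "d2 > 0" "ball q d2 \<subseteq> U" using U openE by blast
  define d where "d = min d1 d2"
  have sub: "ball q d \<subseteq> U" using d2 by (auto simp: d_def)
  show ?thesis
  proof (intro exI conjI ballI)
    show "d > 0" using d1 d2 by (simp add: d_def)
    fix x y assume xy: "x \<in> ball q d" "y \<in> ball q d"
    have "norm (G x - G y - D q (x - y)) \<le> norm (x - y) * e"
    proof (rule differentiable_bound_linearization [where S="ball q d"])
      fix t :: real assume t: "t \<in> {0..1}"
      have "y + t *\<^sub>R (x - y) = (1 - t) *\<^sub>R y + t *\<^sub>R x" by (simp add: algebra_simps)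
      then show "y + t *\<^sub>R (x - y) \<in> ball q d"
        using convexD_alt [OF convex_ball xy(2,1), of t] t by simp
    next
      fix z assume z: "z \<in> ball q d"
      then show "(G has_derivative D z) (at z within ball q d)"
        using D sub has_derivative_at_withinI by blast
      have "onorm (D z - D q) = norm (B z - B q)"
      proof -
        have "blinfun_apply (B z - B q) = D z - D q"
          using B [of z] B [OF U(2)] z sub by (intro ext) (auto simp: blinfun.diff_left)
        then show ?thesis by (simp add: norm_blinfun.rep_eq)
      qed
      also have "\<dots> \<le> e" using d1(2) [of z] z sub by (auto simp: dist_norm norm_minus_commute d_def subset_iff)
      finally show "onorm (D z - D q) \<le> e" .
    next
      show "q \<in> ball q d" using \<open>d > 0\<close> by simp
    qed
    then show "norm (G x - G y - D q (x - y)) \<le> e * norm (x - y)" by (simp add: mult.commute)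
  qed
qed

section \<open>The unit normal of a smooth convex body and its derivative\<close>

text \<open>Every vector orthogonal to the gradient is tangent to the zero set: the function changes sign
  between \<open>q + r (w - c g)\<close> and \<open>q + r (w + c g)\<close>.\<close>

lemma tangent_direction_approximable:
  fixes S :: "'a::euclidean_space set"
  assumes le: "local_equation S q U f g" and q: "q \<in> S" and w: "w \<bullet> g q = 0" and e: "e > 0"
  shows "\<exists>x\<in>S. \<exists>r. 0 < r \<and> r < e \<and> norm ((x - q) /\<^sub>R r - w) < e"
proof -
  from le have U: "open U" "q \<in> U" "S \<inter> U = {y\<in>U. f y = 0}" "continuous_on U f"
      and gr: "(f has_derivative (\<lambda>h. h \<bullet> g q)) (at q)" "g q \<noteq> 0"
    unfolding local_equation_def gderiv_def
    by (auto intro!: has_derivative_continuous_on intro: has_derivative_at_withinI)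
  have fq: "f q = 0" using q U by auto
  let ?G = "g q"
  define c where "c = e / (2 * norm ?G)"
  have c: "c > 0" using e gr by (simp add: c_def)
  define M where "M = norm w + c * norm ?G + 1"
  have M: "M > 0" using c by (simp add: M_def add_nonneg_pos)
  define \<eta> where "\<eta> = c * (?G \<bullet> ?G) / (2 * M)"
  have \<eta>: "\<eta> > 0" using c M gr by (simp add: \<eta>_def)
  obtain d where d: "d > 0" "\<And>y. norm (y - q) < d \<Longrightarrow> norm (f y - f q - (y - q) \<bullet> ?G) \<le> \<eta> * norm (y - q)"
    using gr(1) \<eta> unfolding has_derivative_at_alt by blast
  obtain d' where d': "d' > 0" "ball q d' \<subseteq> U" using U openE by blast
  define r where "r = min (e / 2) (min d d' / (2 * M))"
  have r: "r > 0" "r < e" using e d d' M by (auto simp: r_def)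
  have "r * M \<le> min d d' / (2 * M) * M" using M by (intro mult_right_mono) (auto simp: r_def)
  also have "\<dots> = min d d' / 2" using M by simp
  also have "\<dots> < min d d'" using d d' by (auto simp: min_def)
  finally have rM: "r * M < min d d'" .
  let ?p = "\<lambda>l. q + r *\<^sub>R (w + l *\<^sub>R ?G)"
  have nl: "norm (w + l *\<^sub>R ?G) \<le> M" if "\<bar>l\<bar> \<le> c" for l
  proof -
    have "norm (w + l *\<^sub>R ?G) \<le> norm w + \<bar>l\<bar> * norm ?G" using norm_triangle_ineq [of w "l *\<^sub>R ?G"] by simp
    also have "\<dots> \<le> M" using that mult_right_mono [of "\<bar>l\<bar>" c "norm ?G"] by (simp add: M_def)
    finally show ?thesis .
  qed
  have np: "norm (?p l - q) \<le> r * M" if "\<bar>l\<bar> \<le> c" for l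
    using nl [OF that] r by simp
  have pU: "?p l \<in> U" if "\<bar>l\<bar> \<le> c" for l
    using np [OF that] rM d' by (auto simp: dist_norm norm_minus_commute subset_iff)
  have est: "\<bar>f (?p l) - r * l * (?G \<bullet> ?G)\<bar> \<le> r * c * (?G \<bullet> ?G) / 2" if "\<bar>l\<bar> \<le> c" for l
  proof -
    have "norm (f (?p l) - f q - (?p l - q) \<bullet> ?G) \<le> \<eta> * norm (?p l - q)"
      using np [OF that] rM by (intro d) auto
    also have "\<dots> \<le> \<eta> * (r * M)" using np [OF that] \<eta> by (intro mult_left_mono) auto
    also have "\<dots> = r * c * (?G \<bullet> ?G) / 2" using M by (simp add: \<eta>_def)
    finally show ?thesis using w fq by (simp add: inner_add_left mult_ac)
  qed
  have pos: "r * c * (?G \<bullet> ?G) > 0" using r c gr by simp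
  have "\<bar>f (?p c) - r * c * (?G \<bullet> ?G)\<bar> \<le> r * c * (?G \<bullet> ?G) / 2" using c by (intro est) simp
  then have "f (?p c) \<ge> 0" using pos by argo
  moreover have "\<bar>f (?p (- c)) - r * (- c) * (?G \<bullet> ?G)\<bar> \<le> r * c * (?G \<bullet> ?G) / 2" using c by (intro est) simp
  then have "f (?p (- c)) \<le> 0" using pos by argo
  moreover have "continuous_on {- c..c} (\<lambda>l. f (?p l))"
    by (rule continuous_on_compose2 [OF U(4)]) (use pU in \<open>auto intro!: continuous_intros\<close>)
  ultimately obtain l where l: "- c \<le> l" "l \<le> c" "f (?p l) = 0"
    using IVT' [of "\<lambda>l. f (?p l)" "- c" 0 c] c by auto
  then have "?p l \<in> S" using pU [of l] U(3) by (auto simp: abs_le_iff)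
  moreover have "(?p l - q) /\<^sub>R r - w = l *\<^sub>R ?G" using r by simp
  then have "norm ((?p l - q) /\<^sub>R r - w) \<le> c * norm ?G" using l by (auto intro!: mult_right_mono)
  then have "norm ((?p l - q) /\<^sub>R r - w) < e" using e gr by (simp add: c_def)
  ultimately show ?thesis using r by blast
qed

locale C2_body = body +
  assumes C2: "C2_hypersurface (frontier K)"
begin

lemma frontier_subset: "frontier K \<subseteq> K"
  using closed_K by (simp add: frontier_subset_closed)

lemma compact_frontier: "compact (frontier K)"
  using bounded_K by (simp add: compact_frontier_bounded)

text \<open>A supporting functional is nonnegative in every tangent direction and in its opposite, so it
  vanishes on the tangent space.\<close>

lemma support_in_span_gradient:
  assumes le: "local_equation (frontier K) q U f g" and q: "q \<in> frontier K"
    and v: "\<And>x. x \<in> K \<Longrightarrow> v \<bullet> q \<le> v \<bullet> x"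
  shows "v \<in> span {g q}"
proof -
  from le have g0: "g q \<noteq> 0" unfolding local_equation_def by blast
  define k where "k = (v \<bullet> g q) / (g q \<bullet> g q)"
  define w where "w = v - k *\<^sub>R g q"
  have wg: "w \<bullet> g q = 0" using g0 by (simp add: w_def k_def inner_diff_left)
  have vw: "v \<bullet> w = w \<bullet> w"
    using wg by (simp add: w_def inner_diff_left inner_diff_right inner_commute)
  have "w \<bullet> w \<le> 0"
  proof (rule field_le_epsilon)
    fix e :: real assume e: "e > 0"
    define e' where "e' = e / (norm v + 1)"
    have e': "e' > 0" using e by (simp add: e'_def add_nonneg_pos)
    obtain x r where x: "x \<in> frontier K" "r > 0" "norm ((x - q) /\<^sub>R r - (- w)) < e'"
      using tangent_direction_approximable [OF le q _ e', of "- w"] wg by auto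
    have "v \<bullet> ((x - q) /\<^sub>R r) \<ge> 0"
      using v [of x] x frontier_subset by (auto simp: inner_diff_right divide_inverse [symmetric])
    moreover have "v \<bullet> ((x - q) /\<^sub>R r) - v \<bullet> (- w) \<le> norm v * norm ((x - q) /\<^sub>R r - (- w))"
      unfolding inner_diff_right [symmetric] by (rule norm_cauchy_schwarz)
    moreover have "norm v * norm ((x - q) /\<^sub>R r - (- w)) \<le> norm v * e'"
      using x by (intro mult_left_mono) auto
    moreover have "norm v * e' \<le> e"
    proof -
      have "norm v * e' \<le> (norm v + 1) * e'" using e' by (intro mult_right_mono) auto
      moreover have "norm v + 1 \<noteq> 0" by (smt (verit) norm_ge_zero)
      ultimately show ?thesis by (simp add: e'_def)
    qed
    ultimately show "w \<bullet> w \<le> 0 + e" using vw by simp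
  qed
  then have "w = 0" by (metis inner_eq_zero_iff inner_ge_zero antisym)
  then have "v = k *\<^sub>R g q" by (simp add: w_def)
  then show ?thesis unfolding span_singleton by blast
qed

lemma unit_normal_ex1:
  assumes q: "q \<in> frontier K"
  shows "\<exists>!v. norm v = 1 \<and> (\<forall>x\<in>K. v \<bullet> q \<le> v \<bullet> x)"
proof (rule ex_ex1I)
  have "q \<notin> rel_interior K"
    using q unfolding frontier_def rel_interior_nonempty_interior [OF interior_K] by simp
  then obtain a where a: "a \<noteq> 0" "\<And>x. x \<in> K \<Longrightarrow> a \<bullet> q \<le> a \<bullet> x"
    using supporting_hyperplane_rel_boundary [OF convex_K, of q] q frontier_subset by (metis subsetD)
  then show "\<exists>v. norm v = 1 \<and> (\<forall>x\<in>K. v \<bullet> q \<le> v \<bullet> x)"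
    by (intro exI [of _ "a /\<^sub>R norm a"]) (auto intro!: mult_left_mono)
next
  fix v v' assume v: "norm v = 1 \<and> (\<forall>x\<in>K. v \<bullet> q \<le> v \<bullet> x)" and v': "norm v' = 1 \<and> (\<forall>x\<in>K. v' \<bullet> q \<le> v' \<bullet> x)"
  obtain U f g where le: "local_equation (frontier K) q U f g"
    using C2 q unfolding C2_hypersurface_def by blast
  obtain k where k: "v = k *\<^sub>R g q" using support_in_span_gradient [OF le q] v unfolding span_singleton by blast
  obtain k' where k': "v' = k' *\<^sub>R g q" using support_in_span_gradient [OF le q] v' unfolding span_singleton by blast
  have "\<bar>k\<bar> * norm (g q) = \<bar>k'\<bar> * norm (g q)" "k \<noteq> 0" "g q \<noteq> 0" using v v' k k' by auto
  then have "k' = k \<or> k' = - k" by auto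
  moreover have "k' \<noteq> - k"
  proof
    assume "k' = - k"
    then have "v' = - v" using k k' by simp
    then have "K \<subseteq> {x. v \<bullet> x = v \<bullet> q}" using v v' by (auto simp: antisym)
    moreover have "v \<noteq> 0" using v by auto
    ultimately have "interior K = {}" using interior_hyperplane interior_mono by (metis subset_empty)
    then show False using interior_K by simp
  qed
  ultimately show "v = v'" using k k' by simp
qed

definition nu :: "'a \<Rightarrow> 'a" where "nu = inner_normal K"

lemma norm_nu: "q \<in> frontier K \<Longrightarrow> norm (nu q) = 1"
  and nu_le: "q \<in> frontier K \<Longrightarrow> x \<in> K \<Longrightarrow> nu q \<bullet> q \<le> nu q \<bullet> x"
  using theI' [OF unit_normal_ex1, of q] unfolding nu_def inner_normal_def by auto

lemma nu_unique:
  assumes "q \<in> frontier K" "norm v = 1" "\<And>x. x \<in> K \<Longrightarrow> v \<bullet> q \<le> v \<bullet> x"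
  shows "nu q = v"
  using unit_normal_ex1 [OF assms(1)] norm_nu nu_le assms by blast

lemma nu_nu: "q \<in> frontier K \<Longrightarrow> nu q \<bullet> nu q = 1"
  using norm_nu by (simp add: norm_eq_1)

lemma support_direction:
  assumes q: "q \<in> frontier K" and v: "v \<noteq> 0" "\<And>x. x \<in> K \<Longrightarrow> v \<bullet> q \<le> v \<bullet> x"
  shows "v = norm v *\<^sub>R nu q"
proof -
  have "nu q = v /\<^sub>R norm v"
    by (rule nu_unique [OF q]) (use v in \<open>auto intro!: mult_left_mono\<close>)
  then show ?thesis using v by simp
qed

text \<open>Limits of unit normals are again supporting, so uniqueness of the normal makes it continuous.\<close>

lemma continuous_nu: "continuous_on (frontier K) nu"
proof (rule continuous_from_closed_graph)
  show "compact (sphere (0::'a) 1)" by simp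
  show "nu \<in> frontier K \<rightarrow> sphere 0 1" using norm_nu by auto
  show "closed ((\<lambda>x. (x, nu x)) ` frontier K)"
  proof (subst closed_sequential_limits, intro allI impI)
    fix X l assume *: "(\<forall>n. X n \<in> (\<lambda>x. (x, nu x)) ` frontier K) \<and> X \<longlonglongrightarrow> l"
    have ex: "\<exists>z\<in>frontier K. X n = (z, nu z)" for n using conjunct1 [OF *, rule_format, of n] by blast
    have X: "fst (X n) \<in> frontier K" "snd (X n) = nu (fst (X n))" for n using ex [of n] by auto
    have lim: "(\<lambda>n. fst (X n)) \<longlonglongrightarrow> fst l" "(\<lambda>n. snd (X n)) \<longlonglongrightarrow> snd l"
      using * by (auto intro: tendsto_fst tendsto_snd)
    have l: "fst l \<in> frontier K"
      by (rule closed_sequentially [OF frontier_closed X(1) lim(1)])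
    have "nu (fst l) = snd l"
    proof (rule nu_unique [OF l])
      have "(\<lambda>n. norm (snd (X n))) \<longlonglongrightarrow> norm (snd l)" by (intro tendsto_intros lim)
      moreover have "norm (snd (X n)) = 1" for n using X norm_nu by simp
      ultimately show "norm (snd l) = 1" by (simp add: LIMSEQ_const_iff)
      fix x assume x: "x \<in> K"
      show "snd l \<bullet> fst l \<le> snd l \<bullet> x"
        by (rule LIMSEQ_le [where X="\<lambda>n. snd (X n) \<bullet> fst (X n)" and Y="\<lambda>n. snd (X n) \<bullet> x"])
           (intro tendsto_intros lim, intro tendsto_intros lim, use X nu_le x in auto)
    qed
    then have "l = (fst l, nu (fst l))" by (simp add: prod_eq_iff)
    then show "l \<in> (\<lambda>x. (x, nu x)) ` frontier K" using l by (rule image_eqI)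
  qed
qed

lemma nu_tendsto:
  assumes "\<And>n. x n \<in> frontier K" "x \<longlonglongrightarrow> q"
  shows "q \<in> frontier K" "(\<lambda>n. nu (x n)) \<longlonglongrightarrow> nu q"
proof -
  show q: "q \<in> frontier K" by (rule closed_sequentially [OF frontier_closed assms])
  show "(\<lambda>n. nu (x n)) \<longlonglongrightarrow> nu q"
    using continuous_on_tendsto_compose [OF continuous_nu assms(2) q] assms by simp
qed

text \<open>A derivative of the inner unit normal along the boundary.  It is required to be strict, that is to
  control differences between any two nearby boundary points; this replaces charts in all limit
  arguments below.\<close>

definition is_shape :: "'a \<Rightarrow> ('a \<Rightarrow> 'a) \<Rightarrow> bool" where
  "is_shape q D \<longleftrightarrow> linear D \<and> (\<forall>w. nu q \<bullet> D w = 0) \<and>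
     (\<forall>u w. nu q \<bullet> u = 0 \<longrightarrow> nu q \<bullet> w = 0 \<longrightarrow> D u \<bullet> w = D w \<bullet> u) \<and>
     (\<forall>e>0. \<exists>d>0. \<forall>x\<in>frontier K \<inter> ball q d. \<forall>y\<in>frontier K \<inter> ball q d.
        norm (nu x - nu y - D (x - y)) \<le> e * norm (x - y))"

lemma tangent_approximable:
  assumes q: "q \<in> frontier K" and w: "nu q \<bullet> w = 0" and e: "e > 0"
  shows "\<exists>x\<in>frontier K. \<exists>r. 0 < r \<and> r < e \<and> norm ((x - q) /\<^sub>R r - w) < e"
proof -
  obtain U f g where le: "local_equation (frontier K) q U f g"
    using C2 q unfolding C2_hypersurface_def by blast
  obtain k where k: "nu q = k *\<^sub>R g q"
    using support_in_span_gradient [OF le q nu_le [OF q]] unfolding span_singleton by blast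
  then have "k \<noteq> 0" using norm_nu [OF q] by auto
  then have "w \<bullet> g q = 0" using w k by (simp add: inner_commute)
  from tangent_direction_approximable [OF le q this e] show ?thesis .
qed

text \<open>Near \<^term>\<open>q\<close> the normal is, up to a constant sign, the normalised gradient of a local equation.
  Its derivative is symmetric on the tangent space because it is a multiple of a Hessian there.\<close>

lemma ex_shape:
  assumes q: "q \<in> frontier K"
  shows "\<exists>D. is_shape q D"
proof -
  obtain U f g and H :: "'a \<Rightarrow> 'a \<Rightarrow>\<^sub>L 'a" where le: "local_equation (frontier K) q U f g"
    and H: "\<And>y. y \<in> U \<Longrightarrow> (g has_derivative blinfun_apply (H y)) (at y)" and cH: "continuous_on U H"
    using C2 q unfolding C2_hypersurface_def by blast
  from le have U: "open U" "q \<in> U" and f: "\<And>y. y \<in> U \<Longrightarrow> GDERIV f y :> g y" and g0: "\<And>y. y \<in> U \<Longrightarrow> g y \<noteq> 0"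
    and cg: "continuous_on U g" and SU: "frontier K \<inter> U = {y\<in>U. f y = 0}"
    unfolding local_equation_def by auto
  have gpar: "nu x \<in> span {g x}" if "x \<in> frontier K" "x \<in> U" for x
  proof (rule support_in_span_gradient [where U=U and f=f and g=g and q=x])
    show "local_equation (frontier K) x U f g" using le that unfolding local_equation_def by blast
  qed (use that nu_le in auto)
  define G where "G y = inverse (norm (g y)) *\<^sub>R g y" for y
  define D where "D y h = inverse (norm (g y)) *\<^sub>R H y h
      - (inverse (norm (g y)) * (H y h \<bullet> sgn (g y)) * inverse (norm (g y))) *\<^sub>R g y" for y h
  have DG: "(G has_derivative D y) (at y)" if y: "y \<in> U" for y
  proof -
    have n: "((\<lambda>y. norm (g y)) has_derivative (\<lambda>h. H y h \<bullet> sgn (g y))) (at y)"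
      by (rule has_derivative_compose [OF H [OF y] has_derivative_norm [OF g0 [OF y]]])
    show ?thesis unfolding G_def D_def
      by (rule derivative_eq_intros n H [OF y] refl | simp add: g0 [OF y] algebra_simps)+
  qed
  have cD: "continuous_on U (\<lambda>y. D y i)" for i
    unfolding D_def sgn_div_norm using g0
    by (intro continuous_intros cg cH) auto
  have G1: "norm (G y) = 1" if "y \<in> U" for y using g0 [OF that] by (simp add: G_def)
  have nuG: "nu x = (nu x \<bullet> G x) *\<^sub>R G x \<and> (nu x \<bullet> G x = 1 \<or> nu x \<bullet> G x = -1)" if x: "x \<in> frontier K" "x \<in> U" for x
  proof -
    obtain k where k: "nu x = k *\<^sub>R g x" using gpar [OF x] unfolding span_singleton by blast
    then have k': "nu x = (k * norm (g x)) *\<^sub>R G x" using g0 [OF x(2)] by (simp add: G_def)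
    have GG: "G x \<bullet> G x = 1" using G1 [OF x(2)] by (simp add: norm_eq_1)
    then have eq: "nu x \<bullet> G x = k * norm (g x)" by (simp add: k')
    have "\<bar>k * norm (g x)\<bar> = 1" using norm_nu [OF x(1)] k by (simp add: abs_mult)
    then show ?thesis using eq k' by (auto simp: abs_if split: if_splits)
  qed
  define \<sigma> where "\<sigma> = nu q \<bullet> G q"
  have s: "\<sigma> = 1 \<or> \<sigma> = -1" and nuq: "nu q = \<sigma> *\<^sub>R G q" using nuG [OF q U(2)] by (auto simp: \<sigma>_def)
  have "continuous_on (frontier K \<inter> U) (\<lambda>x. nu x \<bullet> G x)"
    unfolding G_def using g0
    by (intro continuous_intros continuous_on_subset [OF continuous_nu] continuous_on_subset [OF cg]) auto
  then obtain d0 where d0: "d0 > 0" "\<And>x. x \<in> frontier K \<inter> U \<Longrightarrow> dist x q < d0 \<Longrightarrow> dist (nu x \<bullet> G x) \<sigma> < 1"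
    unfolding continuous_on_iff \<sigma>_def using q U(2) zero_less_one by (metis IntI)
  obtain d1 where d1: "d1 > 0" "ball q d1 \<subseteq> U" using U openE by blast
  have loc: "nu x = \<sigma> *\<^sub>R G x" if x: "x \<in> frontier K" "dist q x < min d0 d1" for x
  proof -
    have xU: "x \<in> U" using x d1 by auto
    have "dist (nu x \<bullet> G x) \<sigma> < 1" using d0 x xU by (auto simp: dist_commute)
    then have "nu x \<bullet> G x = \<sigma>" using nuG [OF x(1) xU] s by (auto simp: dist_real_def)
    then show ?thesis using nuG [OF x(1) xU] by simp
  qed
  have sg: "\<sigma> * (nu q \<bullet> x) * norm (g q) = g q \<bullet> x" for x
    using s g0 [OF U(2)] by (auto simp: nuq G_def)
  have perp: "g q \<bullet> x = 0" if "nu q \<bullet> x = 0" for x using sg [of x] that by simp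
  let ?D = "\<lambda>h. \<sigma> *\<^sub>R D q h"
  have 1: "linear ?D"
    using has_derivative_linear [OF DG [OF U(2)]] by (intro linear_compose_scale_right)
  have 2: "nu q \<bullet> ?D w = 0" for w
  proof -
    have "g q \<bullet> D q w = 0" using g0 [OF U(2)]
      by (simp add: D_def inner_diff_right sgn_div_norm inner_commute power2_norm_eq_inner [symmetric]
          power2_eq_square dot_square_norm field_simps)
    then show ?thesis by (simp add: nuq G_def)
  qed
  have 3: "?D u \<bullet> w = ?D w \<bullet> u" if "nu q \<bullet> u = 0" "nu q \<bullet> w = 0" for u w
    using gradient_derivative_symmetric [OF U f H [OF U(2)], of u w] perp [OF that(1)] perp [OF that(2)]
    by (simp add: D_def inner_diff_left)
  have 4: "\<exists>d>0. \<forall>x\<in>frontier K \<inter> ball q d. \<forall>y\<in>frontier K \<inter> ball q d.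
        norm (nu x - nu y - ?D (x - y)) \<le> e * norm (x - y)" if e: "e > 0" for e
  proof -
    obtain d2 where d2: "d2 > 0" "\<And>x y. x \<in> ball q d2 \<Longrightarrow> y \<in> ball q d2 \<Longrightarrow> norm (G x - G y - D q (x - y)) \<le> e * norm (x - y)"
      using strictly_differentiable [OF U DG cD e] by blast
    show ?thesis
    proof (intro exI [of _ "min d2 (min d0 d1)"] conjI ballI)
      fix x y assume x: "x \<in> frontier K \<inter> ball q (min d2 (min d0 d1))" and y: "y \<in> frontier K \<inter> ball q (min d2 (min d0 d1))"
      have "nu x - nu y - ?D (x - y) = \<sigma> *\<^sub>R (G x - G y - D q (x - y))"
        using loc [of x] loc [of y] x y by (simp add: algebra_simps)
      then have "norm (nu x - nu y - ?D (x - y)) = norm (G x - G y - D q (x - y))" using s by auto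
      also have "\<dots> \<le> e * norm (x - y)" using x y by (intro d2) auto
      finally show "norm (nu x - nu y - ?D (x - y)) \<le> e * norm (x - y)" .
    qed (use d0 d1 d2 in auto)
  qed
  show ?thesis unfolding is_shape_def
    by (intro exI [of _ ?D] conjI allI impI 1 2 3 4)
qed

end

section \<open>The shape operator\<close>

lemma norm_scaleR_inverse: "a > 0 \<Longrightarrow> norm (z /\<^sub>R a) = norm z / a"
  by (simp add: divide_inverse_commute)

context C2_body
begin

text \<open>The choice matters only off the tangent space, where the derivative along the boundary is not
  determined.\<close>

definition shape :: "'a \<Rightarrow> 'a \<Rightarrow> 'a" where "shape q = (SOME D. is_shape q D)"

lemma is_shape_shape: "q \<in> frontier K \<Longrightarrow> is_shape q (shape q)"
  unfolding shape_def using ex_shape by (rule someI_ex)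

lemma linear_shape: "q \<in> frontier K \<Longrightarrow> linear (shape q)"
  and nu_shape: "q \<in> frontier K \<Longrightarrow> nu q \<bullet> shape q w = 0"
  and shape_symmetric: "q \<in> frontier K \<Longrightarrow> nu q \<bullet> u = 0 \<Longrightarrow> nu q \<bullet> w = 0 \<Longrightarrow> shape q u \<bullet> w = shape q w \<bullet> u"
  and shape_strict: "q \<in> frontier K \<Longrightarrow> e > 0 \<Longrightarrow> \<exists>d>0. \<forall>x\<in>frontier K \<inter> ball q d. \<forall>y\<in>frontier K \<inter> ball q d.
        norm (nu x - nu y - shape q (x - y)) \<le> e * norm (x - y)"
  using is_shape_shape unfolding is_shape_def by auto

lemma shape_tendsto:
  assumes "q \<in> frontier K" "(w \<longlongrightarrow> l) F"
  shows "((\<lambda>n. shape q (w n)) \<longlongrightarrow> shape q l) F"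
  using linear_continuous_at [OF linear_conv_bounded_linear [THEN iffD1, OF linear_shape [OF assms(1)]], of l]
    assms(2) unfolding isCont_def by (metis assms(1) bounded_linear.tendsto linear_conv_bounded_linear linear_shape)

lemma shape_has_derivative:
  assumes q: "q \<in> frontier K"
  shows "(inner_normal K has_derivative shape q) (at q within frontier K)"
  unfolding has_derivative_within_alt nu_def [symmetric]
proof (intro conjI allI impI)
  show "bounded_linear (shape q)" using linear_shape [OF q] by (simp add: linear_conv_bounded_linear)
  fix e :: real assume "e > 0"
  then obtain d where d: "d > 0" "\<forall>x\<in>frontier K \<inter> ball q d. \<forall>y\<in>frontier K \<inter> ball q d.
        norm (nu x - nu y - shape q (x - y)) \<le> e * norm (x - y)" using shape_strict [OF q] by blast
  then show "\<exists>d>0. \<forall>y\<in>frontier K. norm (y - q) < d \<longrightarrow> norm (nu y - nu q - shape q (y - q)) \<le> e * norm (y - q)"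
    using q by (intro exI [of _ d]) (auto simp: dist_norm norm_minus_commute)
qed

lemma centre_of_curvature:
  assumes q: "q \<in> frontier K" and w: "w \<noteq> 0" "nu q \<bullet> w = 0" and s: "s > 0" "w + s *\<^sub>R shape q w = 0"
  shows "q + s *\<^sub>R nu q \<in> centres_of_curvature K"
proof -
  have "s *\<^sub>R shape q w = - w" using s(2) by (simp add: eq_neg_iff_add_eq_0 add.commute)
  then have "(1 / s) *\<^sub>R (s *\<^sub>R shape q w) = (1 / s) *\<^sub>R (- w)" by simp
  then have "shape q w = - (1 / s) *\<^sub>R w" using s by simp
  then have "principal_curvature K q (1 / s)"
    unfolding principal_curvature_def nu_def [symmetric]
    using shape_has_derivative [OF q] w by (auto simp: nu_def inner_commute intro!: exI [of _ "shape q"] exI [of _ w])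
  then show ?thesis
    unfolding centres_of_curvature_def using q s by (auto simp: nu_def intro!: exI [of _ q] exI [of _ "1 / s"])
qed

text \<open>Secants of the boundary shrinking to \<^term>\<open>q\<close> become tangent at \<^term>\<open>q\<close>, by monotonicity of the
  normals of a convex body.\<close>

lemma secant_limit:
  assumes x: "\<And>n::nat. x n \<in> frontier K" "x \<longlonglongrightarrow> q" and y: "\<And>n. y n \<in> frontier K" "y \<longlonglongrightarrow> q"
    and ne: "\<And>n. x n \<noteq> y n"
  obtains r w where "strict_mono (r :: nat \<Rightarrow> nat)" "norm w = 1" "nu q \<bullet> w = 0"
    "(\<lambda>n. (x (r n) - y (r n)) /\<^sub>R norm (x (r n) - y (r n))) \<longlonglongrightarrow> w"
    "(\<lambda>n. (nu (x (r n)) - nu (y (r n))) /\<^sub>R norm (x (r n) - y (r n))) \<longlonglongrightarrow> shape q w"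
proof -
  define u where "u n = (x n - y n) /\<^sub>R norm (x n - y n)" for n
  have u1: "norm (u n) = 1" for n using ne [of n] by (simp add: u_def)
  have "seq_compact (sphere (0::'a) 1)" using compact_sphere compact_eq_seq_compact_metric by blast
  then obtain w r where w: "w \<in> sphere 0 1" and r: "strict_mono (r :: nat \<Rightarrow> nat)" and lim: "(u \<circ> r) \<longlonglongrightarrow> w"
    using seq_compactE [of "sphere 0 1" u] u1 by (metis mem_sphere_0)
  have q: "q \<in> frontier K" using nu_tendsto(1) x by blast
  have xr: "(\<lambda>n. x (r n)) \<longlonglongrightarrow> q" "(\<lambda>n. y (r n)) \<longlonglongrightarrow> q"
    using LIMSEQ_subseq_LIMSEQ [OF x(2) r] LIMSEQ_subseq_LIMSEQ [OF y(2) r] by (auto simp: o_def)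
  have lim': "(\<lambda>n. u (r n)) \<longlonglongrightarrow> w" using lim by (simp add: o_def)
  have nux: "(\<lambda>n. nu (x (r n))) \<longlonglongrightarrow> nu q" by (rule nu_tendsto(2)) (use x xr in auto)
  have nuy: "(\<lambda>n. nu (y (r n))) \<longlonglongrightarrow> nu q" by (rule nu_tendsto(2)) (use y xr in auto)
  have "nu (x n) \<bullet> u n \<le> 0" for n
  proof -
    have "nu (x n) \<bullet> (x n - y n) \<le> 0" using nu_le [OF x(1), of "y n"] y(1) frontier_subset by (auto simp: inner_diff_right)
    then show ?thesis by (simp add: u_def mult_nonneg_nonpos)
  qed
  then have "nu q \<bullet> w \<le> 0"
    by (intro LIMSEQ_le_const2 [OF tendsto_inner [OF nux lim']]) auto
  moreover have "nu (y n) \<bullet> u n \<ge> 0" for n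
  proof -
    have "nu (y n) \<bullet> (x n - y n) \<ge> 0" using nu_le [OF y(1), of "x n"] x(1) frontier_subset by (auto simp: inner_diff_right)
    then show ?thesis by (simp add: u_def)
  qed
  then have "nu q \<bullet> w \<ge> 0"
    by (intro LIMSEQ_le_const [OF tendsto_inner [OF nuy lim']]) auto
  ultimately have tang: "nu q \<bullet> w = 0" by simp
  define v where "v n = (nu (x n) - nu (y n)) /\<^sub>R norm (x n - y n)" for n
  have "(\<lambda>n. v (r n) - shape q (u (r n))) \<longlonglongrightarrow> 0"
  proof (rule LIMSEQ_I)
    fix e :: real assume e: "e > 0"
    obtain d where d: "d > 0" "\<forall>x\<in>frontier K \<inter> ball q d. \<forall>y\<in>frontier K \<inter> ball q d.
        norm (nu x - nu y - shape q (x - y)) \<le> (e/2) * norm (x - y)" using shape_strict [OF q, of "e/2"] e by auto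
    have "\<forall>\<^sub>F n in sequentially. dist (x (r n)) q < d \<and> dist (y (r n)) q < d"
      using tendstoD [OF xr(1) d(1)] tendstoD [OF xr(2) d(1)] by (rule eventually_conj)
    then obtain N where N: "\<And>n. n \<ge> N \<Longrightarrow> dist (x (r n)) q < d \<and> dist (y (r n)) q < d"
      unfolding eventually_sequentially by blast
    have "norm (v (r n) - shape q (u (r n)) - 0) < e" if "n \<ge> N" for n
    proof -
      let ?x = "x (r n)" and ?y = "y (r n)"
      have np: "norm (?x - ?y) > 0" using ne by simp
      have "norm (nu ?x - nu ?y - shape q (?x - ?y)) \<le> (e/2) * norm (?x - ?y)"
        using d(2) x(1) y(1) N [OF that] by (auto simp: dist_commute)
      then have "norm (nu ?x - nu ?y - shape q (?x - ?y)) / norm (?x - ?y) \<le> e / 2"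
        using np by (simp add: pos_divide_le_eq)
      moreover have "v (r n) - shape q (u (r n)) = (nu ?x - nu ?y - shape q (?x - ?y)) /\<^sub>R norm (?x - ?y)"
        unfolding v_def u_def linear_scale [OF linear_shape [OF q]] by (simp add: scaleR_diff_right)
      ultimately have "norm (v (r n) - shape q (u (r n))) \<le> e / 2" by (simp only: norm_scaleR_inverse [OF np])
      then show ?thesis using e by simp
    qed
    then show "\<exists>N. \<forall>n\<ge>N. norm (v (r n) - shape q (u (r n)) - 0) < e" by blast
  qed
  from tendsto_add [OF this shape_tendsto [OF q lim']]
  have "(\<lambda>n. v (r n)) \<longlonglongrightarrow> shape q w" by simp
  with that [OF r _ tang] w lim' show ?thesis unfolding u_def v_def by simp
qed

text \<open>Divide the equation that makes two normals meet by the distance of their starting points.  In the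
  limit the normal component drops out, and what remains says that the limit of the secants is an
  eigenvector of the shape operator for \<open>- 1 / l\<close>.\<close>

lemma focal_limit:
  assumes x: "\<And>n::nat. x n \<in> frontier K" "x \<longlonglongrightarrow> q" and y: "\<And>n. y n \<in> frontier K" "y \<longlonglongrightarrow> q"
    and ne: "\<And>n. x n \<noteq> y n" and s: "s \<longlonglongrightarrow> l"
    and eq: "\<And>n. x n + s n *\<^sub>R nu (x n) = y n + t n *\<^sub>R nu (y n)"
  shows "\<exists>w. w \<noteq> 0 \<and> nu q \<bullet> w = 0 \<and> w + l *\<^sub>R shape q w = 0"
proof -
  obtain r w where r: "strict_mono (r :: nat \<Rightarrow> nat)" and w: "norm w = 1" "nu q \<bullet> w = 0"
    and u: "(\<lambda>n. (x (r n) - y (r n)) /\<^sub>R norm (x (r n) - y (r n))) \<longlonglongrightarrow> w"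
    and v: "(\<lambda>n. (nu (x (r n)) - nu (y (r n))) /\<^sub>R norm (x (r n) - y (r n))) \<longlonglongrightarrow> shape q w"
    using secant_limit [OF x y ne] by blast
  have q: "q \<in> frontier K" using nu_tendsto(1) x by blast
  have nuy: "(\<lambda>n. nu (y (r n))) \<longlonglongrightarrow> nu q"
    by (rule nu_tendsto(2)) (use y LIMSEQ_subseq_LIMSEQ [OF y(2) r] in \<open>auto simp: o_def\<close>)
  have sr: "(\<lambda>n. s (r n)) \<longlonglongrightarrow> l" using LIMSEQ_subseq_LIMSEQ [OF s r] by (simp add: o_def)
  define z where "z n = (x n - y n) /\<^sub>R norm (x n - y n) + s n *\<^sub>R ((nu (x n) - nu (y n)) /\<^sub>R norm (x n - y n))" for n
  have lim: "(\<lambda>n. z (r n)) \<longlonglongrightarrow> w + l *\<^sub>R shape q w"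
    unfolding z_def by (intro tendsto_intros u v sr)
  have zn: "z n = ((t n - s n) / norm (x n - y n)) *\<^sub>R nu (y n)" for n
  proof -
    have "(x n - y n) + s n *\<^sub>R (nu (x n) - nu (y n)) = (t n - s n) *\<^sub>R nu (y n)"
      using eq [of n] by (simp add: algebra_simps)
    then have "((x n - y n) + s n *\<^sub>R (nu (x n) - nu (y n))) /\<^sub>R norm (x n - y n) = ((t n - s n) *\<^sub>R nu (y n)) /\<^sub>R norm (x n - y n)"
      by (rule arg_cong)
    then show ?thesis unfolding z_def by (simp add: algebra_simps divide_inverse)
  qed
  then have "z n = (z n \<bullet> nu (y n)) *\<^sub>R nu (y n)" for n using nu_nu [OF y(1)] by simp
  then have "(\<lambda>n. z (r n)) = (\<lambda>n. (z (r n) \<bullet> nu (y (r n))) *\<^sub>R nu (y (r n)))" by auto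
  moreover have "(\<lambda>n. (z (r n) \<bullet> nu (y (r n))) *\<^sub>R nu (y (r n))) \<longlonglongrightarrow> ((w + l *\<^sub>R shape q w) \<bullet> nu q) *\<^sub>R nu q"
    by (intro tendsto_intros lim nuy)
  moreover have "(w + l *\<^sub>R shape q w) \<bullet> nu q = 0"
    using w(2) nu_shape [OF q] by (simp add: inner_commute [of _ "nu q"] inner_add_right)
  ultimately have "(\<lambda>n. z (r n)) \<longlonglongrightarrow> 0" by simp
  then have "w + l *\<^sub>R shape q w = 0" using lim LIMSEQ_unique by blast
  moreover have "w \<noteq> 0" using w(1) by auto
  ultimately show ?thesis using w(2) by blast
qed

text \<open>Otherwise secants on which the normal hardly changes would converge to a tangent vector in the kernel
  of the shape operator.\<close>

lemma nu_locally_expanding: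
  assumes q: "q \<in> frontier K" and inj: "\<And>w. nu q \<bullet> w = 0 \<Longrightarrow> shape q w = 0 \<Longrightarrow> w = 0"
  shows "\<exists>c>0. \<exists>d>0. \<forall>x\<in>frontier K \<inter> ball q d. \<forall>y\<in>frontier K \<inter> ball q d. c * norm (x - y) \<le> norm (nu x - nu y)"
proof (rule ccontr)
  assume neg: "\<not> ?thesis"
  have "\<exists>x y. x \<in> frontier K \<inter> ball q (inverse (Suc n)) \<and> y \<in> frontier K \<inter> ball q (inverse (Suc n)) \<and>
         norm (nu x - nu y) < inverse (Suc n) * norm (x - y)" for n :: nat
  proof -
    have "inverse (real (Suc n)) > 0" by simp
    with neg show ?thesis by (meson not_le)
  qed
  then obtain x y where x: "\<And>n. x n \<in> frontier K \<inter> ball q (inverse (Suc n))" and y: "\<And>n. y n \<in> frontier K \<inter> ball q (inverse (Suc n))"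
    and lt: "\<And>n. norm (nu (x n) - nu (y n)) < inverse (Suc n) * norm (x n - y n)" by metis
  have ne: "x n \<noteq> y n" for n using lt [of n] by auto
  have lim: "z \<longlonglongrightarrow> q" if "\<And>n. z n \<in> frontier K \<inter> ball q (inverse (Suc n))" for z
  proof (rule metric_LIMSEQ_I)
    fix e :: real assume "e > 0"
    then obtain N where N: "inverse (real (Suc N)) < e" using reals_Archimedean by blast
    have "dist (z n) q < e" if "n \<ge> N" for n
    proof -
      have "dist (z n) q < inverse (real (Suc n))" using \<open>\<And>n. z n \<in> _\<close> [of n] by (simp add: dist_commute)
      also have "\<dots> \<le> inverse (real (Suc N))" using that by simp
      finally show ?thesis using N by simp
    qed
    then show "\<exists>N. \<forall>n\<ge>N. dist (z n) q < e" by blast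
  qed
  obtain r w where r: "strict_mono (r :: nat \<Rightarrow> nat)" and w: "norm w = 1" "nu q \<bullet> w = 0"
    and v: "(\<lambda>n. (nu (x (r n)) - nu (y (r n))) /\<^sub>R norm (x (r n) - y (r n))) \<longlonglongrightarrow> shape q w"
    using secant_limit [OF IntD1 [OF x] lim [OF x] IntD1 [OF y] lim [OF y] ne] by blast
  have "(\<lambda>n. (nu (x (r n)) - nu (y (r n))) /\<^sub>R norm (x (r n) - y (r n))) \<longlonglongrightarrow> 0"
  proof (rule Lim_null_comparison)
    show "\<forall>\<^sub>F n in sequentially. norm ((nu (x (r n)) - nu (y (r n))) /\<^sub>R norm (x (r n) - y (r n))) \<le> inverse (real (Suc (r n)))"
    proof (intro always_eventually allI)
      fix n
      have "norm (x (r n) - y (r n)) > 0" using ne by simp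
      then show "norm ((nu (x (r n)) - nu (y (r n))) /\<^sub>R norm (x (r n) - y (r n))) \<le> inverse (real (Suc (r n)))"
        using lt [of "r n"] unfolding norm_scaleR_inverse [OF \<open>norm (x (r n) - y (r n)) > 0\<close>]
        by (simp add: pos_divide_le_eq less_imp_le del: of_nat_Suc)
    qed
    show "(\<lambda>n. inverse (real (Suc (r n)))) \<longlonglongrightarrow> 0"
      using LIMSEQ_subseq_LIMSEQ [OF LIMSEQ_inverse_real_of_nat r] by (simp add: o_def)
  qed
  then have "shape q w = 0" using v LIMSEQ_unique by blast
  then have "w = 0" by (rule inj [OF w(2)])
  then show False using w(1) by simp
qed

lemma tangent_sequence:
  assumes q: "q \<in> frontier K" and w: "nu q \<bullet> w = 0"
  obtains X r where "\<And>n::nat. X n \<in> frontier K" "\<And>n. r n > 0" "r \<longlonglongrightarrow> 0" "X \<longlonglongrightarrow> q"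
    "(\<lambda>n. (X n - q) /\<^sub>R r n) \<longlonglongrightarrow> w" 
proof -
  have "\<exists>x r. x \<in> frontier K \<and> 0 < r \<and> r < inverse (Suc n) \<and> norm ((x - q) /\<^sub>R r - w) < inverse (Suc n)" for n :: nat
    using tangent_approximable [OF q w, of "inverse (Suc n)"] by auto
  then obtain X r where X: "\<And>n::nat. X n \<in> frontier K" "\<And>n. 0 < r n" "\<And>n. r n < inverse (Suc n)"
    "\<And>n. norm ((X n - q) /\<^sub>R r n - w) < inverse (Suc n)" by metis
  have r0: "r \<longlonglongrightarrow> 0"
  proof (rule Lim_null_comparison [OF _ LIMSEQ_inverse_real_of_nat], intro always_eventually allI)
    show "norm (r n) \<le> inverse (real (Suc n))" for n using X(2) [of n] X(3) [of n] by simp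
  qed
  have "(\<lambda>n. (X n - q) /\<^sub>R r n - w) \<longlonglongrightarrow> 0"
    by (rule Lim_null_comparison [OF _ LIMSEQ_inverse_real_of_nat]) (use X(4) in \<open>auto intro!: always_eventually less_imp_le\<close>)
  then have lim: "(\<lambda>n. (X n - q) /\<^sub>R r n) \<longlonglongrightarrow> w" by (rule LIM_zero_cancel)
  have "(\<lambda>n. q + r n *\<^sub>R ((X n - q) /\<^sub>R r n)) \<longlonglongrightarrow> q + 0 *\<^sub>R w" by (intro tendsto_intros r0 lim)
  moreover have "q + r n *\<^sub>R ((X n - q) /\<^sub>R r n) = X n" for n using X(2) [of n] by simp
  ultimately have "X \<longlonglongrightarrow> q" by simp
  then show ?thesis using that X(1,2) r0 lim by blast
qed

lemma shape_along_sequence: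
  assumes q: "q \<in> frontier K"
    and X: "\<And>n::nat. X n \<in> frontier K" "\<And>n. r n > 0" "X \<longlonglongrightarrow> q" "(\<lambda>n. (X n - q) /\<^sub>R r n) \<longlonglongrightarrow> w" 
  shows "(\<lambda>n. (nu (X n) - nu q) /\<^sub>R r n) \<longlonglongrightarrow> shape q w"
proof -
  have "(\<lambda>n. (nu (X n) - nu q) /\<^sub>R r n - shape q ((X n - q) /\<^sub>R r n)) \<longlonglongrightarrow> 0"
  proof (rule LIMSEQ_I)
    fix e :: real assume e: "e > 0"
    define e' where "e' = e / (norm w + 1)"
    have nw: "norm w + 1 > 0" by (simp add: add_nonneg_pos)
    have e': "e' > 0" using e nw by (simp add: e'_def)
    obtain d where d: "d > 0" "\<forall>x\<in>frontier K \<inter> ball q d. \<forall>y\<in>frontier K \<inter> ball q d.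
        norm (nu x - nu y - shape q (x - y)) \<le> e' * norm (x - y)" using shape_strict [OF q e'] by auto
    have "(\<lambda>n. norm ((X n - q) /\<^sub>R r n)) \<longlonglongrightarrow> norm w" by (intro tendsto_intros X)
    then have "\<forall>\<^sub>F n in sequentially. norm ((X n - q) /\<^sub>R r n) < norm w + 1"
      by (rule order_tendstoD) simp
    then have "\<forall>\<^sub>F n in sequentially. dist (X n) q < d \<and> norm ((X n - q) /\<^sub>R r n) < norm w + 1"
      using tendstoD [OF X(3) d(1)] by (rule eventually_conj [rotated])
    then obtain N where N: "\<And>n. n \<ge> N \<Longrightarrow> dist (X n) q < d \<and> norm ((X n - q) /\<^sub>R r n) < norm w + 1"
      unfolding eventually_sequentially by blast
    have "norm ((nu (X n) - nu q) /\<^sub>R r n - shape q ((X n - q) /\<^sub>R r n) - 0) < e" if "n \<ge> N" for n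
    proof -
      have "(nu (X n) - nu q) /\<^sub>R r n - shape q ((X n - q) /\<^sub>R r n) = (nu (X n) - nu q - shape q (X n - q)) /\<^sub>R r n"
        unfolding linear_scale [OF linear_shape [OF q]] by (simp add: scaleR_diff_right)
      then have "norm ((nu (X n) - nu q) /\<^sub>R r n - shape q ((X n - q) /\<^sub>R r n)) = norm (nu (X n) - nu q - shape q (X n - q)) * inverse (r n)"
        using X(2) [of n] by simp
      also have "\<dots> \<le> (e' * norm (X n - q)) * inverse (r n)"
        using d q X(1,2) [of n] N [OF that] by (intro mult_right_mono) (auto simp: dist_commute less_imp_le)
      also have "\<dots> = e' * norm ((X n - q) /\<^sub>R r n)" using X(2) [of n] by simp
      also have "\<dots> < e' * (norm w + 1)" using N [OF that] e' by (intro mult_strict_left_mono) auto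
      also have "\<dots> = e" using nw by (simp add: e'_def)
      finally show ?thesis by simp
    qed
    then show "\<exists>N. \<forall>n\<ge>N. norm ((nu (X n) - nu q) /\<^sub>R r n - shape q ((X n - q) /\<^sub>R r n) - 0) < e" by blast
  qed
  from tendsto_add [OF this shape_tendsto [OF q X(4)]] show ?thesis by simp
qed

text \<open>Normals of a convex body are monotone.\<close>

lemma shape_nonpos:
  assumes q: "q \<in> frontier K" and w: "nu q \<bullet> w = 0"
  shows "shape q w \<bullet> w \<le> 0"
proof -
  obtain X r where X: "\<And>n::nat. X n \<in> frontier K" "\<And>n. r n > 0" "r \<longlonglongrightarrow> 0" "X \<longlonglongrightarrow> q"
    "(\<lambda>n. (X n - q) /\<^sub>R r n) \<longlonglongrightarrow> w" using tangent_sequence [OF q w] by blast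
  have lim: "(\<lambda>n. ((nu (X n) - nu q) /\<^sub>R r n) \<bullet> ((X n - q) /\<^sub>R r n)) \<longlonglongrightarrow> shape q w \<bullet> w"
    by (intro tendsto_intros shape_along_sequence q X)
  have "((nu (X n) - nu q) /\<^sub>R r n) \<bullet> ((X n - q) /\<^sub>R r n) \<le> 0" for n
  proof -
    have "(nu (X n) - nu q) \<bullet> (X n - q) \<le> 0"
      using nu_le [OF X(1), of q n] nu_le [OF q, of "X n"] subsetD [OF frontier_subset X(1) [of n]]
        subsetD [OF frontier_subset q]
      by (simp add: inner_diff_left inner_diff_right)
    then show ?thesis using X(2) [of n] by (simp add: mult_nonneg_nonpos)
  qed
  then show ?thesis by (intro LIMSEQ_le_const2 [OF lim]) auto
qed

text \<open>\<open>K\<close> lies in a ball around \<^term>\<open>c\<close> that touches it at \<^term>\<open>q\<close>, so its boundary leaves the tangent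
  plane at least quadratically.  The bound obtained is half the curvature of that ball.\<close>

lemma shape_negative_at_farthest:
  assumes q: "q \<in> frontier K" and far: "\<And>x. x \<in> K \<Longrightarrow> norm (x - c) \<le> norm (q - c)" and w: "nu q \<bullet> w = 0"
    and R: "norm (q - c) > 0"
  shows "shape q w \<bullet> w \<le> - (norm w)\<^sup>2 / (2 * norm (q - c))"
proof -
  let ?R = "norm (q - c)"
  have touch: "(norm (x - q))\<^sup>2 \<le> 2 * ((c - q) \<bullet> (x - q))" if "x \<in> K" for x
  proof -
    have "(norm (x - c))\<^sup>2 \<le> ?R\<^sup>2" using far [OF that] by (simp add: power_mono)
    then show ?thesis unfolding power2_norm_eq_inner by (simp add: inner_diff_left inner_diff_right inner_commute algebra_simps)
  qed
  have supp: "(c - q) \<bullet> q \<le> (c - q) \<bullet> x" if "x \<in> K" for x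
  proof -
    have "0 \<le> (norm (x - q))\<^sup>2" by simp
    then have "0 \<le> (c - q) \<bullet> (x - q)" using touch [OF that] by linarith
    then show ?thesis by (simp add: inner_diff_right)
  qed
  have "c - q \<noteq> 0" using R by auto
  from support_direction [OF q this supp] have cq: "c - q = ?R *\<^sub>R nu q" by (simp add: norm_minus_commute)
  obtain X r where X: "\<And>n::nat. X n \<in> frontier K" "\<And>n. r n > 0" "r \<longlonglongrightarrow> 0" "X \<longlonglongrightarrow> q"
    "(\<lambda>n. (X n - q) /\<^sub>R r n) \<longlonglongrightarrow> w" using tangent_sequence [OF q w] by blast
  have lim: "(\<lambda>n. ((nu (X n) - nu q) /\<^sub>R r n) \<bullet> ((X n - q) /\<^sub>R r n)) \<longlonglongrightarrow> shape q w \<bullet> w"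
    by (intro tendsto_intros shape_along_sequence q X)
  have lim2: "(\<lambda>n. - (norm ((X n - q) /\<^sub>R r n))\<^sup>2 / (2 * ?R)) \<longlonglongrightarrow> - (norm w)\<^sup>2 / (2 * ?R)"
    using R by (intro tendsto_intros X) auto
  have "((nu (X n) - nu q) /\<^sub>R r n) \<bullet> ((X n - q) /\<^sub>R r n) \<le> - (norm ((X n - q) /\<^sub>R r n))\<^sup>2 / (2 * ?R)" for n
  proof -
    have XK: "X n \<in> K" and qK: "q \<in> K" using X(1) q frontier_subset by auto
    have "(norm (X n - q))\<^sup>2 \<le> (2 * ?R) * (nu q \<bullet> (X n - q))" using touch [OF XK] cq by simp
    then have "(norm (X n - q))\<^sup>2 / (2 * ?R) \<le> nu q \<bullet> (X n - q)" using R by (simp add: pos_divide_le_eq mult.commute)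
    then have "(nu (X n) - nu q) \<bullet> (X n - q) \<le> - (norm (X n - q))\<^sup>2 / (2 * ?R)"
      using nu_le [OF X(1) qK, of n] by (simp add: inner_diff_left inner_diff_right)
    then have "((nu (X n) - nu q) \<bullet> (X n - q)) * (inverse (r n))\<^sup>2 \<le> (- (norm (X n - q))\<^sup>2 / (2 * ?R)) * (inverse (r n))\<^sup>2"
      by (rule mult_right_mono) simp
    then show ?thesis using X(2) [of n] by (simp add: power_mult_distrib power2_eq_square mult_ac)
  qed
  then show ?thesis by (intro LIMSEQ_le [OF lim lim2]) auto
qed

text \<open>Strict differentiability at one point already makes the shape operator continuous there.\<close>

lemma shape_continuous:
  assumes q: "\<And>n::nat. q n \<in> frontier K" "q \<longlonglongrightarrow> p" and w: "\<And>n. nu (q n) \<bullet> w n = 0" "w \<longlonglongrightarrow> l"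
  shows "(\<lambda>n. shape (q n) (w n)) \<longlonglongrightarrow> shape p l"
proof -
  have p: "p \<in> frontier K" using nu_tendsto(1) q by blast
  have close: "norm (shape x v - shape p v) \<le> e * norm v"
    if d: "\<forall>x\<in>frontier K \<inter> ball p d. \<forall>y\<in>frontier K \<inter> ball p d. norm (nu x - nu y - shape p (x - y)) \<le> e * norm (x - y)"
      and x: "x \<in> frontier K" "dist x p < d" and v: "nu x \<bullet> v = 0" for e d x v
  proof -
    obtain X r where X: "\<And>n::nat. X n \<in> frontier K" "\<And>n. r n > 0" "r \<longlonglongrightarrow> 0" "X \<longlonglongrightarrow> x"
      "(\<lambda>n. (X n - x) /\<^sub>R r n) \<longlonglongrightarrow> v" using tangent_sequence [OF x(1) v] by blast
    have lim: "(\<lambda>n. norm ((nu (X n) - nu x) /\<^sub>R r n - shape p ((X n - x) /\<^sub>R r n))) \<longlonglongrightarrow> norm (shape x v - shape p v)"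
      by (intro tendsto_intros shape_along_sequence shape_tendsto x p X)
    have lim2: "(\<lambda>n. e * norm ((X n - x) /\<^sub>R r n)) \<longlonglongrightarrow> e * norm v" by (intro tendsto_intros X)
    have "\<forall>\<^sub>F n in sequentially. dist (X n) x < d - dist x p" using tendstoD [OF X(4)] x by simp
    then obtain N where N: "\<And>n. n \<ge> N \<Longrightarrow> dist (X n) x < d - dist x p" unfolding eventually_sequentially by blast
    have "norm ((nu (X n) - nu x) /\<^sub>R r n - shape p ((X n - x) /\<^sub>R r n)) \<le> e * norm ((X n - x) /\<^sub>R r n)" if "n \<ge> N" for n
    proof -
      have "dist (X n) p < d" using N [OF that] dist_triangle [of "X n" p x] by simp
      then have "norm (nu (X n) - nu x - shape p (X n - x)) \<le> e * norm (X n - x)"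
        using d X(1) [of n] x by (auto simp: dist_commute)
      then have "norm (nu (X n) - nu x - shape p (X n - x)) * inverse (r n) \<le> e * norm (X n - x) * inverse (r n)"
        using X(2) [of n] by (intro mult_right_mono) auto
      moreover have "(nu (X n) - nu x) /\<^sub>R r n - shape p ((X n - x) /\<^sub>R r n) = (nu (X n) - nu x - shape p (X n - x)) /\<^sub>R r n"
        unfolding linear_scale [OF linear_shape [OF p]] by (simp add: scaleR_diff_right)
      ultimately show ?thesis using X(2) [of n] by (simp add: mult_ac)
    qed
    then show ?thesis by (intro LIMSEQ_le [OF lim lim2]) blast
  qed
  have "(\<lambda>n. shape (q n) (w n) - shape p (w n)) \<longlonglongrightarrow> 0"
  proof (rule LIMSEQ_I)
    fix e :: real assume e: "e > 0"
    define e' where "e' = e / (norm l + 1)"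
    have nw: "norm l + 1 > 0" by (simp add: add_nonneg_pos)
    have e': "e' > 0" using e nw by (simp add: e'_def)
    obtain d where d: "d > 0" "\<forall>x\<in>frontier K \<inter> ball p d. \<forall>y\<in>frontier K \<inter> ball p d.
        norm (nu x - nu y - shape p (x - y)) \<le> e' * norm (x - y)" using shape_strict [OF p e'] by auto
    have "(\<lambda>n. norm (w n)) \<longlonglongrightarrow> norm l" by (intro tendsto_intros w)
    then have "\<forall>\<^sub>F n in sequentially. norm (w n) < norm l + 1" by (rule order_tendstoD) simp
    then have "\<forall>\<^sub>F n in sequentially. dist (q n) p < d \<and> norm (w n) < norm l + 1"
      using tendstoD [OF q(2) d(1)] by (rule eventually_conj [rotated])
    then obtain N where N: "\<And>n. n \<ge> N \<Longrightarrow> dist (q n) p < d \<and> norm (w n) < norm l + 1"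
      unfolding eventually_sequentially by blast
    have "norm (shape (q n) (w n) - shape p (w n) - 0) < e" if "n \<ge> N" for n
    proof -
      have "norm (shape (q n) (w n) - shape p (w n)) \<le> e' * norm (w n)"
        using close [OF d(2) q(1) _ w(1)] N [OF that] by blast
      also have "\<dots> < e' * (norm l + 1)" using N [OF that] e' by (intro mult_strict_left_mono) auto
      also have "\<dots> = e" using nw by (simp add: e'_def)
      finally show ?thesis by simp
    qed
    then show "\<exists>N. \<forall>n\<ge>N. norm (shape (q n) (w n) - shape p (w n) - 0) < e" by blast
  qed
  from tendsto_add [OF this shape_tendsto [OF p w(2)]] show ?thesis by simp
qed

text \<open>The quadratic form of a symmetric operator is extremal on the unit sphere at an eigenvector.\<close>

lemma least_curvature:
  assumes q: "q \<in> frontier K" and dim: "DIM('a) \<ge> 2"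
  obtains k w where "k \<ge> 0" "w \<noteq> 0" "nu q \<bullet> w = 0" "shape q w = - k *\<^sub>R w"
    "\<And>v. nu q \<bullet> v = 0 \<Longrightarrow> shape q v \<bullet> v \<le> - k * (norm v)\<^sup>2"
proof -
  define T where "T = sphere 0 1 \<inter> {w. nu q \<bullet> w = 0}"
  have "compact T" unfolding T_def by (intro compact_Int_closed compact_sphere closed_hyperplane)
  moreover have "T \<noteq> {}"
  proof -
    obtain v where "v \<noteq> 0" "orthogonal (nu q) v" using orthogonal_to_vector_exists [OF dim, of "nu q"] by blast
    then have "v /\<^sub>R norm v \<in> T" by (simp add: T_def orthogonal_def)
    then show ?thesis by blast
  qed
  moreover have "continuous_on T (\<lambda>w. shape q w \<bullet> w)"
    using linear_continuous_on [OF linear_conv_bounded_linear [THEN iffD1, OF linear_shape [OF q]]]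
    by (intro continuous_intros)
  ultimately obtain w where w: "w \<in> T" and max: "\<And>v. v \<in> T \<Longrightarrow> shape q v \<bullet> v \<le> shape q w \<bullet> w"
    using continuous_attains_sup [of T "\<lambda>w. shape q w \<bullet> w"] by blast
  define k where "k = - (shape q w \<bullet> w)"
  have w1: "norm w = 1" "nu q \<bullet> w = 0" using w by (auto simp: T_def)
  have k0: "k \<ge> 0" using shape_nonpos [OF q w1(2)] by (simp add: k_def)
  have lin: "linear (shape q)" by (rule linear_shape [OF q])
  have bound: "shape q v \<bullet> v \<le> - k * (norm v)\<^sup>2" if v: "nu q \<bullet> v = 0" for v
  proof (cases "v = 0")
    case False
    then have "v /\<^sub>R norm v \<in> T" using v by (simp add: T_def)
    from max [OF this] have "shape q (v /\<^sub>R norm v) \<bullet> (v /\<^sub>R norm v) \<le> - k" by (simp add: k_def)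
    then have "(shape q v \<bullet> v) / (norm v)\<^sup>2 \<le> - k"
      unfolding linear_scale [OF lin] by (simp add: power2_eq_square divide_inverse mult_ac)
    then show ?thesis using False by (simp add: pos_divide_le_eq)
  qed (simp add: linear_0 [OF lin])
  have orth: "(shape q w + k *\<^sub>R w) \<bullet> v = 0" if v: "nu q \<bullet> v = 0" for v
  proof -
    define b where "b = (shape q w + k *\<^sub>R w) \<bullet> v"
    define c where "c = - (shape q v \<bullet> v + k * (v \<bullet> v))"
    have c: "c \<ge> 0" using bound [OF v] by (simp add: c_def power2_norm_eq_inner)
    have quad: "2 * t * b \<le> t\<^sup>2 * c" for t
    proof -
      have "shape q (w + t *\<^sub>R v) \<bullet> (w + t *\<^sub>R v) \<le> - k * (norm (w + t *\<^sub>R v))\<^sup>2"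
        by (rule bound) (use v w1 in \<open>simp add: inner_add_right\<close>)
      moreover have "shape q (w + t *\<^sub>R v) \<bullet> (w + t *\<^sub>R v) = - k + 2 * t * (shape q w \<bullet> v) + t\<^sup>2 * (shape q v \<bullet> v)"
        using shape_symmetric [OF q v w1(2)]
        by (simp add: linear_add [OF lin] linear_scale [OF lin] inner_add_left inner_add_right k_def power2_eq_square algebra_simps)
      moreover have "(norm (w + t *\<^sub>R v))\<^sup>2 = 1 + 2 * t * (w \<bullet> v) + t\<^sup>2 * (v \<bullet> v)"
      proof -
        have "w \<bullet> w = 1" using w1 by (simp add: norm_eq_1)
        then show ?thesis unfolding power2_norm_eq_inner
          by (simp add: inner_add_left inner_add_right inner_commute power2_eq_square algebra_simps)
      qed
      ultimately show ?thesis
        by (simp add: b_def c_def inner_add_left algebra_simps)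
    qed
    have "b = 0"
    proof (rule ccontr)
      assume b: "b \<noteq> 0"
      \<comment> \<open>at this argument the linear term of the inequality dominates the quadratic one\<close>
      have c1: "c + 1 > 0" using c by simp
      from quad [of "b / (c + 1)"] have "2 * (b * b) / (c + 1) \<le> (b * b) * c / (c + 1)\<^sup>2"
        by (simp add: power2_eq_square)
      then have "(2 * (b * b) / (c + 1)) * (c + 1)\<^sup>2 \<le> ((b * b) * c / (c + 1)\<^sup>2) * (c + 1)\<^sup>2"
        by (rule mult_right_mono) simp
      then have "2 * (b * b) * (c + 1) \<le> (b * b) * c" using c1 by (simp add: power2_eq_square)
      moreover have "b * b > 0" using b by (simp add: zero_less_mult_iff) linarith
      moreover have "2 * (b * b) * (c + 1) = (b * b) * (2 * (c + 1))" by simp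
      ultimately have "2 * (c + 1) \<le> c" by (metis mult_le_cancel_left_pos)
      then show False using c by simp
    qed
    then show ?thesis by (simp add: b_def)
  qed
  have "nu q \<bullet> (shape q w + k *\<^sub>R w) = 0" using nu_shape [OF q] w1 by (simp add: inner_add_right)
  then have "(shape q w + k *\<^sub>R w) \<bullet> (shape q w + k *\<^sub>R w) = 0" by (rule orth)
  then have "shape q w = - k *\<^sub>R w" by (simp add: eq_neg_iff_add_eq_0)
  moreover have "w \<noteq> 0" using w1(1) by auto
  ultimately show ?thesis using that [OF k0 _ w1(2) _ bound] by blast
qed

end

section \<open>Positivity of the curvatures\<close>

locale curved_body = C2_body +
  assumes centres: "centres_of_curvature K \<subseteq> K" and dim: "DIM('a) \<ge> 2"
begin

lemma connected_frontier: "connected (frontier K)"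
proof -
  have "aff_dim K = int DIM('a)" using aff_dim_nonempty_interior [OF interior_K] .
  then have "connected (rel_frontier K)"
    using connected_sphere_gen [OF convex_K bounded_K] dim by simp
  then show ?thesis
    using rel_frontier_nonempty_interior [OF interior_K] by simp
qed

text \<open>A positive least curvature is bounded below in terms of the diameter, because its centre of
  curvature lies in \<open>K\<close>.\<close>

lemma shape_definite:
  assumes q: "q \<in> frontier K" and inj: "\<And>w. nu q \<bullet> w = 0 \<Longrightarrow> shape q w = 0 \<Longrightarrow> w = 0" and w: "nu q \<bullet> w = 0"
  shows "shape q w \<bullet> w \<le> - (norm w)\<^sup>2 / diameter K"
proof -
  obtain k v where k: "k \<ge> 0" "v \<noteq> 0" "nu q \<bullet> v = 0" "shape q v = - k *\<^sub>R v"
    "\<And>w. nu q \<bullet> w = 0 \<Longrightarrow> shape q w \<bullet> w \<le> - k * (norm w)\<^sup>2" using least_curvature [OF q dim] by blast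
  have "k \<noteq> 0" using inj k by auto
  then have k0: "k > 0" using k by simp
  have "q + (1 / k) *\<^sub>R nu q \<in> K"
    using centre_of_curvature [OF q k(2,3), of "1 / k"] centres k(4) k0 by auto
  then have "dist (q + (1 / k) *\<^sub>R nu q) q \<le> diameter K"
    using q frontier_subset by (intro diameter_bounded_bound bounded_K) auto
  then have dk: "1 / k \<le> diameter K" using norm_nu [OF q] k0 by (simp add: dist_norm)
  moreover have "0 < 1 / k" using k0 by simp
  ultimately have dpos: "diameter K > 0" by linarith
  have "1 \<le> diameter K * k" using dk k0 by (simp add: pos_divide_le_eq)
  then have "1 / diameter K \<le> k" using dpos by (simp add: pos_divide_le_eq mult.commute)
  then have "(1 / diameter K) * (norm w)\<^sup>2 \<le> k * (norm w)\<^sup>2" by (rule mult_right_mono) simp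
  then show ?thesis using k(5) [OF w] by simp
qed

text \<open>By the lower bound, the boundary points with positive curvatures form a closed set, and by
  continuity of the shape operator an open one.  It contains a point farthest from a given one, and the
  boundary is connected.\<close>

lemma shape_injective:
  assumes q: "q \<in> frontier K" "nu q \<bullet> w = 0" "shape q w = 0"
  shows "w = 0"
proof -
  define P where "P = {q \<in> frontier K. \<forall>w. nu q \<bullet> w = 0 \<longrightarrow> shape q w \<bullet> w \<le> - (norm w)\<^sup>2 / diameter K}"
  have dpos: "diameter K > 0"
  proof -
    obtain x e where "e > 0" "ball x e \<subseteq> K" using interior_K by (meson all_not_in_conv mem_interior)
    then have "diameter (ball x e) \<le> diameter K" by (intro diameter_subset bounded_K)
    then show ?thesis using \<open>e > 0\<close> by simp
  qed
  have Pinj: "w = 0" if "q \<in> P" "nu q \<bullet> w = 0" "shape q w = 0" for q w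
  proof -
    have "0 \<le> - (norm w)\<^sup>2 / diameter K" using that by (auto simp: P_def)
    then show ?thesis using dpos by (simp add: field_simps)
  qed
  have Pdef: "q \<in> P" if "q \<in> frontier K" "\<And>w. nu q \<bullet> w = 0 \<Longrightarrow> shape q w = 0 \<Longrightarrow> w = 0" for q
    using shape_definite [OF that] that(1) by (auto simp: P_def)
  have clP: "closed P"
    unfolding closed_sequential_limits
  proof (intro allI impI)
    fix x p assume *: "(\<forall>n. x n \<in> P) \<and> x \<longlonglongrightarrow> p"
    then have x: "\<And>n. x n \<in> frontier K" "x \<longlonglongrightarrow> p" by (auto simp: P_def)
    have p: "p \<in> frontier K" and nup: "(\<lambda>n. nu (x n)) \<longlonglongrightarrow> nu p" using nu_tendsto x by blast+
    have "shape p w \<bullet> w \<le> - (norm w)\<^sup>2 / diameter K" if w: "nu p \<bullet> w = 0" for w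
    proof -
      define v where "v n = w - (nu (x n) \<bullet> w) *\<^sub>R nu (x n)" for n
      have vt: "nu (x n) \<bullet> v n = 0" for n using nu_nu [OF x(1)] by (simp add: v_def inner_diff_right)
      have "v \<longlonglongrightarrow> w - (nu p \<bullet> w) *\<^sub>R nu p" unfolding v_def by (intro tendsto_intros nup)
      then have vw: "v \<longlonglongrightarrow> w" using w by simp
      have l1: "(\<lambda>n. shape (x n) (v n) \<bullet> v n) \<longlonglongrightarrow> shape p w \<bullet> w"
        by (intro tendsto_intros shape_continuous x vt vw)
      have l2: "(\<lambda>n. - (norm (v n))\<^sup>2 / diameter K) \<longlonglongrightarrow> - (norm w)\<^sup>2 / diameter K"
        using dpos by (intro tendsto_intros vw) auto
      show ?thesis by (rule LIMSEQ_le [OF l1 l2]) (use * vt in \<open>auto simp: P_def\<close>)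
    qed
    then show "p \<in> P" using p by (simp add: P_def)
  qed
  have clN: "closed (frontier K - P)"
    unfolding closed_sequential_limits
  proof (intro allI impI)
    fix x p assume *: "(\<forall>n. x n \<in> frontier K - P) \<and> x \<longlonglongrightarrow> p"
    then have x: "\<And>n. x n \<in> frontier K" "\<And>n. x n \<notin> P" "x \<longlonglongrightarrow> p" by auto
    have p: "p \<in> frontier K" using nu_tendsto x by blast
    have "\<exists>w. norm w = 1 \<and> nu (x n) \<bullet> w = 0 \<and> shape (x n) w = 0" for n
    proof -
      obtain w where w: "nu (x n) \<bullet> w = 0" "shape (x n) w = 0" "w \<noteq> 0" using Pdef x by blast
      then show ?thesis using linear_scale [OF linear_shape [OF x(1) [of n]]]
        by (intro exI [of _ "w /\<^sub>R norm w"]) auto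
    qed
    then obtain w where w: "\<And>n. norm (w n) = 1" "\<And>n. nu (x n) \<bullet> w n = 0" "\<And>n. shape (x n) (w n) = 0" by metis
    have "seq_compact (sphere (0::'a) 1)" using compact_sphere compact_eq_seq_compact_metric by blast
    then obtain l r where l: "l \<in> sphere 0 1" and r: "strict_mono (r :: nat \<Rightarrow> nat)" and lim: "(w \<circ> r) \<longlonglongrightarrow> l"
      using seq_compactE [of "sphere 0 1" w] w(1) by (metis mem_sphere_0)
    have lim': "(\<lambda>n. w (r n)) \<longlonglongrightarrow> l" using lim by (simp add: o_def)
    have xr: "(\<lambda>n. x (r n)) \<longlonglongrightarrow> p" using LIMSEQ_subseq_LIMSEQ [OF x(3) r] by (simp add: o_def)
    have "(\<lambda>n. shape (x (r n)) (w (r n))) \<longlonglongrightarrow> shape p l"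
      by (intro shape_continuous x xr w lim')
    then have "shape p l = 0" using w(3) by (simp add: LIMSEQ_const_iff)
    moreover have "(\<lambda>n. nu (x (r n)) \<bullet> w (r n)) \<longlonglongrightarrow> nu p \<bullet> l"
      by (intro tendsto_intros nu_tendsto(2) x xr lim')
    then have "nu p \<bullet> l = 0" using w(2) by (simp add: LIMSEQ_const_iff)
    ultimately have "p \<notin> P" using Pinj l by force
    then show "p \<in> frontier K - P" using p by simp
  qed
  have "P \<noteq> {}"
  proof -
    have "compact (frontier K)" "frontier K \<noteq> {}" using compact_frontier q by auto
    obtain c where c: "c \<in> interior K" using interior_K by blast
    obtain p where p: "p \<in> K" "\<And>x. x \<in> K \<Longrightarrow> dist c x \<le> dist c p"
      using distance_attains_sup [OF compact_K nonempty_K, of c] by blast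
    have pf: "p \<in> frontier K"
    proof (rule ccontr)
      assume "p \<notin> frontier K"
      then have "p \<in> interior K" using p closure_subset by (auto simp: frontier_def)
      then obtain e where e: "e > 0" "ball p e \<subseteq> K" by (meson mem_interior)
      obtain u :: 'a where u: "norm u = 1" using vector_choose_size zero_le_one by blast
      define d where "d = (if p = c then u else (p - c) /\<^sub>R norm (p - c))"
      have d1: "norm d = 1" using u by (simp add: d_def)
      have pc: "p - c = norm (p - c) *\<^sub>R d" by (simp add: d_def)
      have "p + (e/2) *\<^sub>R d \<in> K" using e d1 by (intro subsetD [OF e(2)]) (simp add: dist_norm)
      from p(2) [OF this] have "norm (p + (e/2) *\<^sub>R d - c) \<le> norm (p - c)" by (simp add: dist_norm norm_minus_commute)
      moreover have "p + (e/2) *\<^sub>R d - c = (norm (p - c) + e/2) *\<^sub>R d" using pc by (simp add: algebra_simps)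
      ultimately show False using d1 e by simp
    qed
    have R: "norm (p - c) > 0" using pf c by (auto simp: frontier_def)
    have "w = 0" if "nu p \<bullet> w = 0" "shape p w = 0" for w
    proof -
      have "shape p w \<bullet> w \<le> - (norm w)\<^sup>2 / (2 * norm (p - c))"
        using p(2) by (intro shape_negative_at_farthest pf that R) (simp add: dist_norm norm_minus_commute)
      then show ?thesis using that R by (simp add: field_simps)
    qed
    then show ?thesis using Pdef pf by blast
  qed
  moreover have "P \<subseteq> frontier K" by (auto simp: P_def)
  ultimately have "frontier K - P = {}"
    using connected_frontier clP clN unfolding connected_closed by blast
  then show ?thesis using Pinj q by blast
qed

end

section \<open>Reflecting the complement through the body\<close>

context body
begin

text \<open>A point outside \<open>K\<close> is \<open>q - s \<nu>(q)\<close> with \<open>q\<close> its closest point and \<open>s > 0\<close> its distance.  Reflecting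
  it in \<open>q\<close> gives \<open>q + s \<nu>(q)\<close>, so the fibres of this map on the complement list the normals through a
  given point.  It replaces a map on the boundary times a half-line by a Lipschitz map from an open
  subset of the ambient space to that space, to which invariance of domain applies.\<close>

definition reflect :: "'a \<Rightarrow> 'a" where "reflect x = 2 *\<^sub>R closest_point K x - x"

lemma reflect_self: "x \<in> K \<Longrightarrow> reflect x = x"
  by (simp add: reflect_def closest_point_self scaleR_2)

lemma continuous_closest: "continuous_on S (closest_point K)"
  by (rule continuous_on_closest_point [OF convex_K closed_K nonempty_K])

lemma continuous_reflect: "continuous_on S reflect"
  unfolding reflect_def by (intro continuous_intros continuous_closest)

lemma reflect_lipschitz: "norm (reflect x - reflect y) \<le> 3 * norm (x - y)"
proof -
  have "norm (closest_point K x - closest_point K y) \<le> norm (x - y)"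
    using closest_point_lipschitz [OF convex_K closed_K nonempty_K, of x y] by (simp add: dist_norm)
  moreover have "reflect x - reflect y = 2 *\<^sub>R (closest_point K x - closest_point K y) - (x - y)"
    by (simp add: reflect_def algebra_simps)
  then have "norm (reflect x - reflect y) \<le> 2 * norm (closest_point K x - closest_point K y) + norm (x - y)"
    using norm_triangle_ineq4 [of "2 *\<^sub>R (closest_point K x - closest_point K y)" "x - y"] by simp
  ultimately show ?thesis by linarith
qed

lemma supported_in_frontier:
  assumes q: "q \<in> K" and v: "v \<noteq> 0" "\<And>x. x \<in> K \<Longrightarrow> v \<bullet> q \<le> v \<bullet> x"
  shows "q \<in> frontier K"
proof (rule ccontr)
  assume "q \<notin> frontier K"
  then have "q \<in> interior K" using q closure_subset by (auto simp: frontier_def)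
  then obtain e where e: "e > 0" "ball q e \<subseteq> K" by (meson mem_interior)
  define d where "d = e / (2 * norm v)"
  have d: "d > 0" using e v by (simp add: d_def)
  have "norm (d *\<^sub>R v) < e" using e v by (simp add: d_def)
  then have "q - d *\<^sub>R v \<in> K" by (intro subsetD [OF e(2)]) (simp add: dist_norm)
  from v(2) [OF this] have "d * (v \<bullet> v) \<le> 0" by (simp add: inner_diff_right)
  moreover have "v \<bullet> v > 0" using v by simp
  ultimately show False using d by (simp add: mult_le_0_iff)
qed

end

context C2_body
begin

lemma outside_decomposition:
  assumes x: "x \<notin> K"
  shows "closest_point K x \<in> frontier K" "infdist x K > 0"
    "x = closest_point K x - infdist x K *\<^sub>R nu (closest_point K x)"
proof -
  let ?q = "closest_point K x"
  have d: "infdist x K > 0" using x infdist_eq_0 infdist_nonneg [of x K] by (metis less_eq_real_def)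
  then show "infdist x K > 0" .
  have ne: "?q - x \<noteq> 0" using x closest_in [of x] by auto
  have s: "(?q - x) \<bullet> ?q \<le> (?q - x) \<bullet> z" if "z \<in> K" for z
    using closest_point_dot [OF convex_K closed_K that, of x] by (simp add: inner_diff_left inner_diff_right)
  show q: "?q \<in> frontier K"
    by (rule supported_in_frontier [OF closest_in ne s])
  have "?q - x = norm (?q - x) *\<^sub>R nu ?q" by (rule support_direction [OF q ne s])
  moreover have "norm (?q - x) = infdist x K" by (simp add: infdist_eq dist_norm norm_minus_commute)
  ultimately show "x = ?q - infdist x K *\<^sub>R nu ?q" by (simp add: algebra_simps)
qed

lemma closest_point_on_normal:
  assumes q: "q \<in> frontier K" and s: "s \<ge> 0"
  shows "closest_point K (q - s *\<^sub>R nu q) = q"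
proof (rule closest_point_unique [OF convex_K closed_K, symmetric])
  show qK: "q \<in> K" using q frontier_subset by blast
  show "\<forall>z\<in>K. dist (q - s *\<^sub>R nu q) q \<le> dist (q - s *\<^sub>R nu q) z"
  proof
    fix z assume z: "z \<in> K"
    have "s = (s *\<^sub>R nu q) \<bullet> nu q" using nu_nu [OF q] by simp
    also have "\<dots> \<le> (z - (q - s *\<^sub>R nu q)) \<bullet> nu q"
      using nu_le [OF q z] by (simp add: inner_diff_left inner_diff_right inner_commute)
    also have "\<dots> \<le> norm (z - (q - s *\<^sub>R nu q)) * norm (nu q)" by (rule norm_cauchy_schwarz)
    finally have "s \<le> norm (z - (q - s *\<^sub>R nu q))" using norm_nu [OF q] by simp
    then show "dist (q - s *\<^sub>R nu q) q \<le> dist (q - s *\<^sub>R nu q) z"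
      using s norm_nu [OF q] by (simp add: dist_norm norm_minus_commute)
  qed
qed

lemma infdist_on_normal:
  assumes q: "q \<in> frontier K" and s: "s \<ge> 0"
  shows "infdist (q - s *\<^sub>R nu q) K = s"
  using closest_point_on_normal [OF assms] norm_nu [OF q] s by (simp add: infdist_eq dist_norm)

lemma reflect_on_normal:
  assumes q: "q \<in> frontier K" and s: "s \<ge> 0"
  shows "reflect (q - s *\<^sub>R nu q) = q + s *\<^sub>R nu q"
  unfolding reflect_def closest_point_on_normal [OF assms] by (simp add: scaleR_2)

lemma on_normal_notin:
  assumes q: "q \<in> frontier K" and s: "s > 0"
  shows "q - s *\<^sub>R nu q \<notin> K"
  using infdist_on_normal [OF q, of s] infdist_eq_0 [of "q - s *\<^sub>R nu q"] s by auto

lemma reflect_outside: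
  assumes x: "x \<notin> K"
  shows "reflect x = closest_point K x + infdist x K *\<^sub>R nu (closest_point K x)"
  using reflect_on_normal [OF outside_decomposition(1) [OF x], of "infdist x K"]
    outside_decomposition(3) [OF x] infdist_nonneg [of x K] by simp

lemma farthest_support:
  assumes q: "q \<in> K" and far: "\<And>x. x \<in> K \<Longrightarrow> dist p x \<le> dist p q" and ne: "q \<noteq> p"
  shows "q \<in> frontier K" "p = q + dist p q *\<^sub>R nu q"
proof -
  have supp: "(p - q) \<bullet> q \<le> (p - q) \<bullet> x" if x: "x \<in> K" for x
  proof -
    have "(norm (p - x))\<^sup>2 \<le> (norm (p - q))\<^sup>2" using far [OF x] by (simp add: power_mono dist_norm)
    moreover have "(norm (p - x))\<^sup>2 = (norm (p - q))\<^sup>2 - 2 * ((p - q) \<bullet> (x - q)) + (norm (x - q))\<^sup>2"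
      unfolding power2_norm_eq_inner by (simp add: inner_diff_left inner_diff_right inner_commute algebra_simps)
    moreover have "0 \<le> (norm (x - q))\<^sup>2" by simp
    ultimately have "0 \<le> (p - q) \<bullet> (x - q)" by linarith
    then show ?thesis by (simp add: inner_diff_right)
  qed
  show qf: "q \<in> frontier K"
    by (rule supported_in_frontier [OF q _ supp]) (use ne in auto)
  have "p - q = norm (p - q) *\<^sub>R nu q" by (rule support_direction [OF qf _ supp]) (use ne in auto)
  then show "p = q + dist p q *\<^sub>R nu q" by (simp add: dist_norm algebra_simps)
qed

subsection \<open>Normals are determined by their feet\<close>

text \<open>A starting point determines its normal line, so counting normals is counting starting points.\<close>

definition feet :: "'a \<Rightarrow> 'a set" where
  "feet p = {q \<in> frontier K. \<exists>s. p = q + s *\<^sub>R nu q}"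

text \<open>A functional attaining its maximum over \<open>K + t B\<close> at \<open>z + w\<close> attains it over \<open>K\<close> at \<open>z\<close> and over the ball
  at \<open>w\<close>.\<close>

lemma support_parallel_body:
  assumes t: "t \<ge> 0" and v: "v \<noteq> 0" and q': "q' \<in> parallel_body K t"
    and supp: "\<And>x. x \<in> parallel_body K t \<Longrightarrow> v \<bullet> x \<le> v \<bullet> q'"
  shows "\<exists>q\<in>frontier K. q' = q - t *\<^sub>R nu q \<and> v = - (norm v *\<^sub>R nu q)"
proof -
  obtain z w where z: "z \<in> K" "norm w \<le> t" "q' = z + w"
    using q' unfolding parallel_body_eq_sums by auto
  have far: "v \<bullet> y + t * norm v \<le> v \<bullet> z + v \<bullet> w" if y: "y \<in> K" for y
  proof -
    have "y + (t / norm v) *\<^sub>R v \<in> parallel_body K t"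
      unfolding parallel_body_eq_sums using y t v by force
    from supp [OF this] show ?thesis
      using v by (simp add: z inner_add_right power2_norm_eq_inner [symmetric] power2_eq_square)
  qed
  have vw: "v \<bullet> w \<le> t * norm v"
  proof -
    have "v \<bullet> w \<le> norm v * norm w" by (rule norm_cauchy_schwarz)
    also have "\<dots> \<le> norm v * t" using z by (intro mult_left_mono) auto
    finally show ?thesis by (simp add: mult.commute)
  qed
  have vz: "v \<bullet> y \<le> v \<bullet> z" if "y \<in> K" for y using far [OF that] vw by linarith
  have zf: "z \<in> frontier K" by (rule supported_in_frontier [OF z(1), of "- v"]) (use v vz in auto)
  have "- v = norm (- v) *\<^sub>R nu z" by (rule support_direction [OF zf]) (use v vz in auto)
  then have "- (- v) = - (norm (- v) *\<^sub>R nu z)" by (rule arg_cong)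
  then have vn: "v = - (norm v *\<^sub>R nu z)" by simp
  have eq: "v \<bullet> w = t * norm v" using far [OF z(1)] vw by linarith
  have "norm v * (nu z \<bullet> w) = - (t * norm v)" using eq by (subst (asm) vn) simp
  then have "norm v * (nu z \<bullet> w) = norm v * (- t)" by (simp add: mult.commute)
  moreover have "norm v \<noteq> 0" using v by simp
  ultimately have nw: "nu z \<bullet> w = - t" using mult_cancel_left by blast
  have "(norm (w + t *\<^sub>R nu z))\<^sup>2 = (norm w)\<^sup>2 + 2 * t * (nu z \<bullet> w) + t\<^sup>2"
    using nu_nu [OF zf] unfolding power2_norm_eq_inner
    by (simp add: inner_add_left inner_add_right inner_commute power2_eq_square algebra_simps)
  also have "\<dots> \<le> t\<^sup>2 + 2 * t * (- t) + t\<^sup>2" using z(2) nw by (simp add: power_mono)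
  also have "\<dots> = 0" by (simp add: power2_eq_square)
  finally have "w = - (t *\<^sub>R nu z)" by (simp add: eq_neg_iff_add_eq_0)
  then show ?thesis using zf z vn by (intro bexI [of _ z]) auto
qed

lemma range_line_rescale:
  fixes v u :: "'b::real_vector"
  assumes "v = c *\<^sub>R u" "c \<noteq> 0"
  shows "range (\<lambda>s. (q + d *\<^sub>R u) + s *\<^sub>R v) = range (\<lambda>s. q + s *\<^sub>R u)" (is "?l = ?r")
proof (intro set_eqI iffI)
  fix x assume "x \<in> ?l"
  then obtain s where "x = (q + d *\<^sub>R u) + s *\<^sub>R v" by blast
  then have "x = q + (d + s * c) *\<^sub>R u" using assms by (simp add: algebra_simps)
  then show "x \<in> ?r" by blast
next
  fix x assume "x \<in> ?r"
  then obtain s where "x = q + s *\<^sub>R u" by blast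
  moreover have "((s - d) / c) *\<^sub>R v = (s - d) *\<^sub>R u" using assms by simp
  ultimately have "x = (q + d *\<^sub>R u) + ((s - d) / c) *\<^sub>R v" by (simp add: algebra_simps)
  then show "x \<in> ?l" by blast
qed

lemma normal_line_parallel_body:
  assumes t: "t \<ge> 0"
  shows "normal_line (parallel_body K t) q' L \<longleftrightarrow>
    (\<exists>q\<in>frontier K. q' = q - t *\<^sub>R nu q \<and> L = range (\<lambda>s. q + s *\<^sub>R nu q))"
proof
  assume "normal_line (parallel_body K t) q' L"
  then obtain v where v: "q' \<in> frontier (parallel_body K t)" "v \<noteq> 0" "\<And>x. x \<in> parallel_body K t \<Longrightarrow> v \<bullet> x \<le> v \<bullet> q'"
    and L: "L = range (\<lambda>s. q' + s *\<^sub>R v)" unfolding normal_line_def supporting_at_def by blast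
  have "q' \<in> parallel_body K t"
    using v(1) frontier_subset_closed [OF compact_imp_closed [OF compact_parallel_body]] by blast
  from support_parallel_body [OF t v(2) this v(3)] obtain q where q: "q \<in> frontier K" "q' = q - t *\<^sub>R nu q" "v = - (norm v *\<^sub>R nu q)"
    by blast
  have "L = range (\<lambda>s. q + s *\<^sub>R nu q)"
    using range_line_rescale [of v "- norm v" "nu q" q "- t"] q(2,3) v(2) L by simp
  then show "\<exists>q\<in>frontier K. q' = q - t *\<^sub>R nu q \<and> L = range (\<lambda>s. q + s *\<^sub>R nu q)" using q by blast
next
  assume "\<exists>q\<in>frontier K. q' = q - t *\<^sub>R nu q \<and> L = range (\<lambda>s. q + s *\<^sub>R nu q)"
  then obtain q where q: "q \<in> frontier K" "q' = q - t *\<^sub>R nu q" "L = range (\<lambda>s. q + s *\<^sub>R nu q)" by blast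
  interpret P: body "parallel_body K t" using convex_body_parallel_body [OF t] by unfold_locales
  have mem: "q' \<in> parallel_body K t" using infdist_on_normal [OF q(1) t] by (simp add: parallel_body_def q)
  have ne: "- nu q \<noteq> 0" using norm_nu [OF q(1)] by auto
  have supp: "(- nu q) \<bullet> x \<le> (- nu q) \<bullet> q'" if "x \<in> parallel_body K t" for x
  proof -
    obtain z w where z: "z \<in> K" "norm w \<le> t" "x = z + w"
      using \<open>x \<in> parallel_body K t\<close> unfolding parallel_body_eq_sums by auto
    have "(- nu q) \<bullet> w \<le> norm (- nu q) * norm w" by (rule norm_cauchy_schwarz)
    then have "- (nu q \<bullet> w) \<le> t" using z(2) norm_nu [OF q(1)] by simp
    then show ?thesis using nu_le [OF q(1) z(1)] nu_nu [OF q(1)]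
      by (simp add: z q inner_add_right inner_diff_right)
  qed
  have "q' \<in> frontier (parallel_body K t)" 
    by (rule P.supported_in_frontier [OF mem, of "nu q"]) (use ne supp in auto)
  moreover have "L = range (\<lambda>s. q' + s *\<^sub>R (- nu q))"
    using range_line_rescale [of "- nu q" "- 1" "nu q" q "- t"] q by simp
  moreover from calculation(1) have "supporting_at (parallel_body K t) q' (- nu q)"
    unfolding supporting_at_def using ne supp by simp
  ultimately show "normal_line (parallel_body K t) q' L" unfolding normal_line_def by blast
qed

text \<open>Parallel bodies have the same normal lines, each with its starting point moved along it.\<close>

lemma num_normals_parallel_body:
  assumes t: "t \<ge> 0"
  shows "num_normals (parallel_body K t) p = emeasure (count_space UNIV) (feet p)"
proof -
  let ?f = "\<lambda>q. (q - t *\<^sub>R nu q, range (\<lambda>s. q + s *\<^sub>R nu q))"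
  have eq: "{(q, L). normal_line (parallel_body K t) q L \<and> p \<in> L} = ?f ` feet p"
  proof (intro set_eqI iffI)
    fix z assume "z \<in> {(q, L). normal_line (parallel_body K t) q L \<and> p \<in> L}"
    then obtain q' L where z: "z = (q', L)" "normal_line (parallel_body K t) q' L" and p: "p \<in> L" by blast
    obtain q where q: "q \<in> frontier K" "q' = q - t *\<^sub>R nu q" "L = range (\<lambda>s. q + s *\<^sub>R nu q)"
      using normal_line_parallel_body [OF t] z(2) by blast
    then have "q \<in> feet p" using p unfolding feet_def by blast
    moreover have "z = ?f q" using z(1) q by simp
    ultimately show "z \<in> ?f ` feet p" by (rule rev_image_eqI)
  next
    fix z assume "z \<in> ?f ` feet p"
    then obtain q where q: "q \<in> feet p" "z = ?f q" by blast
    then have "normal_line (parallel_body K t) (fst z) (snd z)" "p \<in> snd z"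
      using normal_line_parallel_body [OF t] by (auto simp: feet_def)
    then show "z \<in> {(q, L). normal_line (parallel_body K t) q L \<and> p \<in> L}" by (simp add: case_prod_unfold)
  qed
  have "inj_on ?f (feet p)"
  proof (rule inj_onI)
    fix a b assume ab: "a \<in> feet p" "b \<in> feet p" and eq: "?f a = ?f b"
    from eq have "fst (?f a) = fst (?f b)" by (rule arg_cong)
    then have "a - t *\<^sub>R nu a = b - t *\<^sub>R nu b" by (simp only: fst_conv)
    moreover have "a \<in> frontier K" "b \<in> frontier K" using ab unfolding feet_def by blast+
    ultimately show "a = b" using closest_point_on_normal [of a t] closest_point_on_normal [of b t] t by metis
  qed
  then have "finite (?f ` feet p) = finite (feet p)" "card (?f ` feet p) = card (feet p)"
    by (auto simp: finite_image_iff card_image)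
  then show ?thesis unfolding num_normals_def eq by (simp add: emeasure_count_space)
qed

lemma num_normals_eq_feet: "num_normals K p = emeasure (count_space UNIV) (feet p)"
  using num_normals_parallel_body [of 0 p] by (simp add: parallel_body_0)

text \<open>The reflection sees exactly the normals whose starting point lies behind \<^term>\<open>p\<close>, in the direction
  opposite to the inner normal.\<close>

lemma feet_fibre: "closest_point K ` {x. x \<notin> K \<and> reflect x = p} = {q \<in> frontier K. \<exists>s>0. p = q + s *\<^sub>R nu q}" (is "?l = ?r")
proof (intro set_eqI iffI)
  fix q assume "q \<in> ?l"
  then show "q \<in> ?r" using outside_decomposition reflect_outside by blast
next
  fix q assume "q \<in> ?r"
  then obtain s where s: "q \<in> frontier K" "s > 0" "p = q + s *\<^sub>R nu q" by blast
  then have "q - s *\<^sub>R nu q \<in> {x. x \<notin> K \<and> reflect x = p}" using on_normal_notin reflect_on_normal by simp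
  moreover have "closest_point K (q - s *\<^sub>R nu q) = q" using closest_point_on_normal s by simp
  ultimately show "q \<in> ?l" by (metis imageI)
qed

lemma inj_on_fibre: "inj_on (closest_point K) {x. x \<notin> K \<and> reflect x = p}"
proof (rule inj_onI)
  fix x y assume "x \<in> {x. x \<notin> K \<and> reflect x = p}" "y \<in> {x. x \<notin> K \<and> reflect x = p}" "closest_point K x = closest_point K y"
  then show "x = y" by (simp add: reflect_def) (metis diff_left_imp_eq)
qed

lemma num_normals_inside:
  assumes p: "p \<in> interior K"
  shows "num_normals K p = emeasure (count_space UNIV) {x. x \<notin> K \<and> reflect x = p}"
proof -
  have "feet p = closest_point K ` {x. x \<notin> K \<and> reflect x = p}"
    unfolding feet_fibre
  proof (intro set_eqI iffI)
    fix q assume "q \<in> feet p"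
    then obtain s where q: "q \<in> frontier K" and s: "p = q + s *\<^sub>R nu q" by (auto simp: feet_def)
    have "s \<noteq> 0" using s p q by (auto simp: frontier_def)
    moreover have "\<not> s < 0"
    proof
      assume "s < 0"
      then have "p \<notin> K" using on_normal_notin [OF q, of "- s"] s by simp
      then show False using p interior_subset by blast
    qed
    ultimately have "s > 0" by linarith
    then show "q \<in> {q \<in> frontier K. \<exists>s>0. p = q + s *\<^sub>R nu q}" using q s by blast
  qed (auto simp: feet_def)
  then show ?thesis
    unfolding num_normals_eq_feet using inj_on_fibre [of p]
    by (simp add: emeasure_count_space finite_image_iff card_image)
qed

text \<open>Outside \<open>K\<close> there is one more starting point, the closest point, at which \<^term>\<open>p\<close> lies on the outer side.\<close>

lemma num_normals_outside:
  assumes p: "p \<notin> K" and ex1: "\<exists>!x. x \<notin> K \<and> reflect x = p"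
  shows "num_normals K p = 2"
proof -
  obtain x where x: "{x. x \<notin> K \<and> reflect x = p} = {x}" using ex1 by blast
  let ?q = "closest_point K p" and ?a = "closest_point K x"
  have pos: "{q \<in> frontier K. \<exists>s>0. p = q + s *\<^sub>R nu q} = {?a}" using feet_fibre [of p] x by simp
  have "feet p = {?q, ?a}"
  proof (intro set_eqI iffI)
    fix q assume "q \<in> feet p"
    then obtain s where q: "q \<in> frontier K" and s: "p = q + s *\<^sub>R nu q" by (auto simp: feet_def)
    show "q \<in> {?q, ?a}"
    proof (cases "s > 0")
      case True
      then show ?thesis using pos q s by blast
    next
      case False
      then show ?thesis using closest_point_on_normal [OF q, of "- s"] s by simp
    qed
  next
    fix q assume "q \<in> {?q, ?a}"
    moreover have "?q \<in> feet p" using outside_decomposition [OF p] unfolding feet_def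
      by (metis (mono_tags, lifting) add_uminus_conv_diff mem_Collect_eq scaleR_minus_left)
    moreover have "?a \<in> feet p" using pos by (auto simp: feet_def)
    ultimately show "q \<in> feet p" by blast
  qed
  moreover have "?q \<noteq> ?a"
  proof
    assume eq: "?q = ?a"
    obtain s where s: "?a \<in> frontier K" "s > 0" "p = ?a + s *\<^sub>R nu ?a" using pos by blast
    have "p = ?a - infdist p K *\<^sub>R nu ?a" "infdist p K > 0" using outside_decomposition [OF p] eq by auto
    then have "(s + infdist p K) *\<^sub>R nu ?a = 0" using s(3) by (simp add: algebra_simps)
    then show False using s(1,2) \<open>infdist p K > 0\<close> norm_nu [OF s(1)] by auto
  qed
  ultimately show ?thesis unfolding num_normals_eq_feet by (simp add: emeasure_count_space)
qed

subsection \<open>Local injectivity of the reflection\<close>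

text \<open>Two families of points with equal reflections that approach \<^term>\<open>x0\<close> make it a focal position, by
  \<open>focal_limit\<close>.\<close>

lemma reflect_locally_injective:
  assumes x0: "x0 \<notin> K"
    and nondeg: "\<And>w. nu (closest_point K x0) \<bullet> w = 0 \<Longrightarrow>
       w + infdist x0 K *\<^sub>R shape (closest_point K x0) w = 0 \<Longrightarrow> w = 0"
  shows "\<exists>e>0. ball x0 e \<subseteq> - K \<and> inj_on reflect (ball x0 e)"
proof (rule ccontr)
  assume neg: "\<not> ?thesis"
  have "open (- K)" using closed_K by auto
  then obtain e0 where e0: "e0 > 0" "ball x0 e0 \<subseteq> - K" using x0 by (meson ComplI openE)
  have "\<exists>x y. x \<in> ball x0 (min e0 (inverse (Suc n))) \<and> y \<in> ball x0 (min e0 (inverse (Suc n))) \<and> x \<noteq> y \<and> reflect x = reflect y" for n :: nat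
  proof -
    let ?e = "min e0 (inverse (real (Suc n)))"
    have "?e > 0" "ball x0 ?e \<subseteq> - K" using e0 by auto
    then have "\<not> inj_on reflect (ball x0 ?e)" using neg by blast
    then show ?thesis unfolding inj_on_def by blast
  qed
  then obtain x y where x: "\<And>n. x n \<in> ball x0 (min e0 (inverse (Suc n)))" and y: "\<And>n. y n \<in> ball x0 (min e0 (inverse (Suc n)))"
    and ne: "\<And>n. x n \<noteq> y n" and eq: "\<And>n. reflect (x n) = reflect (y n)" by metis
  have lim: "z \<longlonglongrightarrow> x0" if z: "\<And>n. z n \<in> ball x0 (min e0 (inverse (Suc n)))" for z
  proof -
    have "(\<lambda>n. dist (z n) x0) \<longlonglongrightarrow> 0"
      by (rule Lim_null_comparison [OF _ LIMSEQ_inverse_real_of_nat], intro always_eventually allI)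
         (use z in \<open>simp add: dist_commute less_imp_le\<close>)
    then show ?thesis by (rule tendsto_dist_iff [THEN iffD2])
  qed
  have out: "x n \<notin> K" "y n \<notin> K" for n using x [of n] y [of n] e0(2) by auto
  have cp: "(\<lambda>n. closest_point K (z n)) \<longlonglongrightarrow> closest_point K x0" if "z \<longlonglongrightarrow> x0" for z
    using continuous_on_tendsto_compose [OF continuous_closest [of UNIV] that] by simp
  have "\<exists>w. w \<noteq> 0 \<and> nu (closest_point K x0) \<bullet> w = 0 \<and> w + infdist x0 K *\<^sub>R shape (closest_point K x0) w = 0"
  proof (rule focal_limit)
    show "closest_point K (x n) \<in> frontier K" "closest_point K (y n) \<in> frontier K" for n
      using outside_decomposition out by auto
    show "(\<lambda>n. closest_point K (x n)) \<longlonglongrightarrow> closest_point K x0" by (rule cp [OF lim [OF x]])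
    show "(\<lambda>n. closest_point K (y n)) \<longlonglongrightarrow> closest_point K x0" by (rule cp [OF lim [OF y]])
    show "closest_point K (x n) \<noteq> closest_point K (y n)" for n
      using inj_on_fibre [of "reflect (y n)"] out [of n] ne [of n] eq [of n] unfolding inj_on_def by blast
    show "(\<lambda>n. infdist (x n) K) \<longlonglongrightarrow> infdist x0 K" by (intro tendsto_infdist lim [OF x])
    show "closest_point K (x n) + infdist (x n) K *\<^sub>R nu (closest_point K (x n)) =
      closest_point K (y n) + infdist (y n) K *\<^sub>R nu (closest_point K (y n))" for n
      using reflect_outside out eq by metis
  qed
  then show False using nondeg by blast
qed

end

subsection \<open>Outside the body the reflection is a bijection\<close>

context curved_body
begin

text \<open>A degenerate position is reflected to a centre of curvature.\<close>

lemma nondegenerate_outside: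
  assumes x: "x \<notin> K" and r: "reflect x \<notin> K"
    and w: "nu (closest_point K x) \<bullet> w = 0" "w + infdist x K *\<^sub>R shape (closest_point K x) w = 0"
  shows "w = 0"
proof (rule ccontr)
  assume "w \<noteq> 0"
  from centre_of_curvature [OF outside_decomposition(1) [OF x] this w(1) outside_decomposition(2) [OF x] w(2)]
  show False using centres r reflect_outside [OF x] by auto
qed

text \<open>Boundary points with a common normal span a segment in the boundary along which the normal is
  constant, and the normal is locally expanding.\<close>

lemma nu_injective:
  assumes q: "q \<in> frontier K" "q' \<in> frontier K" and eq: "nu q = nu q'"
  shows "q = q'"
proof (rule ccontr)
  assume ne: "q \<noteq> q'"
  have K: "q \<in> K" "q' \<in> K" using q frontier_subset by auto
  obtain c d where c: "c > 0" and d: "d > 0"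
    and ex: "\<forall>x\<in>frontier K \<inter> ball q d. \<forall>y\<in>frontier K \<inter> ball q d. c * norm (x - y) \<le> norm (nu x - nu y)"
    using nu_locally_expanding [OF q(1) shape_injective [OF q(1)]] by blast
  define e where "e = min 1 (d / (2 * norm (q' - q)))"
  have e: "e > 0" "e \<le> 1" using d ne by (auto simp: e_def)
  define z where "z = q + e *\<^sub>R (q' - q)"
  have "e * norm (q' - q) \<le> d / (2 * norm (q' - q)) * norm (q' - q)" by (rule mult_right_mono) (auto simp: e_def)
  also have "\<dots> < d" using d ne by simp
  finally have zd: "dist q z < d" using e by (simp add: z_def dist_norm)
  have "z = (1 - e) *\<^sub>R q + e *\<^sub>R q'" by (simp add: z_def algebra_simps)
  then have zK: "z \<in> K" using convexD_alt [OF convex_K K, of e] e by simp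
  have "nu q \<bullet> q' = nu q \<bullet> q" using nu_le [OF q(1) K(2)] nu_le [OF q(2) K(1)] eq by simp
  then have nz: "nu q \<bullet> z = nu q \<bullet> q" by (simp add: z_def inner_add_right inner_diff_right)
  have nz': "nu q \<bullet> z \<le> nu q \<bullet> x" if "x \<in> K" for x using nu_le [OF q(1) that] nz by simp
  have "nu q \<noteq> 0" using norm_nu [OF q(1)] by auto
  then have zf: "z \<in> frontier K" using nz' by (rule supported_in_frontier [OF zK])
  have "nu z = nu q" by (rule nu_unique [OF zf norm_nu [OF q(1)] nz'])
  moreover have "c * norm (q - z) \<le> norm (nu q - nu z)" using ex q(1) zf zd d by auto
  ultimately have "norm (q - z) \<le> 0" using c by (simp add: mult_le_0_iff)
  moreover have "norm (q - z) = e * norm (q' - q)" using e by (simp add: z_def)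
  moreover have "e * norm (q' - q) > 0" using e ne by simp
  ultimately show False by linarith
qed

text \<open>The starting point is a point of \<open>K\<close> farthest from \<^term>\<open>p\<close>.\<close>

lemma ex_reflection:
  assumes p: "p \<notin> K"
  shows "\<exists>x. x \<notin> K \<and> reflect x = p"
proof -
  obtain q where q: "q \<in> K" "\<And>x. x \<in> K \<Longrightarrow> dist p x \<le> dist p q"
    using distance_attains_sup [OF compact_K nonempty_K, of p] by blast
  have ne: "q \<noteq> p" using p q by auto
  from farthest_support [OF q ne] have qf: "q \<in> frontier K" and pq: "p = q + dist p q *\<^sub>R nu q" by auto
  have "dist p q > 0" using ne by simp
  then show ?thesis using on_normal_notin [OF qf] reflect_on_normal [OF qf] pq
    by (metis less_imp_le)
qed

definition several_preimages :: "'a set" where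
  "several_preimages = {p. p \<notin> K \<and> (\<exists>x y. x \<notin> K \<and> y \<notin> K \<and> x \<noteq> y \<and> reflect x = p \<and> reflect y = p)}"

text \<open>Both reflections are local homeomorphisms, so two preimages persist under small displacements.\<close>

lemma open_several_preimages: "open several_preimages"
  unfolding open_subopen [of several_preimages]
proof
  fix p assume "p \<in> several_preimages"
  then obtain x y where p: "p \<notin> K" and xy: "x \<notin> K" "y \<notin> K" "x \<noteq> y" "reflect x = p" "reflect y = p"
    unfolding several_preimages_def by blast
  obtain e where e: "e > 0" "ball x e \<subseteq> - K" "inj_on reflect (ball x e)"
    using reflect_locally_injective [OF xy(1) nondegenerate_outside [OF xy(1)]] xy(4) p by blast
  obtain f where f: "f > 0" "ball y f \<subseteq> - K" "inj_on reflect (ball y f)"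
    using reflect_locally_injective [OF xy(2) nondegenerate_outside [OF xy(2)]] xy(5) p by blast
  define g where "g = min (dist x y / 2) (min e f)"
  have g: "g > 0" "g \<le> e" "g \<le> f" "g \<le> dist x y / 2" using e f xy by (auto simp: g_def)
  have sub: "ball x g \<subseteq> ball x e" "ball y g \<subseteq> ball y f" using g by auto
  have ox: "open (reflect ` ball x g)"
    by (rule invariance_of_domain [OF continuous_reflect open_ball inj_on_subset [OF e(3) sub(1)]])
  have oy: "open (reflect ` ball y g)"
    by (rule invariance_of_domain [OF continuous_reflect open_ball inj_on_subset [OF f(3) sub(2)]])
  have disj: "ball x g \<inter> ball y g = {}" using g(4) by (intro disjoint_ballI) auto
  let ?T = "reflect ` ball x g \<inter> reflect ` ball y g \<inter> - K"
  have "open ?T" using ox oy closed_K by (intro open_Int) auto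
  moreover have "p \<in> reflect ` ball x g" by (rule image_eqI [of _ _ x]) (use xy(4) g(1) in auto)
  moreover have "p \<in> reflect ` ball y g" by (rule image_eqI [of _ _ y]) (use xy(5) g(1) in auto)
  ultimately have "open ?T" "p \<in> ?T" using p by auto
  moreover have "?T \<subseteq> several_preimages"
  proof
    fix z assume z: "z \<in> ?T"
    then obtain a b where ab: "a \<in> ball x g" "z = reflect a" "b \<in> ball y g" "z = reflect b" by blast
    have "a \<notin> K" "b \<notin> K" "a \<noteq> b" using ab sub e(2) f(2) disj by blast+
    then show "z \<in> several_preimages" using z ab unfolding several_preimages_def by auto
  qed
  ultimately show "\<exists>T. open T \<and> p \<in> T \<and> T \<subseteq> several_preimages" by blast
qed

lemma two_feet_subsequence:
  fixes p :: "nat \<Rightarrow> 'a"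
  assumes "\<And>n. p n \<in> several_preimages"
  obtains x y r a b where "\<And>n. x n \<notin> K" "\<And>n. y n \<notin> K" "\<And>n. x n \<noteq> y n" "\<And>n. reflect (x n) = p n" "\<And>n. reflect (y n) = p n"
    "strict_mono (r :: nat \<Rightarrow> nat)" "(\<lambda>n. closest_point K (x (r n))) \<longlonglongrightarrow> a" "(\<lambda>n. closest_point K (y (r n))) \<longlonglongrightarrow> b"
proof -
  obtain x y where xy: "\<And>n. x n \<notin> K" "\<And>n. y n \<notin> K" "\<And>n. x n \<noteq> y n" "\<And>n. reflect (x n) = p n" "\<And>n. reflect (y n) = p n"
    using assms unfolding several_preimages_def mem_Collect_eq by metis
  have "seq_compact (frontier K \<times> frontier K)"
    using compact_Times [OF compact_frontier compact_frontier] compact_eq_seq_compact_metric by blast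
  moreover have "\<forall>n. (closest_point K (x n), closest_point K (y n)) \<in> frontier K \<times> frontier K"
    using outside_decomposition xy by auto
  ultimately obtain l r where r: "strict_mono (r :: nat \<Rightarrow> nat)"
    and lim: "((\<lambda>n. (closest_point K (x n), closest_point K (y n))) \<circ> r) \<longlonglongrightarrow> l"
    by (rule seq_compactE)
  have "(\<lambda>n. closest_point K (x (r n))) \<longlonglongrightarrow> fst l" "(\<lambda>n. closest_point K (y (r n))) \<longlonglongrightarrow> snd l"
    using tendsto_fst [OF lim] tendsto_snd [OF lim] by (auto simp: o_def)
  with that xy r show ?thesis by blast
qed

text \<open>Two preimages of points converging outside \<open>K\<close> cannot merge, because the limit position is not
  degenerate; nor can they escape to \<open>K\<close>, which the reflection fixes.\<close>

lemma open_not_several_preimages: "open (- K - several_preimages)"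
proof (rule ccontr)
  assume "\<not> ?thesis"
  then obtain p where p: "p \<notin> K" "p \<notin> several_preimages" and no: "\<And>e. e > 0 \<Longrightarrow> \<not> ball p e \<subseteq> - K - several_preimages"
    unfolding open_contains_ball by blast
  have "open (- K)" using closed_K by auto
  then obtain e0 where e0: "e0 > 0" "ball p e0 \<subseteq> - K" using p by (meson ComplI openE)
  have "\<exists>z. z \<in> ball p (inverse (Suc n)) \<and> z \<in> several_preimages" for n :: nat
  proof -
    have "min e0 (inverse (real (Suc n))) > 0" using e0 by auto
    from no [OF this] obtain z where "z \<in> ball p (min e0 (inverse (real (Suc n))))" "z \<notin> - K - several_preimages" by blast
    moreover then have "z \<notin> K" using e0 by auto
    ultimately show ?thesis by auto
  qed
  then obtain z where z: "\<And>n. z n \<in> ball p (inverse (Suc n))" "\<And>n. z n \<in> several_preimages" by metis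
  have "(\<lambda>n. dist (z n) p) \<longlonglongrightarrow> 0"
    by (rule Lim_null_comparison [OF _ LIMSEQ_inverse_real_of_nat], intro always_eventually allI)
       (use z in \<open>simp add: dist_commute less_imp_le\<close>)
  then have zp: "z \<longlonglongrightarrow> p" by (rule tendsto_dist_iff [THEN iffD2])
  obtain x y r a b where xy: "\<And>n. x n \<notin> K" "\<And>n. y n \<notin> K" "\<And>n. x n \<noteq> y n" "\<And>n. reflect (x n) = z n" "\<And>n. reflect (y n) = z n"
    and r: "strict_mono (r :: nat \<Rightarrow> nat)"
    and lim: "(\<lambda>n. closest_point K (x (r n))) \<longlonglongrightarrow> a" "(\<lambda>n. closest_point K (y (r n))) \<longlonglongrightarrow> b"
    by (rule two_feet_subsequence [OF z(2)]) (rule that)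
  have zr: "(\<lambda>n. z (r n)) \<longlonglongrightarrow> p" using LIMSEQ_subseq_LIMSEQ [OF zp r] by (simp add: o_def)
  have fibre: "(\<lambda>n. x (r n)) \<longlonglongrightarrow> 2 *\<^sub>R a - p \<and> 2 *\<^sub>R a - p \<notin> K \<and> reflect (2 *\<^sub>R a - p) = p"
    if lim: "(\<lambda>n. closest_point K (x (r n))) \<longlonglongrightarrow> a" and x: "\<And>n. reflect (x n) = z n" for x a
  proof -
    have "x n = 2 *\<^sub>R closest_point K (x n) - z n" for n using x [of n] by (simp add: reflect_def algebra_simps)
    moreover have "(\<lambda>n. 2 *\<^sub>R closest_point K (x (r n)) - z (r n)) \<longlonglongrightarrow> 2 *\<^sub>R a - p"
      by (intro tendsto_intros lim zr)
    ultimately have xl: "(\<lambda>n. x (r n)) \<longlonglongrightarrow> 2 *\<^sub>R a - p" by simp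
    have "(\<lambda>n. reflect (x (r n))) \<longlonglongrightarrow> reflect (2 *\<^sub>R a - p)"
      using continuous_on_tendsto_compose [OF continuous_reflect [of UNIV] xl] by simp
    then have rl: "reflect (2 *\<^sub>R a - p) = p" using x zr LIMSEQ_unique by simp
    then show ?thesis using xl p reflect_self by metis
  qed
  have fx: "(\<lambda>n. x (r n)) \<longlonglongrightarrow> 2 *\<^sub>R a - p" "2 *\<^sub>R a - p \<notin> K" "reflect (2 *\<^sub>R a - p) = p" using fibre [OF lim(1) xy(4)] by auto
  have fy: "(\<lambda>n. y (r n)) \<longlonglongrightarrow> 2 *\<^sub>R b - p" "2 *\<^sub>R b - p \<notin> K" "reflect (2 *\<^sub>R b - p) = p" using fibre [OF lim(2) xy(5)] by auto
  have "2 *\<^sub>R a - p = 2 *\<^sub>R b - p" using p fx(2,3) fy(2,3) unfolding several_preimages_def by blast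
  then have fy': "(\<lambda>n. y (r n)) \<longlonglongrightarrow> 2 *\<^sub>R a - p" using fy(1) by simp
  have "reflect (2 *\<^sub>R a - p) \<notin> K" using fx(3) p(1) by simp
  from reflect_locally_injective [OF fx(2) nondegenerate_outside [OF fx(2) this]]
  obtain e where e: "e > 0" "inj_on reflect (ball (2 *\<^sub>R a - p) e)" by blast
  have "\<forall>\<^sub>F n in sequentially. dist (x (r n)) (2 *\<^sub>R a - p) < e \<and> dist (y (r n)) (2 *\<^sub>R a - p) < e"
    using tendstoD [OF fx(1) e(1)] tendstoD [OF fy' e(1)] by (rule eventually_conj)
  then obtain n where n: "\<forall>k\<ge>n. dist (x (r k)) (2 *\<^sub>R a - p) < e \<and> dist (y (r k)) (2 *\<^sub>R a - p) < e"
    unfolding eventually_sequentially ..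
  have "x (r n) \<in> ball (2 *\<^sub>R a - p) e" "y (r n) \<in> ball (2 *\<^sub>R a - p) e"
    using n [rule_format, of n] by (simp_all add: dist_commute)
  moreover have "reflect (x (r n)) = reflect (y (r n))" by (simp only: xy(4,5))
  ultimately have "x (r n) = y (r n)" using inj_onD [OF e(2)] by blast
  then show False using xy(3) by blast
qed

text \<open>Far away from \<open>K\<close> two normals through one point would have almost the same direction, hence almost
  the same starting point, while the unit normal is locally expanding.\<close>

lemma not_all_several_preimages: "- K - several_preimages \<noteq> {}"
proof
  assume all: "- K - several_preimages = {}"
  obtain B where B: "\<And>x. x \<in> K \<Longrightarrow> norm x \<le> B" using bounded_K bounded_iff by blast
  obtain u :: 'a where u: "norm u = 1" using vector_choose_size zero_le_one by blast
  have B0: "B \<ge> 0" using B nonempty_K norm_ge_zero by (meson all_not_in_conv order_trans)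
  define p where "p n = (2 * B + real (Suc n)) *\<^sub>R u" for n
  have np: "norm (p n) = 2 * B + real (Suc n)" for n using B0 u by (simp add: p_def)
  have "p n \<notin> K" for n using B [of "p n"] np [of n] B0 by auto
  then have pm: "p n \<in> several_preimages" for n using all by blast
  obtain x y r a b where xy: "\<And>n. x n \<notin> K" "\<And>n. y n \<notin> K" "\<And>n. x n \<noteq> y n" "\<And>n. reflect (x n) = p n" "\<And>n. reflect (y n) = p n"
    and r: "strict_mono (r :: nat \<Rightarrow> nat)"
    and lim: "(\<lambda>n. closest_point K (x (r n))) \<longlonglongrightarrow> a" "(\<lambda>n. closest_point K (y (r n))) \<longlonglongrightarrow> b"
    by (rule two_feet_subsequence [OF pm]) (rule that)
  let ?a = "\<lambda>n. closest_point K (x n)" and ?b = "\<lambda>n. closest_point K (y n)"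
  have af: "?a n \<in> frontier K" and bf: "?b n \<in> frontier K" for n using outside_decomposition xy by auto
  have key: "real (Suc n) * norm (nu (?a n) - nu (?b n)) \<le> 2 * norm (?a n - ?b n)" for n
  proof -
    let ?s = "infdist (x n) K" and ?t = "infdist (y n) K"
    have pa: "p n = ?a n + ?s *\<^sub>R nu (?a n)" using reflect_outside xy by metis
    have pb: "p n = ?b n + ?t *\<^sub>R nu (?b n)" using reflect_outside xy by metis
    have s: "?s = norm (p n - ?a n)" and t: "?t = norm (p n - ?b n)"
    proof -
      have "p n - ?a n = ?s *\<^sub>R nu (?a n)" "p n - ?b n = ?t *\<^sub>R nu (?b n)"
        using pa pb by (metis add_diff_cancel_left')+
      then show "?s = norm (p n - ?a n)" "?t = norm (p n - ?b n)"
        using norm_nu [OF af] norm_nu [OF bf] by (simp_all add: abs_of_nonneg [OF infdist_nonneg])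
    qed
    have "norm (p n) \<le> norm (?a n) + ?s" using norm_triangle_sub [of "p n" "?a n"] s by simp
    then have sn: "?s \<ge> real (Suc n)" using np [of n] B [OF closest_in, of "x n"] B0 by linarith
    have "\<bar>?t - ?s\<bar> \<le> norm ((p n - ?b n) - (p n - ?a n))" unfolding s t by (rule norm_triangle_ineq3)
    then have ts: "\<bar>?t - ?s\<bar> \<le> norm (?a n - ?b n)" by simp
    have "?s *\<^sub>R (nu (?a n) - nu (?b n)) = (?b n - ?a n) + (?t - ?s) *\<^sub>R nu (?b n)"
      using pa pb by (simp add: algebra_simps)
    then have "?s * norm (nu (?a n) - nu (?b n)) = norm ((?b n - ?a n) + (?t - ?s) *\<^sub>R nu (?b n))"
      using infdist_nonneg by (metis abs_of_nonneg norm_scaleR)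
    also have "\<dots> \<le> norm (?b n - ?a n) + \<bar>?t - ?s\<bar>"
      using norm_triangle_ineq [of "?b n - ?a n" "(?t - ?s) *\<^sub>R nu (?b n)"] norm_nu [OF bf] by simp
    also have "\<dots> \<le> 2 * norm (?a n - ?b n)" using ts by (simp add: norm_minus_commute)
    finally show ?thesis using mult_right_mono [OF sn, of "norm (nu (?a n) - nu (?b n))"] by simp
  qed
  have nua: "(\<lambda>n. nu (?a (r n))) \<longlonglongrightarrow> nu a" and af': "a \<in> frontier K" using nu_tendsto [OF af lim(1)] by auto
  have nub: "(\<lambda>n. nu (?b (r n))) \<longlonglongrightarrow> nu b" and bf': "b \<in> frontier K" using nu_tendsto [OF bf lim(2)] by auto
  have "(\<lambda>n. nu (?a (r n)) - nu (?b (r n))) \<longlonglongrightarrow> 0"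
  proof (rule Lim_null_comparison)
    show "\<forall>\<^sub>F n in sequentially. norm (nu (?a (r n)) - nu (?b (r n))) \<le> (4 * B) * inverse (real (Suc (r n)))"
    proof (intro always_eventually allI)
      fix n
      have "norm (?a (r n) - ?b (r n)) \<le> B + B"
        using norm_triangle_ineq4 [of "?a (r n)" "?b (r n)"] B [OF closest_in, of "x (r n)"] B [OF closest_in, of "y (r n)"] by linarith
      then have "real (Suc (r n)) * norm (nu (?a (r n)) - nu (?b (r n))) \<le> 4 * B" using key [of "r n"] by linarith
      then show "norm (nu (?a (r n)) - nu (?b (r n))) \<le> (4 * B) * inverse (real (Suc (r n)))"
        unfolding divide_inverse [symmetric] by (subst pos_le_divide_eq) (simp_all add: mult.commute del: of_nat_Suc)
    qed
    have "(\<lambda>n. inverse (real (Suc (r n)))) \<longlonglongrightarrow> 0"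
      using LIMSEQ_subseq_LIMSEQ [OF LIMSEQ_inverse_real_of_nat r] by (simp add: o_def)
    then show "(\<lambda>n. (4 * B) * inverse (real (Suc (r n)))) \<longlonglongrightarrow> 0" by (rule tendsto_mult_right_zero)
  qed
  then have "nu a - nu b = 0" using tendsto_diff [OF nua nub] LIMSEQ_unique by blast
  then have ab: "b = a" using nu_injective [OF af' bf'] by simp
  obtain c d where c: "c > 0" and d: "d > 0"
    and ex: "\<forall>x\<in>frontier K \<inter> ball a d. \<forall>y\<in>frontier K \<inter> ball a d. c * norm (x - y) \<le> norm (nu x - nu y)"
    using nu_locally_expanding [OF af' shape_injective [OF af']] by blast
  have "\<forall>\<^sub>F n in sequentially. dist (?a (r n)) a < d \<and> dist (?b (r n)) a < d"
    using tendstoD [OF lim(1) d] tendstoD [OF lim(2) d] ab by (auto intro: eventually_conj)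
  then obtain N where N: "\<And>n. n \<ge> N \<Longrightarrow> dist (?a (r n)) a < d \<and> dist (?b (r n)) a < d"
    unfolding eventually_sequentially by blast
  obtain M :: nat where M: "2 / c < real M" using reals_Archimedean2 by blast
  define n where "n = max N M"
  have n: "n \<ge> N" "real (Suc (r n)) > 2 / c"
    using M seq_suble [OF r, of n] by (auto simp: n_def)
  let ?d = "norm (?a (r n) - ?b (r n))"
  have "?a (r n) \<noteq> ?b (r n)"
    using inj_on_fibre [of "p (r n)"] xy [of "r n"] unfolding inj_on_def by blast
  then have dpos: "?d > 0" by simp
  have "c * ?d \<le> norm (nu (?a (r n)) - nu (?b (r n)))" using ex N [OF n(1)] af bf by (auto simp: dist_commute)
  then have "real (Suc (r n)) * (c * ?d) \<le> real (Suc (r n)) * norm (nu (?a (r n)) - nu (?b (r n)))" by (rule mult_left_mono) simp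
  also have "\<dots> \<le> 2 * ?d" by (rule key)
  finally have "(real (Suc (r n)) * c) * ?d \<le> 2 * ?d" by (simp only: mult.assoc)
  then have "real (Suc (r n)) * c \<le> 2" using dpos by (simp only: mult_le_cancel_right_pos)
  then show False using n(2) c by (simp add: pos_divide_less_eq)
qed

text \<open>The complement of \<open>K\<close> is connected, so the open and relatively closed set of points with several
  preimages is empty.\<close>

theorem unique_reflection:
  assumes p: "p \<notin> K"
  shows "\<exists>!x. x \<notin> K \<and> reflect x = p"
proof -
  have "connected (- K)" by (rule connected_complement_bounded_convex [OF bounded_K convex_K dim])
  then have "several_preimages \<inter> - K = {} \<or> (- K - several_preimages) \<inter> - K = {}"
    by (rule connectedD [OF _ open_several_preimages open_not_several_preimages]) auto
  then have "p \<notin> several_preimages" using not_all_several_preimages p by blast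
  then have uniq: "x = y" if "x \<notin> K" "reflect x = p" "y \<notin> K" "reflect y = p" for x y
    using that p unfolding several_preimages_def by blast
  obtain x where x: "x \<notin> K" "reflect x = p" using ex_reflection [OF p] by blast
  show ?thesis
  proof (rule ex1I [of _ x])
    show "y = x" if "y \<notin> K \<and> reflect y = p" for y using uniq x that by simp
  qed (use x in simp)
qed

lemma num_normals_outside_2: "p \<notin> K \<Longrightarrow> num_normals K p = 2"
  by (rule num_normals_outside [OF _ unique_reflection])

end

section \<open>Counting the fibres of a Lipschitz map\<close>

text \<open>The lower corner, scaled by \<open>2\<^sup>k\<close>, of the dyadic cube of side \<open>2\<^sup>-\<^sup>k\<close> that contains the point.\<close>

definition dyadic_cell :: "nat \<Rightarrow> 'a::euclidean_space \<Rightarrow> 'a" where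
  "dyadic_cell k x = (\<Sum>i\<in>Basis. of_int \<lfloor>2 ^ k * (x \<bullet> i)\<rfloor> *\<^sub>R i)"

lemma dyadic_cell_inner: "i \<in> Basis \<Longrightarrow> dyadic_cell k x \<bullet> i = of_int \<lfloor>2 ^ k * (x \<bullet> i)\<rfloor>"
  unfolding dyadic_cell_def by simp

lemma dyadic_cell_eq_iff:
  "dyadic_cell k x = dyadic_cell k y \<longleftrightarrow> (\<forall>i\<in>Basis. \<lfloor>2 ^ k * (x \<bullet> i)\<rfloor> = \<lfloor>2 ^ k * (y \<bullet> i)\<rfloor>)"
  by (subst euclidean_eq_iff) (simp add: dyadic_cell_inner)

lemma dyadic_cell_Suc:
  assumes "dyadic_cell (Suc k) x = dyadic_cell (Suc k) y"
  shows "dyadic_cell k x = dyadic_cell k y"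
proof -
  have "\<lfloor>2 ^ k * t\<rfloor> = \<lfloor>2 ^ Suc k * t\<rfloor> div 2" for t :: real
    using floor_divide_real_eq_div [of 2 "2 ^ Suc k * t"] by simp
  then show ?thesis using assms unfolding dyadic_cell_eq_iff by metis
qed

lemma dyadic_cell_close:
  fixes x y :: "'a::euclidean_space"
  assumes "dyadic_cell k x = dyadic_cell k y"
  shows "norm (x - y) \<le> DIM('a) * (1 / 2 ^ k)"
proof -
  have "norm (x - y) \<le> (\<Sum>i\<in>Basis. \<bar>(x - y) \<bullet> i\<bar>)" by (rule norm_le_l1)
  also have "\<dots> \<le> (\<Sum>i\<in>(Basis::'a set). 1 / 2 ^ k)"
  proof (rule sum_mono)
    fix i :: 'a assume "i \<in> Basis"
    then have "\<lfloor>2 ^ k * (x \<bullet> i)\<rfloor> = \<lfloor>2 ^ k * (y \<bullet> i)\<rfloor>" using assms by (simp add: dyadic_cell_eq_iff)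
    then have "\<bar>2 ^ k * (x \<bullet> i) - 2 ^ k * (y \<bullet> i)\<bar> < 1" by linarith
    then have "2 ^ k * \<bar>(x - y) \<bullet> i\<bar> < 1"
      unfolding right_diff_distrib [symmetric] abs_mult inner_diff_left by simp
    then show "\<bar>(x - y) \<bullet> i\<bar> \<le> 1 / 2 ^ k" by (simp add: pos_le_divide_eq mult.commute)
  qed
  also have "\<dots> = DIM('a) * (1 / 2 ^ k)" by simp
  finally show ?thesis .
qed

lemma finite_dyadic_cells:
  fixes A :: "'a::euclidean_space set"
  assumes "bounded A"
  shows "finite (dyadic_cell k ` A)"
proof -
  obtain R where R: "\<And>x. x \<in> A \<Longrightarrow> norm x \<le> R" using assms bounded_iff by blast
  define I where "I = {\<lfloor>- (2 ^ k * R)\<rfloor>..\<lfloor>2 ^ k * R\<rfloor>}"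
  have "dyadic_cell k ` A \<subseteq> (\<lambda>h. \<Sum>i\<in>Basis. of_int (h i) *\<^sub>R i) ` (Basis \<rightarrow>\<^sub>E I)"
  proof
    fix z assume "z \<in> dyadic_cell k ` A"
    then obtain x where x: "x \<in> A" "z = dyadic_cell k x" by blast
    have "\<lfloor>2 ^ k * (x \<bullet> i)\<rfloor> \<in> I" if "i \<in> Basis" for i
    proof -
      have "x \<bullet> i \<le> R" "- R \<le> x \<bullet> i" using Basis_le_norm [OF that, of x] R [OF x(1)] by linarith+
      then have "2 ^ k * (x \<bullet> i) \<le> 2 ^ k * R" "- (2 ^ k * R) \<le> 2 ^ k * (x \<bullet> i)"
        using mult_left_mono [of "x \<bullet> i" R "2 ^ k"] mult_left_mono [of "- R" "x \<bullet> i" "2 ^ k"] by auto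
      then show ?thesis by (auto simp: I_def intro!: floor_mono)
    qed
    then have mem: "(\<lambda>i\<in>Basis. \<lfloor>2 ^ k * (x \<bullet> i)\<rfloor>) \<in> Basis \<rightarrow>\<^sub>E I" by auto
    have "z = (\<Sum>i\<in>Basis. of_int ((\<lambda>i\<in>Basis. \<lfloor>2 ^ k * (x \<bullet> i)\<rfloor>) i) *\<^sub>R i)"
      unfolding x(2) dyadic_cell_def by (intro sum.cong) auto
    then show "z \<in> (\<lambda>h. \<Sum>i\<in>Basis. of_int (h i) *\<^sub>R i) ` (Basis \<rightarrow>\<^sub>E I)" using mem by blast
  qed
  moreover have "finite ((\<lambda>h. \<Sum>i\<in>Basis. of_int (h i) *\<^sub>R (i::'a)) ` (Basis \<rightarrow>\<^sub>E I))"
    by (intro finite_imageI finite_PiE) (auto simp: I_def)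
  ultimately show ?thesis by (rule finite_subset)
qed

lemma dyadic_cell_measurable: "{x. dyadic_cell k x = z} \<in> sets borel"
proof -
  have "{x. dyadic_cell k x = z} = (\<Inter>i\<in>Basis. {x. real_of_int \<lfloor>2 ^ k * (x \<bullet> i)\<rfloor> = z \<bullet> i})"
    by (subst euclidean_eq_iff) (auto simp: dyadic_cell_inner)
  also have "\<dots> \<in> sets borel"
  proof (intro sets.finite_INT)
    fix i :: 'a assume "i \<in> Basis"
    have "(\<lambda>x. real_of_int \<lfloor>2 ^ k * (x \<bullet> i)\<rfloor>) \<in> borel_measurable borel"
      by (rule measurable_compose [OF _ borel_measurable_real_floor]) measurable
    then have "{x \<in> space borel. real_of_int \<lfloor>2 ^ k * (x \<bullet> i)\<rfloor> = z \<bullet> i} \<in> sets borel"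
      by (rule borel_measurable_eq) measurable
    then show "{x. real_of_int \<lfloor>2 ^ k * (x \<bullet> i)\<rfloor> = z \<bullet> i} \<in> sets borel" by simp
  qed auto
  finally show ?thesis .
qed

text \<open>The cubes of a sufficiently fine grid separate any finite set of points.\<close>

lemma SUP_card_dyadic_cells:
  fixes S :: "'a::euclidean_space set"
  assumes "bounded S"
  shows "(SUP k. of_nat (card (dyadic_cell k ` S))) = emeasure (count_space UNIV) S"
proof (rule antisym)
  show "(SUP k. of_nat (card (dyadic_cell k ` S))) \<le> emeasure (count_space UNIV) S"
  proof (rule SUP_least)
    fix k
    show "of_nat (card (dyadic_cell k ` S)) \<le> emeasure (count_space UNIV) S"
      by (cases "finite S") (auto simp: emeasure_count_space card_image_le)
  qed
next
  have le: "of_nat (card F) \<le> (SUP k. of_nat (card (dyadic_cell k ` S)) :: ennreal)" if F: "finite F" "F \<subseteq> S" for F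
  proof -
    define D where "D = insert 1 ((\<lambda>(x, y). norm (x - y)) ` {(x, y) \<in> F \<times> F. x \<noteq> y})"
    have finD: "finite D" unfolding D_def using F by (auto intro: finite_subset [of _ "F \<times> F"])
    have Dne: "D \<noteq> {}" by (simp add: D_def)
    have "Min D > 0" using finD Dne by (subst Min_gr_iff) (auto simp: D_def)
    then obtain k where k: "1 / 2 ^ k < Min D / DIM('a)"
      using real_arch_pow_inv [of "Min D / DIM('a)" "1/2"] by (auto simp: power_one_over)
    have "inj_on (dyadic_cell k) F"
    proof (rule inj_onI, rule ccontr)
      fix x y assume xy: "x \<in> F" "y \<in> F" "dyadic_cell k x = dyadic_cell k y" "x \<noteq> y"
      then have "norm (x - y) \<in> D" by (force simp: D_def)
      then have "Min D \<le> norm (x - y)" using finD by simp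
      also have "\<dots> \<le> DIM('a) * (1 / 2 ^ k)" by (rule dyadic_cell_close [OF xy(3)])
      also have "\<dots> < Min D" using k by (simp add: pos_less_divide_eq mult.commute)
      finally show False by simp
    qed
    then have "card F = card (dyadic_cell k ` F)" by (simp add: card_image)
    also have "\<dots> \<le> card (dyadic_cell k ` S)"
      using F by (intro card_mono finite_dyadic_cells assms image_mono)
    finally show ?thesis by (intro SUP_upper2 [of k]) auto
  qed
  show "emeasure (count_space UNIV) S \<le> (SUP k. of_nat (card (dyadic_cell k ` S)))"
  proof (cases "finite S")
    case True
    then show ?thesis using le [OF True subset_refl] by (simp add: emeasure_count_space)
  next
    case False
    have "of_nat n \<le> (SUP k. of_nat (card (dyadic_cell k ` S)) :: ennreal)" for n
    proof -
      obtain F where "F \<subseteq> S" "card F = n" "finite F" using infinite_arbitrarily_large [OF False] by blast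
      then show ?thesis using le by blast
    qed
    then have "(SUP k. of_nat (card (dyadic_cell k ` S)) :: ennreal) = top"
      by (metis ennreal_SUP_of_nat_eq_top SUP_least top_unique)
    then show ?thesis by (simp only: top_greatest)
  qed
qed

text \<open>A cube of the finer grid determines the cube of the coarser grid that contains it.\<close>

lemma card_dyadic_cells_le_Suc:
  fixes S :: "'a::euclidean_space set"
  assumes "bounded S"
  shows "card (dyadic_cell k ` S) \<le> card (dyadic_cell (Suc k) ` S)"
proof -
  define h where "h z = dyadic_cell k (SOME x. x \<in> S \<and> dyadic_cell (Suc k) x = z)" for z
  have "dyadic_cell k x = h (dyadic_cell (Suc k) x)" if "x \<in> S" for x
  proof -
    have "\<exists>y. y \<in> S \<and> dyadic_cell (Suc k) y = dyadic_cell (Suc k) x" using that by blast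
    from someI_ex [OF this] show ?thesis unfolding h_def using dyadic_cell_Suc by metis
  qed
  then have "dyadic_cell k ` S = h ` dyadic_cell (Suc k) ` S" by force
  then show ?thesis using card_image_le [OF finite_dyadic_cells [OF assms]] by metis
qed

text \<open>A cube of side \<open>2\<^sup>-\<^sup>k\<close> has an image of measure at most a constant times the measure of the
  cube, and the cubes meeting a bounded set fill at most a fixed ball.\<close>

lemma Lipschitz_image_dyadic_cells:
  fixes f :: "'a::euclidean_space \<Rightarrow> 'a"
  assumes bA: "bounded A" and L: "\<And>x y. norm (f x - f y) \<le> L * norm (x - y)" and L0: "L \<ge> 0"
  shows "\<exists>C<\<infinity>. \<forall>k. (\<Sum>z\<in>dyadic_cell k ` A. emeasure lebesgue (f ` {x\<in>A. dyadic_cell k x = z})) \<le> C"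
proof -
  obtain R where R: "\<And>x. x \<in> A \<Longrightarrow> norm x \<le> R" using bA bounded_iff by blast
  let ?m = "DIM('a)"
  let ?c = "(2 * L * ?m) ^ ?m"
  let ?B = "ball (0::'a) (R + ?m + 1)"
  show ?thesis
  proof (intro exI conjI allI)
    show "ennreal ?c * emeasure lebesgue ?B < \<infinity>"
      using emeasure_bounded_finite [of ?B] by (simp add: ennreal_mult_less_top)
    fix k
    let ?h = "1 / 2 ^ k :: real"
    let ?box = "\<lambda>z. box (?h *\<^sub>R z) (?h *\<^sub>R (z + One))"
    have cellbox: "emeasure lebesgue (f ` {x\<in>A. dyadic_cell k x = z}) \<le> ennreal ?c * emeasure lebesgue (?box z)"
      if z: "z \<in> dyadic_cell k ` A" for z
    proof -
      obtain x0 where x0: "x0 \<in> A" "dyadic_cell k x0 = z" using z by blast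
      define l where "l = L * (?m * ?h)"
      have l0: "l \<ge> 0" using L0 by (simp add: l_def)
      have "f ` {x\<in>A. dyadic_cell k x = z} \<subseteq> cbox (f x0 - l *\<^sub>R One) (f x0 + l *\<^sub>R One)"
      proof
        fix y assume "y \<in> f ` {x\<in>A. dyadic_cell k x = z}"
        then obtain x where x: "y = f x" "dyadic_cell k x = dyadic_cell k x0" using x0 by auto
        have "norm (y - f x0) \<le> L * norm (x - x0)" unfolding x(1) by (rule L)
        also have "\<dots> \<le> l" unfolding l_def by (intro mult_left_mono dyadic_cell_close x L0)
        finally have "\<bar>(y - f x0) \<bullet> i\<bar> \<le> l" if "i \<in> Basis" for i using Basis_le_norm [OF that, of "y - f x0"] by linarith
        then show "y \<in> cbox (f x0 - l *\<^sub>R One) (f x0 + l *\<^sub>R One)"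
          by (auto simp: mem_box inner_diff_left inner_add_left abs_le_iff algebra_simps)
      qed
      then have "emeasure lebesgue (f ` {x\<in>A. dyadic_cell k x = z}) \<le> emeasure lebesgue (cbox (f x0 - l *\<^sub>R One) (f x0 + l *\<^sub>R One))"
        by (rule emeasure_mono) simp
      also have "\<dots> = ennreal ((2 * l) ^ ?m)"
        using l0 by (simp add: emeasure_lborel_cbox_eq inner_diff_left inner_add_left)
      also have "(2 * l) ^ ?m = ?c * ?h ^ ?m" by (simp add: l_def power_mult_distrib power_divide mult_ac)
      also have "ennreal (?c * ?h ^ ?m) = ennreal ?c * ennreal (?h ^ ?m)" using L0 by (intro ennreal_mult) auto
      also have "ennreal (?h ^ ?m) = emeasure lebesgue (?box z)"
        by (simp add: emeasure_lborel_box_eq inner_add_left algebra_simps add_divide_distrib)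
      finally show ?thesis .
    qed
    have int: "\<exists>n. z \<bullet> i = of_int n" if "z \<in> dyadic_cell k ` A" "i \<in> Basis" for z i
      using that by (auto simp: dyadic_cell_inner)
    have incell: "dyadic_cell k x = z" if z: "z \<in> dyadic_cell k ` A" and x: "x \<in> ?box z" for x z
    proof (subst euclidean_eq_iff, rule ballI)
      fix i :: 'a assume i: "i \<in> Basis"
      obtain n where n: "z \<bullet> i = of_int n" using int [OF z i] by blast
      have "z \<bullet> i / 2 ^ k < x \<bullet> i" "x \<bullet> i < (z \<bullet> i + 1) / 2 ^ k" using x i by (auto simp: mem_box inner_add_left)
      then have "z \<bullet> i < 2 ^ k * (x \<bullet> i)" "2 ^ k * (x \<bullet> i) < z \<bullet> i + 1"
        by (simp_all add: pos_divide_less_eq pos_less_divide_eq mult.commute)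
      then have "\<lfloor>2 ^ k * (x \<bullet> i)\<rfloor> = n" unfolding n by (intro floor_unique) auto
      then show "dyadic_cell k x \<bullet> i = z \<bullet> i" using i n by (simp add: dyadic_cell_inner)
    qed
    have disj: "disjoint_family_on ?box (dyadic_cell k ` A)"
      unfolding disjoint_family_on_def
    proof (intro ballI impI equals0I)
      fix z z' x assume "z \<in> dyadic_cell k ` A" "z' \<in> dyadic_cell k ` A" "z \<noteq> z'" "x \<in> ?box z \<inter> ?box z'"
      then show False using incell [of z x] incell [of z' x] by simp
    qed
    have inB: "?box z \<subseteq> ?B" if z: "z \<in> dyadic_cell k ` A" for z
    proof
      fix x assume "x \<in> ?box z"
      then have "dyadic_cell k x = z" by (rule incell [OF z])
      then obtain x0 where x0: "x0 \<in> A" "dyadic_cell k x = dyadic_cell k x0" using z by auto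
      have "norm x \<le> norm (x - x0) + norm x0" using norm_triangle_sub [of x x0] by simp
      also have "norm (x - x0) \<le> ?m * ?h" by (rule dyadic_cell_close [OF x0(2)])
      also have "?m * ?h \<le> real ?m * 1" by (intro mult_left_mono) auto
      finally show "x \<in> ?B" using R [OF x0(1)] by simp
    qed
    have "(\<Sum>z\<in>dyadic_cell k ` A. emeasure lebesgue (f ` {x\<in>A. dyadic_cell k x = z}))
        \<le> (\<Sum>z\<in>dyadic_cell k ` A. ennreal ?c * emeasure lebesgue (?box z))"
      by (intro sum_mono cellbox)
    also have "\<dots> = ennreal ?c * (\<Sum>z\<in>dyadic_cell k ` A. emeasure lebesgue (?box z))"
      by (rule sum_distrib_left [symmetric])
    also have "(\<Sum>z\<in>dyadic_cell k ` A. emeasure lebesgue (?box z)) = emeasure lebesgue (\<Union>z\<in>dyadic_cell k ` A. ?box z)"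
      by (rule sum_emeasure [OF _ disj finite_dyadic_cells [OF bA]]) auto
    also have "\<dots> \<le> emeasure lebesgue ?B" by (rule emeasure_mono) (use inB in auto)
    finally show "(\<Sum>z\<in>dyadic_cell k ` A. emeasure lebesgue (f ` {x\<in>A. dyadic_cell k x = z}))
        \<le> ennreal ?c * emeasure lebesgue ?B" by (simp add: mult_left_mono)
  qed
qed

text \<open>The number of preimages is the increasing limit of the numbers of dyadic cubes that meet the
  fibre, which are finite sums of indicator functions of images of cubes.\<close>

theorem Lipschitz_fibre_count:
  fixes f :: "'a::euclidean_space \<Rightarrow> 'a"
  assumes bA: "bounded A" and A: "A \<in> sets lebesgue"
    and L: "\<And>x y. norm (f x - f y) \<le> L * norm (x - y)" and L0: "L \<ge> 0"
  shows "(\<lambda>p. emeasure (count_space UNIV) {x\<in>A. f x = p}) \<in> borel_measurable lebesgue" (is ?meas)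
    and "(\<integral>\<^sup>+p. emeasure (count_space UNIV) {x\<in>A. f x = p} \<partial>lebesgue) < \<infinity>" (is ?fin)
proof -
  let ?N = "\<lambda>k p. of_nat (card (dyadic_cell k ` {x\<in>A. f x = p})) :: ennreal"
  have img: "f ` {x\<in>A. dyadic_cell k x = z} \<in> sets lebesgue" for k z
  proof (rule sets_lebesgue_continuous_image)
    have "{x\<in>A. dyadic_cell k x = z} = A \<inter> {x. dyadic_cell k x = z}" by blast
    also have "\<dots> \<in> sets lebesgue"
      by (intro sets.Int A sets_completionI_sets) (simp add: dyadic_cell_measurable)
    finally show "{x\<in>A. dyadic_cell k x = z} \<in> sets lebesgue" .
    have "L-lipschitz_on UNIV f" using L L0 by (intro lipschitz_onI) (auto simp: dist_norm)
    then show "continuous_on UNIV f" by (rule lipschitz_on_continuous_on)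
    show "negligible (f ` T)" if "negligible T" for T
      by (rule negligible_locally_Lipschitz_image [OF _ that]) (use L in \<open>auto intro!: exI [of _ UNIV] exI [of _ L]\<close>)
  qed auto
  have Nsum: "?N k p = (\<Sum>z\<in>dyadic_cell k ` A. indicator (f ` {x\<in>A. dyadic_cell k x = z}) p)" for k p
  proof -
    have "(\<Sum>z\<in>dyadic_cell k ` A. indicator (f ` {x\<in>A. dyadic_cell k x = z}) p :: ennreal)
      = of_nat (card {z\<in>dyadic_cell k ` A. p \<in> f ` {x\<in>A. dyadic_cell k x = z}})"
      using finite_dyadic_cells [OF bA, of k] by (simp add: indicator_def sum.If_cases Int_def)
    also have "{z\<in>dyadic_cell k ` A. p \<in> f ` {x\<in>A. dyadic_cell k x = z}} = dyadic_cell k ` {x\<in>A. f x = p}"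
    proof (intro set_eqI iffI)
      fix z assume "z \<in> {z\<in>dyadic_cell k ` A. p \<in> f ` {x\<in>A. dyadic_cell k x = z}}"
      then obtain x where "x \<in> A" "f x = p" "z = dyadic_cell k x" by auto
      then show "z \<in> dyadic_cell k ` {x\<in>A. f x = p}" by simp
    qed auto
    finally show ?thesis by simp
  qed
  have Nmeas: "?N k \<in> borel_measurable lebesgue" for k
    unfolding Nsum by (intro borel_measurable_sum borel_measurable_indicator img)
  have eq: "emeasure (count_space UNIV) {x\<in>A. f x = p} = (SUP k. ?N k p)" for p
    by (rule SUP_card_dyadic_cells [symmetric]) (rule bounded_subset [OF bA], auto)
  show ?meas unfolding eq by (intro borel_measurable_SUP Nmeas) auto
  have inc: "incseq ?N"
  proof (intro incseq_SucI le_funI)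
    fix k p
    have "bounded {x\<in>A. f x = p}" by (rule bounded_subset [OF bA]) auto
    then show "?N k p \<le> ?N (Suc k) p" using card_dyadic_cells_le_Suc by auto
  qed
  obtain C where C: "C < \<infinity>" "\<And>k. (\<Sum>z\<in>dyadic_cell k ` A. emeasure lebesgue (f ` {x\<in>A. dyadic_cell k x = z})) \<le> C"
    using Lipschitz_image_dyadic_cells [OF bA L L0] by blast
  have "(\<integral>\<^sup>+p. (SUP k. ?N k p) \<partial>lebesgue) = (SUP k. integral\<^sup>N lebesgue (?N k))"
    by (rule nn_integral_monotone_convergence_SUP [OF inc Nmeas])
  also have "\<dots> \<le> C"
  proof (rule SUP_least)
    fix k
    have "integral\<^sup>N lebesgue (?N k) = (\<Sum>z\<in>dyadic_cell k ` A. emeasure lebesgue (f ` {x\<in>A. dyadic_cell k x = z}))"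
      unfolding Nsum using img by (simp add: nn_integral_sum nn_integral_indicator)
    then show "integral\<^sup>N lebesgue (?N k) \<le> C" using C(2) by simp
  qed
  finally show ?fin unfolding eq using C(1) by (rule le_less_trans)
qed

section \<open>Points with at least three normals\<close>

context C2_body
begin

text \<open>Focal distances are negative reciprocals of eigenvalues of the shape operator, whose eigenvectors for
  different eigenvalues are orthogonal.\<close>

lemma finite_focal_distances:
  assumes q: "q \<in> frontier K"
  shows "finite {s. s > 0 \<and> (\<exists>w. w \<noteq> 0 \<and> nu q \<bullet> w = 0 \<and> w + s *\<^sub>R shape q w = 0)}" (is "finite ?F")
proof -
  define w where "w s = (SOME w. w \<noteq> 0 \<and> nu q \<bullet> w = 0 \<and> w + s *\<^sub>R shape q w = 0)" for s
  have w: "w s \<noteq> 0 \<and> nu q \<bullet> w s = 0 \<and> w s + s *\<^sub>R shape q (w s) = 0" if "s \<in> ?F" for s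
  proof -
    have "\<exists>w. w \<noteq> 0 \<and> nu q \<bullet> w = 0 \<and> w + s *\<^sub>R shape q w = 0" using that by blast
    then show ?thesis unfolding w_def by (rule someI_ex)
  qed
  have orth: "w s \<bullet> w t = 0" if st: "s \<in> ?F" "t \<in> ?F" "s \<noteq> t" for s t
  proof -
    have s: "s > 0" and t: "t > 0" using st by auto
    have ws: "w s = - (s *\<^sub>R shape q (w s))" and wt: "w t = - (t *\<^sub>R shape q (w t))"
      using w [OF st(1)] w [OF st(2)] by (simp_all add: eq_neg_iff_add_eq_0)
    define a where "a = shape q (w s) \<bullet> w t"
    have "w s \<bullet> w t = - (s * a)" by (subst ws) (simp add: a_def)
    moreover have "w t \<bullet> w s = - (t * (shape q (w t) \<bullet> w s))" by (subst wt) simp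
    moreover have "shape q (w t) \<bullet> w s = a"
      unfolding a_def using shape_symmetric [OF q] w [OF st(1)] w [OF st(2)] by blast
    ultimately have "s * a = t * a" by (simp add: inner_commute)
    then have "a = 0" using st(3) by simp
    then show ?thesis using \<open>w s \<bullet> w t = - (s * a)\<close> by simp
  qed
  have inj: "inj_on w ?F"
  proof (rule inj_onI, rule ccontr)
    fix s t assume st: "s \<in> ?F" "t \<in> ?F" "w s = w t" "s \<noteq> t"
    then have "w s \<bullet> w s = 0" using orth [OF st(1,2,4)] by simp
    then show False using w [OF st(1)] by simp
  qed
  have "pairwise orthogonal (w ` ?F)"
    unfolding pairwise_def orthogonal_def
  proof (intro ballI impI)
    fix a b assume "a \<in> w ` ?F" "b \<in> w ` ?F" and ab: "a \<noteq> b"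
    then obtain s t where "s \<in> ?F" "t \<in> ?F" "a = w s" "b = w t" by blast
    then show "a \<bullet> b = 0" using orth [of s t] ab by blast
  qed
  moreover have "0 \<notin> w ` ?F" using w by force
  ultimately have "independent (w ` ?F)" by (rule pairwise_orthogonal_independent)
  then have "finite (w ` ?F)" by (rule independent_imp_finite)
  then show ?thesis using inj by (rule finite_imageD)
qed

text \<open>The ball around \<^term>\<open>p\<close> up to the nearest boundary point is contained in \<open>K\<close>, so the supporting
  hyperplane of \<open>K\<close> at that point supports this ball.\<close>

lemma nearest_foot:
  assumes p: "p \<in> interior K" and q: "q \<in> frontier K" and near: "\<And>y. y \<in> frontier K \<Longrightarrow> dist p q \<le> dist p y"
  shows "p = q + dist p q *\<^sub>R nu q" "cball p (dist p q) \<subseteq> K"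
proof -
  let ?r = "dist p q"
  have ne: "p \<noteq> q" using p q by (auto simp: frontier_def)
  then have r: "?r > 0" by simp
  have "ball p ?r \<inter> frontier K = {}" using near by force
  moreover have "p \<in> ball p ?r \<inter> K" using r p interior_subset by auto
  ultimately have "ball p ?r \<subseteq> K"
    using connected_Int_frontier [OF convex_connected [OF convex_ball], of p ?r K] by blast
  then have "closure (ball p ?r) \<subseteq> K" using closed_K by (rule closure_minimal)
  then show sub: "cball p ?r \<subseteq> K" using r by (simp add: closure_ball)
  have "p - ?r *\<^sub>R nu q \<in> K" using norm_nu [OF q] by (intro subsetD [OF sub]) (simp add: dist_norm)
  from nu_le [OF q this] have ge: "?r \<le> nu q \<bullet> (p - q)"
    using nu_nu [OF q] by (simp add: inner_diff_right)
  have "(norm (a - t *\<^sub>R nu q))\<^sup>2 = (norm a)\<^sup>2 - 2 * t * (nu q \<bullet> a) + t\<^sup>2" for a t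
    using nu_nu [OF q] unfolding power2_norm_eq_inner
    by (simp add: inner_diff_left inner_diff_right inner_commute power2_eq_square algebra_simps)
  then have "(norm (p - q - ?r *\<^sub>R nu q))\<^sup>2 = ?r\<^sup>2 - 2 * ?r * (nu q \<bullet> (p - q)) + ?r\<^sup>2"
    by (simp only: dist_norm)
  also have "\<dots> \<le> ?r\<^sup>2 - 2 * ?r * ?r + ?r\<^sup>2" using mult_left_mono [OF ge, of "2 * ?r"] r by simp
  also have "\<dots> = 0" by (simp add: power2_eq_square)
  finally have "p - q - ?r *\<^sub>R nu q = 0" by simp
  then show "p = q + ?r *\<^sub>R nu q" by (simp add: algebra_simps)
qed

lemma ex_nearest_foot:
  assumes p: "p \<in> interior K"
  obtains q where "q \<in> frontier K" "\<And>y. y \<in> frontier K \<Longrightarrow> dist p q \<le> dist p y"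
proof -
  have "frontier K \<noteq> {}"
  proof
    assume "frontier K = {}"
    then have "K = {} \<or> K = UNIV" using frontier_eq_empty by blast
    then show False using nonempty_K bounded_K not_bounded_UNIV by blast
  qed
  then show ?thesis using that distance_attains_inf [OF frontier_closed, of K p] by blast
qed

lemma ex_farthest_foot:
  assumes p: "p \<in> interior K"
  obtains q where "q \<in> frontier K" "\<And>y. y \<in> K \<Longrightarrow> dist p y \<le> dist p q" "p = q + dist p q *\<^sub>R nu q"
proof -
  obtain q where q: "q \<in> K" "\<And>y. y \<in> K \<Longrightarrow> dist p y \<le> dist p q"
    using distance_attains_sup [OF compact_K nonempty_K, of p] by blast
  have "q \<noteq> p"
  proof
    assume "q = p"
    then have "K \<subseteq> {p}" using q(2) by auto
    then have "interior K \<subseteq> interior {p}" by (rule interior_mono)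
    then show False using p by simp
  qed
  with farthest_support [OF q] that q show ?thesis by blast
qed

lemma num_normals_ge_card:
  assumes "finite F" "F \<subseteq> feet p"
  shows "of_nat (card F) \<le> num_normals K p"
  unfolding num_normals_eq_feet using assms
  by (cases "finite (feet p)") (auto simp: emeasure_count_space card_mono)

text \<open>If the nearest and the farthest boundary point were equally far, \<open>K\<close> would be a ball.\<close>

lemma nearest_less_farthest:
  assumes nb: "\<nexists>c r. K = cball c r" and p: "p \<in> interior K"
    and q: "q \<in> frontier K" "\<And>y. y \<in> frontier K \<Longrightarrow> dist p q \<le> dist p y"
    and r: "r \<in> frontier K" "\<And>y. y \<in> K \<Longrightarrow> dist p y \<le> dist p r"
  shows "dist p q < dist p r"
proof (rule ccontr)
  assume "\<not> ?thesis"
  then have "K \<subseteq> cball p (dist p q)" using r(2) by force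
  then have "K = cball p (dist p q)" using nearest_foot(2) [OF p q] by blast
  then show False using nb by blast
qed

lemma two_normals:
  assumes nb: "\<nexists>c r. K = cball c r" and p: "p \<in> interior K"
  shows "2 \<le> num_normals K p"
proof -
  obtain q where q: "q \<in> frontier K" "\<And>y. y \<in> frontier K \<Longrightarrow> dist p q \<le> dist p y" using ex_nearest_foot [OF p] by blast
  obtain r where r: "r \<in> frontier K" "\<And>y. y \<in> K \<Longrightarrow> dist p y \<le> dist p r" "p = r + dist p r *\<^sub>R nu r"
    using ex_farthest_foot [OF p] by blast
  have "q \<noteq> r" using nearest_less_farthest [OF nb p q r(1,2)] by auto
  moreover have "{q, r} \<subseteq> feet p" using q(1) r(1,3) nearest_foot(1) [OF p q] unfolding feet_def by blast
  ultimately show ?thesis using num_normals_ge_card [of "{q, r}" p] by simp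
qed

lemma three_normals:
  assumes nb: "\<nexists>c r. K = cball c r" and p: "p \<in> interior K" and s: "s \<in> feet p"
    and y: "y \<in> frontier K" "dist p y < dist p s" and z: "z \<in> K" "dist p s < dist p z"
  shows "3 \<le> num_normals K p"
proof -
  obtain q where q: "q \<in> frontier K" "\<And>y. y \<in> frontier K \<Longrightarrow> dist p q \<le> dist p y" using ex_nearest_foot [OF p] by blast
  obtain r where r: "r \<in> frontier K" "\<And>y. y \<in> K \<Longrightarrow> dist p y \<le> dist p r" "p = r + dist p r *\<^sub>R nu r"
    using ex_farthest_foot [OF p] by blast
  have "dist p q < dist p s" "dist p s < dist p r" using q(2) [OF y(1)] y(2) r(2) [OF z(1)] z(2) by linarith+
  then have "q \<noteq> s" "s \<noteq> r" "q \<noteq> r" by auto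
  then have "card {q, s, r} = 3" by simp
  moreover have "{q, s, r} \<subseteq> feet p" using q(1) r(1,3) s nearest_foot(1) [OF p q] unfolding feet_def by blast
  ultimately show ?thesis using num_normals_ge_card [of "{q, s, r}" p] by simp
qed

text \<open>Along the normal at \<open>q\<close>, the distances at which \<open>q\<close> is a nearest boundary point, and those
  at which it is a farthest one, form two closed and disjoint sets.  If they covered the
  whole stretch inside \<open>K\<close>, one of them would, and it would be the first, as \<open>q\<close> is chosen nearest to
  some interior point; but that one fails at the end where the normal leaves \<open>K\<close>.\<close>

lemma ex_intermediate_distance:
  assumes nb: "\<nexists>c r. K = cball c r"
  obtains q S where "q \<in> frontier K" "open S" "S \<noteq> {}"
    "\<And>s. s \<in> S \<Longrightarrow> s > 0 \<and> q + s *\<^sub>R nu q \<in> interior K \<and>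
       (\<exists>y\<in>frontier K. dist (q + s *\<^sub>R nu q) y < s) \<and> (\<exists>y\<in>frontier K. s < dist (q + s *\<^sub>R nu q) y)"
proof -
  obtain p0 where p0: "p0 \<in> interior K" using interior_K by blast
  obtain q where q: "q \<in> frontier K" "\<And>y. y \<in> frontier K \<Longrightarrow> dist p0 q \<le> dist p0 y" using ex_nearest_foot [OF p0] by blast
  define s0 where "s0 = dist p0 q"
  have s0: "s0 > 0" "p0 = q + s0 *\<^sub>R nu q"
    using nearest_foot(1) [OF p0 q] p0 q(1) by (auto simp: s0_def frontier_def)
  let ?p = "\<lambda>s. q + s *\<^sub>R nu q"
  define J where "J = {s. s > 0 \<and> ?p s \<in> interior K}"
  have openJ: "open J"
  proof -
    have "open (?p -` interior K)" by (intro open_vimage open_interior continuous_intros)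
    then have "open ({0<..} \<inter> ?p -` interior K)" by (intro open_Int) auto
    then show ?thesis by (simp add: J_def vimage_def Int_def)
  qed
  have convJ: "convex J"
  proof (rule convexI)
    fix s t u v :: real assume st: "s \<in> J" "t \<in> J" and uv: "0 \<le> u" "0 \<le> v" "u + v = 1"
    have "?p (u * s + v * t) = (u + v) *\<^sub>R q + (u * s + v * t) *\<^sub>R nu q" using uv by simp
    also have "\<dots> = u *\<^sub>R ?p s + v *\<^sub>R ?p t" by (simp add: algebra_simps)
    finally have "?p (u * s + v * t) \<in> interior K"
      using convexD [OF convex_interior [OF convex_K], of "?p s" "?p t" u v] st uv by (simp add: J_def)
    moreover have "u * s + v * t > 0"
    proof (cases "u = 0")
      case True then show ?thesis using st uv by (simp add: J_def)
    next
      case False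
      then have "u * s > 0" using st uv by (simp add: J_def)
      moreover have "v * t \<ge> 0" using st uv by (simp add: J_def)
      ultimately show ?thesis by linarith
    qed
    ultimately show "u *\<^sub>R s + v *\<^sub>R t \<in> J" by (simp add: J_def)
  qed
  have dq: "dist (?p s) q = s" if "s \<ge> 0" for s using norm_nu [OF q(1)] that by (simp add: dist_norm)
  define P where "P = (\<Inter>y\<in>frontier K. {s. s \<le> dist (?p s) y})"
  define Q where "Q = (\<Inter>y\<in>frontier K. {s. dist (?p s) y \<le> s})"
  have cP: "closed P" and cQ: "closed Q"
    unfolding P_def Q_def by (intro closed_INT ballI closed_Collect_le continuous_intros)+
  have disj: "P \<inter> Q \<inter> J = {}"
  proof (rule ccontr)
    assume "P \<inter> Q \<inter> J \<noteq> {}"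
    then obtain s where s: "s \<in> P" "s \<in> Q" "s > 0" "?p s \<in> interior K" by (auto simp: J_def)
    have near: "dist (?p s) q \<le> dist (?p s) y" if "y \<in> frontier K" for y
      using s(1) that dq [of s] s(3) by (simp add: P_def)
    obtain r where r: "r \<in> frontier K" "\<And>y. y \<in> K \<Longrightarrow> dist (?p s) y \<le> dist (?p s) r"
      using ex_farthest_foot [OF s(4)] by blast
    have "dist (?p s) q < dist (?p s) r" by (rule nearest_less_farthest [OF nb s(4) q(1) near r])
    moreover have "dist (?p s) r \<le> s" using s(2) r(1) by (simp add: Q_def)
    ultimately show False using dq [of s] s(3) by simp
  qed
  have s0J: "s0 \<in> J" using s0 p0 by (simp add: J_def)
  have s0P: "s0 \<in> P" using q(2) by (simp add: P_def s0(2) [symmetric]) (simp add: s0_def)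
  have notcov: "\<not> J \<subseteq> P \<union> Q"
  proof
    assume cov: "J \<subseteq> P \<union> Q"
    have "connected J" using convJ by (rule convex_connected)
    then have "Q \<inter> J = {}"
      using cov disj cP cQ s0J s0P unfolding connected_closed by blast
    then have JP: "J \<subseteq> P" using cov by blast
    obtain B where B: "\<And>x. x \<in> K \<Longrightarrow> norm x \<le> B" using bounded_K bounded_iff by blast
    have Jle: "s \<le> B + norm q" if "s \<in> J" for s
    proof -
      have "norm (?p s) \<le> B" using that interior_subset by (intro B) (auto simp: J_def)
      moreover have "norm (s *\<^sub>R nu q) \<le> norm (?p s) + norm q"
        using norm_triangle_ineq4 [of "?p s" q] by simp
      ultimately show ?thesis using norm_nu [OF q(1)] by simp
    qed
    then have bdd: "bdd_above J" by (rule bdd_aboveI)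
    define b where "b = Sup J"
    have s0b: "s0 \<le> b" unfolding b_def using s0J bdd by (rule cSup_upper)
    have "b \<notin> J"
    proof
      assume "b \<in> J"
      then obtain e where e: "e > 0" "ball b e \<subseteq> J" using openJ openE by blast
      then have "b + e / 2 \<in> J" by (intro subsetD [OF e(2)]) (simp add: dist_real_def)
      then have "b + e / 2 \<le> b" unfolding b_def using bdd by (rule cSup_upper)
      then show False using e by simp
    qed
    have "b \<in> closure J" unfolding b_def using s0J bdd by (intro closure_contains_Sup) auto
    have "?p b \<in> K"
    proof -
      have "closed (?p -` K)" by (intro closed_vimage closed_K continuous_intros)
      moreover have "J \<subseteq> ?p -` K" using interior_subset by (auto simp: J_def)
      ultimately have "closure J \<subseteq> ?p -` K" by (rule closure_minimal [rotated])
      then show ?thesis using \<open>b \<in> closure J\<close> by blast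
    qed
    moreover have "?p b \<notin> interior K" using \<open>b \<notin> J\<close> s0b s0(1) by (simp add: J_def)
    ultimately have bf: "?p b \<in> frontier K" using closure_subset by (auto simp: frontier_def)
    have b0: "b > 0" using s0b s0(1) by simp
    obtain s where s: "s \<in> J" "dist s b < b / 2" using \<open>b \<in> closure J\<close> b0 by (metis closure_approachable half_gt_zero)
    have "s \<le> dist (?p s) (?p b)" using subsetD [OF JP s(1)] bf unfolding P_def by blast
    also have "\<dots> = dist s b"
      using norm_nu [OF q(1)] by (simp add: dist_norm scaleR_diff_left [symmetric])
    finally show False using s(2) b0 unfolding dist_real_def by (smt (verit) field_sum_of_halves)
  qed
  let ?S = "J - (P \<union> Q)"
  have "open ?S" using openJ cP cQ by (intro open_Diff closed_Un)
  moreover have "?S \<noteq> {}" using notcov by blast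
  moreover have "s > 0 \<and> ?p s \<in> interior K \<and> (\<exists>y\<in>frontier K. dist (?p s) y < s) \<and> (\<exists>y\<in>frontier K. s < dist (?p s) y)"
    if "s \<in> ?S" for s
  proof -
    have "s > 0" "?p s \<in> interior K" "s \<notin> P" "s \<notin> Q" using that by (auto simp: J_def)
    then show ?thesis unfolding P_def Q_def by (simp add: not_le)
  qed
  ultimately show ?thesis using that [OF q(1)] by blast
qed

text \<open>On the normal at a suitable \<open>q\<close> there is a point which has \<open>q\<close> neither as nearest nor as
  farthest boundary point, at a distance that is not focal.  The reflection is a local homeomorphism
  there, so \<open>q\<close> continues to a third starting point for all nearby points.\<close>

lemma ex_open_three_normals:
  assumes nb: "\<nexists>c r. K = cball c r"
  obtains V where "open V" "V \<noteq> {}" "V \<subseteq> interior K" "\<And>p. p \<in> V \<Longrightarrow> 3 \<le> num_normals K p"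
proof -
  obtain q S where q: "q \<in> frontier K" and S: "open S" "S \<noteq> {}" and
    inS: "\<And>s. s \<in> S \<Longrightarrow> s > 0 \<and> q + s *\<^sub>R nu q \<in> interior K \<and>
       (\<exists>y\<in>frontier K. dist (q + s *\<^sub>R nu q) y < s) \<and> (\<exists>y\<in>frontier K. s < dist (q + s *\<^sub>R nu q) y)"
    using ex_intermediate_distance [OF nb] by blast
  \<comment> \<open>a nonempty open set of distances contains one that is not focal\<close>
  have "infinite S"
  proof -
    obtain a where "a \<in> S" using S(2) by blast
    then obtain e where "e > 0" "ball a e \<subseteq> S" using S(1) openE by blast
    then show ?thesis using finite_imp_not_open S by blast
  qed
  then obtain s where s: "s \<in> S" "s \<notin> {s. s > 0 \<and> (\<exists>w. w \<noteq> 0 \<and> nu q \<bullet> w = 0 \<and> w + s *\<^sub>R shape q w = 0)}"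
    using finite_focal_distances [OF q] by (meson finite_subset subsetI)
  have s0: "s > 0" and pint: "q + s *\<^sub>R nu q \<in> interior K" using inS [OF s(1)] by auto
  obtain y z where y: "y \<in> frontier K" "dist (q + s *\<^sub>R nu q) y < s" and z: "z \<in> frontier K" "s < dist (q + s *\<^sub>R nu q) z"
    using inS [OF s(1)] by blast
  define x where "x = q - s *\<^sub>R nu q"
  have x: "x \<notin> K" "closest_point K x = q" "infdist x K = s" "reflect x = q + s *\<^sub>R nu q"
    using on_normal_notin [OF q s0] closest_point_on_normal [OF q] infdist_on_normal [OF q] reflect_on_normal [OF q] s0
    by (auto simp: x_def)
  have "\<exists>e>0. ball x e \<subseteq> - K \<and> inj_on reflect (ball x e)"
    by (rule reflect_locally_injective [OF x(1)]) (use s(2) s0 x in auto)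
  then obtain e where e: "e > 0" "ball x e \<subseteq> - K" "inj_on reflect (ball x e)" by blast
  define W where "W = ball x e \<inter> {x. dist (reflect x) y < infdist x K} \<inter> {x. infdist x K < dist (reflect x) z} \<inter> reflect -` interior K"
  have "open W" unfolding W_def
    by (intro open_Int open_ball open_Collect_less continuous_intros continuous_reflect open_vimage open_interior)
  have "W \<subseteq> ball x e" by (auto simp: W_def)
  show ?thesis
  proof (rule that [of "reflect ` W"])
    show "open (reflect ` W)"
      by (rule invariance_of_domain [OF continuous_reflect \<open>open W\<close> inj_on_subset [OF e(3) \<open>W \<subseteq> ball x e\<close>]])
    have "x \<in> W" using e(1) x y z pint by (simp add: W_def)
    then show "reflect ` W \<noteq> {}" by blast
    show "reflect ` W \<subseteq> interior K" by (auto simp: W_def)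
    fix p assume "p \<in> reflect ` W"
    then obtain v where v: "v \<in> W" "p = reflect v" by blast
    have vK: "v \<notin> K" using v(1) e(2) by (auto simp: W_def)
    let ?s = "closest_point K v"
    have pv: "p = ?s + infdist v K *\<^sub>R nu ?s" using reflect_outside [OF vK] v(2) by simp
    have sf: "?s \<in> frontier K" by (rule outside_decomposition(1) [OF vK])
    have d: "dist p ?s = infdist v K" using norm_nu [OF sf] infdist_nonneg [of v K] by (simp add: pv dist_norm)
    show "3 \<le> num_normals K p"
    proof (rule three_normals [OF nb])
      show "p \<in> interior K" using v by (simp add: W_def)
      show "?s \<in> feet p" unfolding feet_def using sf pv by blast
      show "dist p y < dist p ?s" "dist p ?s < dist p z" using v d by (auto simp: W_def)
    qed (use y z frontier_subset in auto)
  qed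
qed

end

section \<open>The mean number of normals of parallel bodies\<close>

context body
begin

lemma parallel_body_lmeasurable: "parallel_body K t \<in> lmeasurable"
  using compact_parallel_body by (rule lmeasurable_compact)

lemma K_lmeasurable: "K \<in> lmeasurable"
  using compact_K by (rule lmeasurable_compact)

lemma AE_not_frontier: "AE p in lebesgue. p \<notin> frontier K"
  using negligible_convex_frontier [OF convex_K]
  by (intro AE_not_in) (simp add: negligible_iff_null_sets)

lemma measure_K_pos: "measure lebesgue K > 0"
proof -
  obtain x e where e: "e > 0" "ball x e \<subseteq> K" using interior_K by (meson all_not_in_conv mem_interior)
  have "0 < measure lebesgue (ball x e)" using e(1) content_ball_pos [of e x] by (simp add: measure_completion)
  also have "\<dots> \<le> measure lebesgue K" using e(2) K_lmeasurable by (intro measure_mono_fmeasurable) auto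
  finally show ?thesis .
qed

lemma measure_parallel_body_strict_mono:
  assumes "0 \<le> s" "s < t"
  shows "measure lebesgue (parallel_body K s) < measure lebesgue (parallel_body K t)"
proof -
  let ?O = "{x. s < infdist x K \<and> infdist x K < t}"
  have op: "open ?O" by (intro open_Collect_conj open_Collect_less continuous_intros)
  have "?O \<noteq> {}"
  proof -
    have "(s + t) / 2 \<in> (\<lambda>x. infdist x K) ` UNIV"
    proof -
      obtain x where x: "x \<in> K" using nonempty_K by blast
      obtain B where B: "\<And>x. x \<in> K \<Longrightarrow> norm x \<le> B" using bounded_K bounded_iff by blast
      obtain u :: 'a where u: "norm u = 1" using vector_choose_size zero_le_one by blast
      have B0: "B \<ge> 0" using B [OF x] norm_ge_zero order_trans by blast
      let ?y = "(B + t) *\<^sub>R u"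
      have "norm ?y = B + t" using u B0 assms by simp
      moreover have "norm ?y \<le> norm (closest_point K ?y) + dist ?y (closest_point K ?y)"
        using norm_triangle_sub [of ?y "closest_point K ?y"] by (simp add: dist_norm)
      ultimately have "infdist ?y K \<ge> t" using B [OF closest_in, of ?y] by (simp add: infdist_eq)
      moreover have "infdist x K = 0" using x by simp
      moreover have "connected ((\<lambda>x. infdist x K) ` UNIV)"
        by (intro connected_continuous_image continuous_intros) auto
      ultimately show ?thesis
        using connectedD_interval [of "(\<lambda>x. infdist x K) ` UNIV" "infdist x K" "infdist ?y K" "(s + t) / 2"] assms by simp
    qed
    then obtain x where "infdist x K = (s + t) / 2" by auto
    then have "x \<in> ?O" using assms by simp
    then show ?thesis by blast
  qed
  then obtain x where "x \<in> ?O" by (meson all_not_in_conv)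
  then obtain e where e: "e > 0" "ball x e \<subseteq> ?O" using op openE by blast
  have disj: "parallel_body K s \<inter> ball x e = {}" using e(2) by (auto simp: parallel_body_def)
  have "measure lebesgue (parallel_body K s) < measure lebesgue (parallel_body K s) + measure lebesgue (ball x e)"
    using e(1) content_ball_pos [of e x] by (simp add: measure_completion)
  also have "\<dots> = measure lebesgue (parallel_body K s \<union> ball x e)"
    by (rule measure_Union [symmetric])
       (use disj fmeasurableD [OF parallel_body_lmeasurable] fmeasurableD2 [OF parallel_body_lmeasurable]
          fmeasurableD2 [OF lmeasurable_ball [of x e]] in auto)
  also have "\<dots> \<le> measure lebesgue (parallel_body K t)"
    using e(2) assms parallel_body_lmeasurable by (intro measure_mono_fmeasurable) (auto simp: parallel_body_def subset_iff)
  finally show ?thesis .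
qed

end

context curved_body
begin

lemma num_normals_parallel_body_eq: "t \<ge> 0 \<Longrightarrow> num_normals (parallel_body K t) p = num_normals K p"
  by (simp add: num_normals_parallel_body num_normals_eq_feet)

text \<open>The frontier is a null set, and each point outside \<open>K\<close> contributes two, so enlarging the domain adds
  twice the volume gained.  The function \<open>N\<close> is the fibre count of the reflection, which makes it
  measurable and integrable.\<close>

lemma normal_integral_parallel_body:
  obtains N :: "'a \<Rightarrow> ennreal" where "N \<in> borel_measurable lebesgue" "(\<integral>\<^sup>+p. N p \<partial>lebesgue) < \<infinity>"
    "\<And>p. p \<in> interior K \<Longrightarrow> N p = num_normals K p" "\<And>p. p \<notin> interior K \<Longrightarrow> N p = 0"
    "\<And>t. t \<ge> 0 \<Longrightarrow> normal_integral (parallel_body K t)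
        = (\<integral>\<^sup>+p. N p \<partial>lebesgue) + 2 * ennreal (measure lebesgue (parallel_body K t) - measure lebesgue K)"
proof -
  obtain B where B: "\<And>x. x \<in> K \<Longrightarrow> norm x \<le> B" using bounded_K bounded_iff by blast
  define A where "A = cball (0::'a) (3 * B) - K"
  define M where "M p = emeasure (count_space UNIV) {x\<in>A. reflect x = p}" for p
  define N where "N p = M p * indicator (interior K) p" for p
  have bA: "bounded A" unfolding A_def by (rule bounded_subset [OF bounded_cball]) auto
  have mA: "A \<in> sets lebesgue" unfolding A_def using K_lmeasurable by (intro sets.Diff) auto
  have M: "M \<in> borel_measurable lebesgue" "(\<integral>\<^sup>+p. M p \<partial>lebesgue) < \<infinity>"
    unfolding M_def using Lipschitz_fibre_count [OF bA mA reflect_lipschitz] by auto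
  have intK: "interior K \<in> sets lebesgue" by (intro sets_completionI_sets) simp
  have N1: "N \<in> borel_measurable lebesgue"
    unfolding N_def by (intro borel_measurable_times_ennreal borel_measurable_indicator M(1) intK)
  have "(\<integral>\<^sup>+p. N p \<partial>lebesgue) \<le> (\<integral>\<^sup>+p. M p \<partial>lebesgue)"
    by (intro nn_integral_mono) (auto simp: N_def indicator_def)
  then have N2: "(\<integral>\<^sup>+p. N p \<partial>lebesgue) < \<infinity>" using M(2) by (rule le_less_trans)
  have N3: "N p = num_normals K p" if p: "p \<in> interior K" for p
  proof -
    have "{x\<in>A. reflect x = p} = {x. x \<notin> K \<and> reflect x = p}"
    proof -
      have "x \<in> cball 0 (3 * B)" if "reflect x = p" for x
      proof -
        have "x = 2 *\<^sub>R closest_point K x - p" using that by (simp add: reflect_def algebra_simps)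
        then have "norm x \<le> 2 * norm (closest_point K x) + norm p"
          by (metis norm_triangle_ineq4 norm_scaleR abs_numeral)
        moreover have "norm p \<le> B" using p interior_subset by (intro B) auto
        ultimately show ?thesis using B [OF closest_in, of x] by simp
      qed
      then show ?thesis by (auto simp: A_def)
    qed
    then show ?thesis using p num_normals_inside [OF p] by (simp add: N_def M_def)
  qed
  have N4: "N p = 0" if "p \<notin> interior K" for p using that by (simp add: N_def)
  have "normal_integral (parallel_body K t)
        = (\<integral>\<^sup>+p. N p \<partial>lebesgue) + 2 * ennreal (measure lebesgue (parallel_body K t) - measure lebesgue K)" if t: "t \<ge> 0" for t
  proof -
    let ?P = "parallel_body K t"
    have sub: "K \<subseteq> ?P" by (rule subset_parallel_body [OF t])
    have Pm: "?P \<in> lmeasurable" by (rule parallel_body_lmeasurable)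
    have Dm: "?P - K \<in> lmeasurable" using Pm K_lmeasurable by (intro fmeasurable.Diff) auto
    have "normal_integral ?P = (\<integral>\<^sup>+p. N p + 2 * indicator (?P - K) p \<partial>lebesgue)"
      unfolding normal_integral_def num_normals_parallel_body_eq [OF t]
    proof (rule nn_integral_cong_AE, rule AE_mp [OF AE_not_frontier], intro AE_I2 impI)
      fix p assume pf: "p \<notin> frontier K"
      show "num_normals K p * indicator ?P p = N p + 2 * indicator (?P - K) p"
      proof (cases "p \<in> K")
        case True
        then have "p \<in> interior K" using pf closure_subset by (auto simp: frontier_def)
        then show ?thesis using True sub N3 by (auto simp: indicator_def)
      next
        case False
        then have "p \<notin> interior K" using interior_subset by blast
        then show ?thesis using False N4 num_normals_outside_2 by (simp add: indicator_def)
      qed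
    qed
    also have "\<dots> = (\<integral>\<^sup>+p. N p \<partial>lebesgue) + (\<integral>\<^sup>+p. 2 * indicator (?P - K) p \<partial>lebesgue)"
      using Dm N1 by (intro nn_integral_add) auto
    also have "(\<integral>\<^sup>+p. 2 * indicator (?P - K) p \<partial>lebesgue) = 2 * emeasure lebesgue (?P - K)"
      using Dm by (intro nn_integral_cmult_indicator) auto
    also have "emeasure lebesgue (?P - K) = ennreal (measure lebesgue (?P - K))"
      using Dm by (simp add: emeasure_eq_measure2)
    also have "measure lebesgue (?P - K) = measure lebesgue ?P - measure lebesgue K"
      using Pm K_lmeasurable sub by (intro measurable_measure_Diff) auto
    finally show ?thesis .
  qed
  with that N1 N2 N3 N4 show ?thesis by blast
qed

text \<open>Nearest and farthest point give two normals at every interior point, and an open set of points has a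
  third one.\<close>

lemma excess_normals:
  assumes nb: "\<nexists>c r. K = cball c r"
    and N: "N \<in> borel_measurable lebesgue" "\<And>p. p \<in> interior K \<Longrightarrow> N p = num_normals K p"
  shows "(\<integral>\<^sup>+p. N p \<partial>lebesgue) > ennreal (2 * measure lebesgue K)"
proof -
  obtain V where V: "open V" "V \<noteq> {}" "V \<subseteq> interior K" "\<And>p. p \<in> V \<Longrightarrow> 3 \<le> num_normals K p"
    using ex_open_three_normals [OF nb] by blast
  obtain x where "x \<in> V" using V(2) by blast
  then obtain e where e: "e > 0" "ball x e \<subseteq> V" using V(1) openE by blast
  have Bm: "ball x e \<in> lmeasurable" by simp
  have "ennreal (2 * measure lebesgue K) < ennreal (2 * measure lebesgue K + measure lebesgue (ball x e))"
    using e(1) content_ball_pos [of e x] by (intro ennreal_lessI) (auto simp: measure_completion add_nonneg_pos)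
  also have "\<dots> = 2 * emeasure lebesgue K + emeasure lebesgue (ball x e)"
    using K_lmeasurable Bm by (simp add: emeasure_eq_measure2 ennreal_mult)
  also have "\<dots> = (\<integral>\<^sup>+p. 2 * indicator K p \<partial>lebesgue) + (\<integral>\<^sup>+p. indicator (ball x e) p \<partial>lebesgue)"
    using K_lmeasurable Bm by (simp add: nn_integral_cmult_indicator nn_integral_indicator)
  also have "\<dots> = (\<integral>\<^sup>+p. 2 * indicator K p + indicator (ball x e) p \<partial>lebesgue)"
    by (intro nn_integral_add [symmetric] borel_measurable_times_ennreal borel_measurable_const
        borel_measurable_indicator fmeasurableD K_lmeasurable Bm)
  also have "\<dots> \<le> (\<integral>\<^sup>+p. N p \<partial>lebesgue)"
  proof (rule nn_integral_mono_AE, rule AE_mp [OF AE_not_frontier], intro AE_I2 impI)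
    fix p assume pf: "p \<notin> frontier K"
    show "2 * indicator K p + indicator (ball x e) p \<le> N p"
    proof (cases "p \<in> K")
      case True
      then have pi: "p \<in> interior K" using pf closure_subset by (auto simp: frontier_def)
      show ?thesis
      proof (cases "p \<in> ball x e")
        case True
        then have "3 \<le> num_normals K p" using V(4) e(2) by blast
        then show ?thesis using N(2) [OF pi] True \<open>p \<in> K\<close> by simp
      next
        case False
        then show ?thesis using N(2) [OF pi] \<open>p \<in> K\<close> two_normals [OF nb pi] by simp
      qed
    next
      case False
      then have "p \<notin> ball x e" using e(2) V(3) interior_subset by blast
      then show ?thesis using False by simp
    qed
  qed
  finally show ?thesis .
qed

theorem mean_normals_strict_antimono:
  assumes nb: "\<nexists>c r. K = cball c r" and st: "0 \<le> s" "s < t"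
  shows "mean_normals (parallel_body K t) < mean_normals (parallel_body K s)"
proof -
  obtain N :: "'a \<Rightarrow> ennreal" where N: "N \<in> borel_measurable lebesgue" "(\<integral>\<^sup>+p. N p \<partial>lebesgue) < \<infinity>"
    "\<And>p. p \<in> interior K \<Longrightarrow> N p = num_normals K p"
    and I: "\<And>t. t \<ge> 0 \<Longrightarrow> normal_integral (parallel_body K t)
        = (\<integral>\<^sup>+p. N p \<partial>lebesgue) + 2 * ennreal (measure lebesgue (parallel_body K t) - measure lebesgue K)"
    using normal_integral_parallel_body by metis
  define V where "V t = measure lebesgue (parallel_body K t)" for t
  define W where "W = measure lebesgue K"
  obtain i where i: "i \<ge> 0" "(\<integral>\<^sup>+p. N p \<partial>lebesgue) = ennreal i"
    using N(2) by (cases "\<integral>\<^sup>+p. N p \<partial>lebesgue") auto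
  have ex: "i > 2 * W"
    using excess_normals [OF nb N(1,3)] i unfolding W_def by (simp add: ennreal_less_iff)
  have VW: "W \<le> V t" if "t \<ge> 0" for t
    unfolding V_def W_def using K_lmeasurable parallel_body_lmeasurable subset_parallel_body [OF that]
    by (intro measure_mono_fmeasurable) auto
  have W0: "W > 0" unfolding W_def by (rule measure_K_pos)
  have mean: "mean_normals (parallel_body K t) = ennreal ((i - 2 * W) / V t + 2)" if t: "t \<ge> 0" for t
  proof -
    have Vt: "V t > 0" "V t \<ge> W" using VW [OF t] W0 by auto
    have "normal_integral (parallel_body K t) = ennreal i + 2 * ennreal (V t - W)"
      using I [OF t] i by (simp add: V_def W_def)
    also have "2 * ennreal (V t - W) = ennreal (2 * (V t - W))"
      using Vt ennreal_mult [of 2 "V t - W"] by simp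
    also have "ennreal i + ennreal (2 * (V t - W)) = ennreal (i + 2 * (V t - W))"
      using i Vt by (intro ennreal_plus [symmetric]) auto
    finally have "mean_normals (parallel_body K t) = ennreal (i + 2 * (V t - W)) / ennreal (V t)"
      unfolding mean_normals_def V_def using parallel_body_lmeasurable by (simp add: emeasure_eq_measure2)
    also have "\<dots> = ennreal ((i + 2 * (V t - W)) / V t)" by (rule divide_ennreal) (use i Vt in auto)
    also have "(i + 2 * (V t - W)) / V t = (i - 2 * W) / V t + 2" using Vt by (simp add: field_simps)
    finally show ?thesis .
  qed
  have "V s < V t" unfolding V_def by (rule measure_parallel_body_strict_mono [OF st])
  moreover have "V s > 0" using VW [OF st(1)] W0 by simp
  ultimately have "(i - 2 * W) / V t < (i - 2 * W) / V s" using ex by (intro divide_strict_left_mono) auto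
  moreover have "(i - 2 * W) / V t \<ge> 0" using ex \<open>V s < V t\<close> \<open>V s > 0\<close> by simp
  ultimately have "ennreal ((i - 2 * W) / V t + 2) < ennreal ((i - 2 * W) / V s + 2)" by (intro ennreal_lessI) auto
  then show ?thesis using mean st by simp
qed

end

text \<open>Every normal of a ball passes through its centre, so the feet of the normals through another
  point are the two ends of a diameter.\<close>

theorem (in C2_body) mean_normals_ball:
  assumes K: "K = cball c r" and t: "t \<ge> 0"
  shows "mean_normals (parallel_body K t) = 2"
proof -
  have r: "r > 0" using interior_K K by auto
  have fr: "frontier K = sphere c r" using K by simp
  have nuq: "nu q = (c - q) /\<^sub>R r" if q: "q \<in> frontier K" for q
  proof -
    have d: "norm (c - q) = r" using q fr by (simp add: dist_norm)
    have "c = q + dist c q *\<^sub>R nu q"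
      by (rule farthest_support) (use d K r q fr in \<open>auto simp: dist_norm\<close>)
    then have "c - q = r *\<^sub>R nu q" using d by (simp add: dist_norm algebra_simps)
    then show ?thesis using r by simp
  qed
  have two: "num_normals K p = 2" if p: "p \<noteq> c" for p
  proof -
    define u where "u = (p - c) /\<^sub>R norm (p - c)"
    have u: "norm u = 1" "p - c = norm (p - c) *\<^sub>R u" using p by (auto simp: u_def)
    have "feet p = {c + r *\<^sub>R u, c - r *\<^sub>R u}"
    proof (intro set_eqI iffI)
      fix q assume "q \<in> feet p"
      then obtain s where q: "q \<in> frontier K" and s: "p = q + s *\<^sub>R nu q" by (auto simp: feet_def)
      have d: "norm (q - c) = r" using q fr by (simp add: dist_norm norm_minus_commute)
      define k where "k = 1 - s / r"
      have pk: "p - c = k *\<^sub>R (q - c)"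
        unfolding k_def using s nuq [OF q] r by (simp add: algebra_simps divide_inverse)
      have k0: "k \<noteq> 0" using pk p by auto
      have "norm (p - c) = \<bar>k\<bar> * r" using pk d by simp
      then have "u = (k / \<bar>k\<bar>) *\<^sub>R ((1 / r) *\<^sub>R (q - c))" using pk k0 r by (simp add: u_def divide_inverse)
      then have "r *\<^sub>R u = (k / \<bar>k\<bar>) *\<^sub>R (q - c)" using r by simp
      moreover have "k / \<bar>k\<bar> = 1 \<or> k / \<bar>k\<bar> = - 1" using k0 by (cases "k > 0") auto
      ultimately have "r *\<^sub>R u = q - c \<or> r *\<^sub>R u = c - q" by auto
      then show "q \<in> {c + r *\<^sub>R u, c - r *\<^sub>R u}" by (auto simp: algebra_simps)
    next
      fix q assume "q \<in> {c + r *\<^sub>R u, c - r *\<^sub>R u}"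
      then have "q = c + (1 * r) *\<^sub>R u \<or> q = c + (- 1 * r) *\<^sub>R u" by auto
      then obtain \<sigma> :: real where \<sigma>: "\<sigma> = 1 \<or> \<sigma> = - 1" "q = c + (\<sigma> * r) *\<^sub>R u" by blast
      have q: "q \<in> frontier K" using fr u r \<sigma> by (auto simp: dist_norm)
      have "nu q = - (\<sigma> *\<^sub>R u)" using nuq [OF q] \<sigma>(2) r by simp
      moreover have "p = c + norm (p - c) *\<^sub>R u" using u(2) by (simp add: algebra_simps)
      ultimately have "p = q + (r - \<sigma> * norm (p - c)) *\<^sub>R nu q" using \<sigma> by (auto simp: algebra_simps)
      then show "q \<in> feet p" using q unfolding feet_def by blast
    qed
    moreover have "c + r *\<^sub>R u \<noteq> c - r *\<^sub>R u"
    proof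
      assume "c + r *\<^sub>R u = c - r *\<^sub>R u"
      then have "(2 * r) *\<^sub>R u = 0" by (simp add: algebra_simps scaleR_2 flip: scaleR_scaleR)
      then show False using r u(1) by auto
    qed
    ultimately show ?thesis unfolding num_normals_eq_feet by (simp add: emeasure_count_space)
  qed
  let ?P = "parallel_body K t"
  have Pm: "?P \<in> lmeasurable" by (rule parallel_body_lmeasurable)
  have "AE p in lebesgue. p \<noteq> c"
    by (intro AE_not_in [of "{c}", simplified]) (simp add: negligible_iff_null_sets [symmetric])
  then have "normal_integral ?P = (\<integral>\<^sup>+p. 2 * indicator ?P p \<partial>lebesgue)"
    unfolding normal_integral_def num_normals_parallel_body [OF t] num_normals_eq_feet [symmetric]
    by (intro nn_integral_cong_AE) (auto simp: two)
  also have "\<dots> = 2 * emeasure lebesgue ?P" using Pm by (intro nn_integral_cmult_indicator) auto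
  finally have I: "normal_integral ?P = 2 * emeasure lebesgue ?P" .
  have "measure lebesgue ?P \<ge> measure lebesgue K"
    using K_lmeasurable Pm subset_parallel_body [OF t] by (intro measure_mono_fmeasurable) auto
  then have V: "measure lebesgue ?P > 0" using measure_K_pos by simp
  have "emeasure lebesgue ?P = ennreal (measure lebesgue ?P)" using Pm by (simp add: emeasure_eq_measure2)
  then have e: "emeasure lebesgue ?P \<noteq> 0" "emeasure lebesgue ?P \<noteq> top" using V by auto
  then show ?thesis unfolding mean_normals_def I
    by (simp add: ennreal_mult_divide_eq)
qed

theorem theorem4:
  fixes K :: "'a::euclidean_space set"
    and C N :: "'a \<Rightarrow> real \<Rightarrow> 'a"
    and T :: real
    and Kt :: "real \<Rightarrow> 'a set"
  assumes "DIM('a) \<ge> 2"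
    and "convex_body K"
    and "C2_hypersurface (frontier K)"
    and "centres_of_curvature K \<subseteq> K"
    and "T > 0"
    and "outer_normal_flow T (frontier K) C N"
    and "\<And>t. Kt t = enclosed_body ((\<lambda>u. C u t) ` sphere 0 1)"
  shows "(\<forall>t\<in>{0..<T}. convex_body (Kt t) \<and> frontier (Kt t) = (\<lambda>u. C u t) ` sphere 0 1) \<and>
         ((\<nexists>c r. K = cball c r) \<longrightarrow> strict_antimono_on {0..<T} (\<lambda>t. mean_normals (Kt t))) \<and>
         ((\<exists>c r. K = cball c r) \<longrightarrow> (\<forall>t\<in>{0..<T}. mean_normals (Kt t) = 2))"
proof -
  interpret curved_body K
    using assms(1-4) by unfold_locales
  have Kt: "Kt t = parallel_body K t" if "t \<in> {0..<T}" for t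
    using flow_parallel_body(2) [OF assms(6) that] assms(7) by simp
  have "convex_body (Kt t) \<and> frontier (Kt t) = (\<lambda>u. C u t) ` sphere 0 1" if "t \<in> {0..<T}" for t
    using convex_body_parallel_body [of t] flow_parallel_body(1) [OF assms(6) that] Kt [OF that] that by simp
  moreover have "strict_antimono_on {0..<T} (\<lambda>t. mean_normals (Kt t))" if nb: "\<nexists>c r. K = cball c r"
  proof (rule monotone_onI)
    fix s t assume "s \<in> {0..<T}" "t \<in> {0..<T}" "s < t"
    then show "mean_normals (Kt s) > mean_normals (Kt t)"
      using mean_normals_strict_antimono [OF nb, of s t] Kt by simp
  qed
  moreover have "mean_normals (Kt t) = 2" if "\<exists>c r. K = cball c r" "t \<in> {0..<T}" for t
    using that mean_normals_ball Kt [OF that(2)] by auto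
  ultimately show ?thesis by blast
qed

end
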